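(* For every decorated representation $\mathcal{M}=(M,\mathbf{v})$ of $\Lambda$ which is supported in $[n]$, the vector formed with the first $n$ entries of the extended $\mathbf g$-vector $\widetilde{\mathbf g}_{\mathcal M}^{\widetilde\Lambda}\in\mathbb Z^{n+m}$ is precisely the $\mathbf g$-vector $\mathbf g_{\mathcal M}^{\Lambda}\in\mathbb Z^n$.
   Context: Let $n\ge 1$, $m\ge 0$ be integers and $[\ell]=\{1,\dots,\ell\}$. Let $\widetilde Q$ be a finite quiver with vertex set $[n+m]$ and arrows $a\colon s(a)\to t(a)$; $Q$ is the quiver with the same vertex set $[n+m]$ whose arrows are the arrows of $\widetilde Q$ with both endpoints in $[n]$. Paths are composed from right to left. $\mathbb C\langle\langle \widetilde Q\rangle\rangle$ and $\mathbb C\langle\langle Q\rangle\rangle$ are the complete path algebras, with arrow ideals $\widetilde{\mathfrak m}$, $\mathfrak m$ and the corresponding adic topologies. $\widehat\rho\colon \mathbb C\langle\langle \widetilde Q\rangle\rangle\to\mathbb C\langle\langle Q\rangle\rangle$ is the continuous $\mathbb C$-algebra homomorphism that is the identity on vertex idempotents and on arrows of $Q$ and sends all other arrows to $0$. $\widetilde{\mathcal J}\subseteq\widetilde{\mathfrak m}^2$ is a closed two-sided ideal, $\mathcal J:=\widehat\rho(\widetilde{\mathcal J})\subseteq \mathfrak m^2$, $\widetilde\Lambda:=\mathbb C\langle\langle \widetilde Q\rangle\rangle/\widetilde{\mathcal J}$ and $\Lambda:=\mathbb C\langle\langle Q\rangle\rangle/\mathcal J$ (neither is assumed finite-dimensional).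 Via $\widehat\rho$, every left $\Lambda$-module is a left $\widetilde\Lambda$-module. A decorated representation of $\Lambda$ is a pair $\mathcal M=(M,\mathbf v)$ with $M$ a finite-dimensional left $\Lambda$-module and $\mathbf v=(v_j)_{j\in[n+m]}\in\mathbb Z_{\ge0}^{n+m}$; it is supported in $[n]$ if $M_j=0$ and $v_j=0$ for all $j\in\{n+1,\dots,n+m\}$. $S(i)$ is the simple module at vertex $i$. For $\mathcal M$ supported in $[n]$, $\mathbf g_{\mathcal M}^\Lambda=(g_i)_{i=1}^n$ and $\widetilde{\mathbf g}_{\mathcal M}^{\widetilde\Lambda}=(\widetilde g_i)_{i=1}^{n+m}$ are defined by $$g_i=-\dim_{\mathbb C}\mathrm{Hom}_\Lambda(S(i),M)+\dim_{\mathbb C}\mathrm{Ext}^1_\Lambda(S(i),M)+v_i\quad (i\in[n]),$$ $$\widetilde g_i=-\dim_{\mathbb C}\mathrm{Hom}_{\widetilde\Lambda}(S(i),M)+\dim_{\mathbb C}\mathrm{Ext}^1_{\widetilde\Lambda}(S(i),M)+v_i\quad (i\in[n+m]).$$ *)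

theory Defs
  imports
    "HOL-Algebra.QuotRing"
    "HOL-Algebra.Ideal_Product"
    "HOL-Analysis.Abstract_Topology"
    "Graph_Theory.Arc_Walk"
    "Jordan_Normal_Form.VS_Connect"
begin

section \<open>Complete path algebras\<close>

text \<open>
  A finite quiver is a \<^locale>\<open>fin_digraph\<close> (loops and parallel arrows are allowed there), with
  \<^const>\<open>tail\<close> and \<^const>\<open>head\<close> as source and target.
  A path is a triple (source, arrows, target); the arrows are listed in the order in which they
  are traversed, and \<open>(v, [], v)\<close> is the trivial path at \<open>v\<close>.
\<close>

type_synonym ('v, 'a) qpath = "'v \<times> 'a list \<times> 'v"

definition qpaths :: "('v, 'a) pre_digraph \<Rightarrow> ('v, 'a) qpath set" where
  "qpaths Q = {(u, p, w). pre_digraph.awalk Q u p w}"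

abbreviation psource :: "('v, 'a) qpath \<Rightarrow> 'v" where "psource q \<equiv> fst q"
abbreviation parrows :: "('v, 'a) qpath \<Rightarrow> 'a list" where "parrows q \<equiv> fst (snd q)"
abbreviation ptarget :: "('v, 'a) qpath \<Rightarrow> 'v" where "ptarget q \<equiv> snd (snd q)"

text \<open>Composition from right to left: \<open>pcomp q r\<close> is first \<open>r\<close>, then \<open>q\<close>.\<close>

definition pcomp :: "('v, 'a) qpath \<Rightarrow> ('v, 'a) qpath \<Rightarrow> ('v, 'a) qpath" where
  "pcomp q r = (psource r, parrows r @ parrows q, ptarget q)"

definition pfactors :: "('v, 'a) pre_digraph \<Rightarrow> ('v, 'a) qpath \<Rightarrow> (('v, 'a) qpath \<times> ('v, 'a) qpath) set" where
  "pfactors Q x =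
    {(q, r). q \<in> qpaths Q \<and> r \<in> qpaths Q \<and> psource q = ptarget r \<and> pcomp q r = x}"

text \<open>Elements are the formal, possibly infinite, complex linear combinations of paths.\<close>

definition cpa :: "('v, 'a) pre_digraph \<Rightarrow> (('v, 'a) qpath \<Rightarrow> complex) ring" where
  "cpa Q = \<lparr>carrier = {f. \<forall>x. x \<notin> qpaths Q \<longrightarrow> f x = 0},
            mult = (\<lambda>f g x. \<Sum>(q, r)\<in>pfactors Q x. f q * g r),
            one = (\<lambda>x. if x \<in> qpaths Q \<and> parrows x = [] then 1 else 0),
            zero = (\<lambda>x. 0),
            add = (\<lambda>f g x. f x + g x)\<rparr>"

definition path_elem :: "('v, 'a) qpath \<Rightarrow> (('v, 'a) qpath \<Rightarrow> complex)" where
  "path_elem q = (\<lambda>x. if x = q then 1 else 0)"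

definition idem_elem :: "'v \<Rightarrow> (('v, 'a) qpath \<Rightarrow> complex)" where
  "idem_elem i = path_elem (i, [], i)"

definition arrow_elem :: "('v, 'a) pre_digraph \<Rightarrow> 'a \<Rightarrow> (('v, 'a) qpath \<Rightarrow> complex)" where
  "arrow_elem Q a = path_elem (tail Q a, [a], head Q a)"

definition arrow_ideal :: "('v, 'a) pre_digraph \<Rightarrow> (('v, 'a) qpath \<Rightarrow> complex) set" where
  "arrow_ideal Q = Idl\<^bsub>cpa Q\<^esub> (arrow_elem Q ` arcs Q)"

fun ideal_power :: "('r, 'b) ring_scheme \<Rightarrow> 'r set \<Rightarrow> nat \<Rightarrow> 'r set" where
  "ideal_power R I 0 = carrier R"
| "ideal_power R I (Suc k) = ideal_prod R I (ideal_power R I k)"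

definition adic_topology :: "('r, 'b) ring_scheme \<Rightarrow> 'r set \<Rightarrow> 'r topology" where
  "adic_topology R I =
    topology (\<lambda>U. U \<subseteq> carrier R \<and> (\<forall>x\<in>U. \<exists>k. ideal_power R I k +>\<^bsub>R\<^esub> x \<subseteq> U))"

abbreviation cpa_topology :: "('v, 'a) pre_digraph \<Rightarrow> (('v, 'a) qpath \<Rightarrow> complex) topology" where
  "cpa_topology Q \<equiv> adic_topology (cpa Q) (arrow_ideal Q)"

text \<open>The quiver with the same vertices as \<open>Q\<close> and the arrows of \<open>Q\<close> with both endpoints in \<open>V\<close>.\<close>

definition arrow_restrict :: "('v, 'a) pre_digraph \<Rightarrow> 'v set \<Rightarrow> ('v, 'a) pre_digraph" where
  "arrow_restrict Q V = Q\<lparr>arcs := {a \<in> arcs Q. tail Q a \<in> V \<and> head Q a \<in> V}\<rparr>"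

text \<open>
  \<open>is_restriction_hom Q' Q \<rho>\<close>: for a subquiver \<open>Q\<close> of \<open>Q'\<close> with the same vertices, \<open>\<rho>\<close> is the
  continuous algebra homomorphism that fixes the idempotents and the arrows of \<open>Q\<close> and kills
  the other arrows.
\<close>

definition is_restriction_hom ::
  "('v, 'a) pre_digraph \<Rightarrow> ('v, 'a) pre_digraph \<Rightarrow>
   ((('v, 'a) qpath \<Rightarrow> complex) \<Rightarrow> (('v, 'a) qpath \<Rightarrow> complex)) \<Rightarrow> bool" where
  "is_restriction_hom Q' Q \<rho> \<longleftrightarrow>
     \<rho> \<in> Ring.ring_hom (cpa Q') (cpa Q) \<and>
     (\<forall>c. \<forall>f\<in>carrier (cpa Q'). \<rho> (\<lambda>x. c * f x) = (\<lambda>x. c * \<rho> f x)) \<and>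
     continuous_map (cpa_topology Q') (cpa_topology Q) \<rho> \<and>
     (\<forall>i\<in>verts Q'. \<rho> (idem_elem i) = idem_elem i) \<and>
     (\<forall>a\<in>arcs Q. \<rho> (arrow_elem Q' a) = arrow_elem Q a) \<and>
     (\<forall>a\<in>arcs Q' - arcs Q. \<rho> (arrow_elem Q' a) = \<zero>\<^bsub>cpa Q\<^esub>)"


section \<open>Left modules, Hom and Ext\<close>

text \<open>The library locale \<^locale>\<open>module\<close> requires a commutative ring of scalars.\<close>

locale left_module = R?: ring R + M?: abelian_group M
    for R :: "('r, 'b) ring_scheme" (structure) and M :: "('r, 'm, 'c) module_scheme" (structure) +
  assumes smult_closed:
      "\<lbrakk>a \<in> carrier R; x \<in> carrier M\<rbrakk> \<Longrightarrow> a \<odot>\<^bsub>M\<^esub> x \<in> carrier M"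
    and smult_l_distr:
      "\<lbrakk>a \<in> carrier R; b \<in> carrier R; x \<in> carrier M\<rbrakk> \<Longrightarrow>
       (a \<oplus> b) \<odot>\<^bsub>M\<^esub> x = a \<odot>\<^bsub>M\<^esub> x \<oplus>\<^bsub>M\<^esub> b \<odot>\<^bsub>M\<^esub> x"
    and smult_r_distr:
      "\<lbrakk>a \<in> carrier R; x \<in> carrier M; y \<in> carrier M\<rbrakk> \<Longrightarrow>
       a \<odot>\<^bsub>M\<^esub> (x \<oplus>\<^bsub>M\<^esub> y) = a \<odot>\<^bsub>M\<^esub> x \<oplus>\<^bsub>M\<^esub> a \<odot>\<^bsub>M\<^esub> y"
    and smult_assoc1:
      "\<lbrakk>a \<in> carrier R; b \<in> carrier R; x \<in> carrier M\<rbrakk> \<Longrightarrow>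
       (a \<otimes> b) \<odot>\<^bsub>M\<^esub> x = a \<odot>\<^bsub>M\<^esub> (b \<odot>\<^bsub>M\<^esub> x)"
    and smult_one: "x \<in> carrier M \<Longrightarrow> \<one> \<odot>\<^bsub>M\<^esub> x = x"

text \<open>The record fields \<^const>\<open>mult\<close> and \<^const>\<open>one\<close> of a module carry no meaning.\<close>

definition restrict_scalars :: "('r \<Rightarrow> 's) \<Rightarrow> ('s, 'm) module \<Rightarrow> ('r, 'm) module" where
  "restrict_scalars h M =
     \<lparr>carrier = carrier M, mult = mult M, one = one M, zero = zero M, add = add M,
      smult = (\<lambda>r x. h r \<odot>\<^bsub>M\<^esub> x)\<rparr>"

definition quotient_module :: "('k, 'm) module \<Rightarrow> 'm set \<Rightarrow> ('k, 'm set) module" where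
  "quotient_module V U =
     \<lparr>carrier = a_rcosets\<^bsub>V\<^esub> U, mult = undefined, one = undefined,
      zero = U, add = set_add V,
      smult = (\<lambda>c X. \<Union>x\<in>X. U +>\<^bsub>V\<^esub> (c \<odot>\<^bsub>V\<^esub> x))\<rparr>"

text \<open>
  A complex algebra is given by a ring \<open>R\<close> and its structure map \<open>\<eta>\<close> from the complex numbers
  to the centre of \<open>R\<close>.  Then \<open>Hom\<^sub>R(N, M)\<close> is a complex vector space.  Its elements are
  extensional (\<^const>\<open>undefined\<close> outside the carrier of \<open>N\<close>), so that they are determined by
  their values on \<open>N\<close>.
\<close>

definition hom_space ::
  "(complex \<Rightarrow> 'r) \<Rightarrow> ('r, 'b) ring_scheme \<Rightarrow> ('r, 'n) module \<Rightarrow> ('r, 'm) module \<Rightarrow>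
   (complex, 'n \<Rightarrow> 'm) module" where
  "hom_space \<eta> R N M =
     \<lparr>carrier = module_hom R N M \<inter> extensional (carrier N),
      mult = undefined, one = undefined,
      zero = (\<lambda>x\<in>carrier N. \<zero>\<^bsub>M\<^esub>),
      add = (\<lambda>f g. \<lambda>x\<in>carrier N. f x \<oplus>\<^bsub>M\<^esub> g x),
      smult = (\<lambda>c f. \<lambda>x\<in>carrier N. \<eta> c \<odot>\<^bsub>M\<^esub> f x)\<rparr>"

definition free_module :: "('r, 'b) ring_scheme \<Rightarrow> 'n set \<Rightarrow> ('r, 'n \<Rightarrow> 'r) module" where
  "free_module R X =
     \<lparr>carrier = {f. (\<forall>x\<in>X. f x \<in> carrier R) \<and> (\<forall>x. x \<notin> X \<longrightarrow> f x = \<zero>\<^bsub>R\<^esub>) \<and>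
                    finite {x. f x \<noteq> \<zero>\<^bsub>R\<^esub>}},
      mult = undefined, one = undefined,
      zero = (\<lambda>x. \<zero>\<^bsub>R\<^esub>),
      add = (\<lambda>f g x. f x \<oplus>\<^bsub>R\<^esub> g x),
      smult = (\<lambda>r f x. r \<otimes>\<^bsub>R\<^esub> f x)\<rparr>"

text \<open>The canonical surjection from the free module on the set \<open>N\<close> to the module \<open>N\<close>.\<close>

definition free_cover ::
  "('r, 'b) ring_scheme \<Rightarrow> ('r, 'n) module \<Rightarrow> ('n \<Rightarrow> 'r) \<Rightarrow> 'n" where
  "free_cover R N f = (\<Oplus>\<^bsub>N\<^esub>x\<in>{x \<in> carrier N. f x \<noteq> \<zero>\<^bsub>R\<^esub>}. f x \<odot>\<^bsub>N\<^esub> x)"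

definition syzygy ::
  "('r, 'b) ring_scheme \<Rightarrow> ('r, 'n) module \<Rightarrow> ('r, 'n \<Rightarrow> 'r) module" where
  "syzygy R N = (free_module R (carrier N))
     \<lparr>carrier := {f \<in> carrier (free_module R (carrier N)). free_cover R N f = \<zero>\<^bsub>N\<^esub>}\<rparr>"

text \<open>
  \<open>Ext\<^sup>1\<^sub>R(N, M)\<close> is the first cohomology of \<open>Hom\<^sub>R(P, M)\<close>, where \<open>P\<close> is the canonical free
  resolution of \<open>N\<close>: \<open>P\<^sub>0\<close> is the free module on the set \<open>N\<close>, \<open>P\<^sub>1\<close> the free module on the
  kernel of \<open>P\<^sub>0 \<rightarrow> N\<close>, and \<open>P\<^sub>2\<close> the free module on the kernel of \<open>P\<^sub>1 \<rightarrow> P\<^sub>0\<close>.  The differential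
  \<open>P\<^sub>k\<^sub>+\<^sub>1 \<rightarrow> P\<^sub>k\<close> is \<^const>\<open>free_cover\<close> followed by the inclusion of the syzygy.
\<close>

definition ext1 ::
  "(complex \<Rightarrow> 'r) \<Rightarrow> ('r, 'b) ring_scheme \<Rightarrow> ('r, 'n) module \<Rightarrow> ('r, 'm) module \<Rightarrow>
   (complex, ((('n \<Rightarrow> 'r) \<Rightarrow> 'r) \<Rightarrow> 'm) set) module" where
  "ext1 \<eta> R N M =
     (let K\<^sub>0 = syzygy R N; K\<^sub>1 = syzygy R K\<^sub>0;
          P\<^sub>0 = free_module R (carrier N);
          P\<^sub>1 = free_module R (carrier K\<^sub>0);
          P\<^sub>2 = free_module R (carrier K\<^sub>1);
          d\<^sub>1 = free_cover R K\<^sub>0; d\<^sub>2 = free_cover R K\<^sub>1;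
          Z = {\<phi> \<in> carrier (hom_space \<eta> R P\<^sub>1 M). \<forall>y\<in>carrier P\<^sub>2. \<phi> (d\<^sub>2 y) = \<zero>\<^bsub>M\<^esub>};
          B = (\<lambda>\<psi>. \<lambda>x\<in>carrier P\<^sub>1. \<psi> (d\<^sub>1 x)) ` carrier (hom_space \<eta> R P\<^sub>0 M)
      in quotient_module ((hom_space \<eta> R P\<^sub>1 M)\<lparr>carrier := Z\<rparr>) B)"

abbreviation cdim :: "(complex, 'm) module \<Rightarrow> nat" where
  "cdim V \<equiv> vectorspace.dim class_ring V"


section \<open>Decorated representations and g-vectors\<close>

text \<open>Below, the algebra is the quotient of the complete path algebra of \<open>Q\<close> by the ideal \<open>J\<close>.\<close>

abbreviation qalg ::
  "('v, 'a) pre_digraph \<Rightarrow> (('v, 'a) qpath \<Rightarrow> complex) set \<Rightarrow> (('v, 'a) qpath \<Rightarrow> complex) set ring" where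
  "qalg Q J \<equiv> cpa Q Quot J"

definition qalg_scalar ::
  "('v, 'a) pre_digraph \<Rightarrow> (('v, 'a) qpath \<Rightarrow> complex) set \<Rightarrow> complex \<Rightarrow> (('v, 'a) qpath \<Rightarrow> complex) set" where
  "qalg_scalar Q J c = J +>\<^bsub>cpa Q\<^esub> (\<lambda>x. c * \<one>\<^bsub>cpa Q\<^esub> x)"

text \<open>
  The simple module at \<open>i\<close>: the complex numbers, on which an element of the algebra acts by the
  coefficient of the trivial path at \<open>i\<close>.  This coefficient is constant on the cosets of an
  ideal contained in the arrow ideal.
\<close>

definition simple_module :: "'v \<Rightarrow> ((('v, 'a) qpath \<Rightarrow> complex) set, complex) module" where
  "simple_module i =
     \<lparr>carrier = UNIV, mult = undefined, one = undefined, zero = 0, add = (+),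
      smult = (\<lambda>X z. the_elem ((\<lambda>f. f (i, [], i)) ` X) * z)\<rparr>"

definition vertex_space ::
  "('v, 'a) pre_digraph \<Rightarrow> (('v, 'a) qpath \<Rightarrow> complex) set \<Rightarrow>
   ((('v, 'a) qpath \<Rightarrow> complex) set, 'm) module \<Rightarrow> 'v \<Rightarrow> 'm set" where
  "vertex_space Q J M j = (\<lambda>x. (J +>\<^bsub>cpa Q\<^esub> idem_elem j) \<odot>\<^bsub>M\<^esub> x) ` carrier M"

type_synonym ('v, 'a, 'm) decorated =
  "((('v, 'a) qpath \<Rightarrow> complex) set, 'm) module \<times> ('v \<Rightarrow> nat)"

definition decorated_rep ::
  "('v, 'a) pre_digraph \<Rightarrow> (('v, 'a) qpath \<Rightarrow> complex) set \<Rightarrow> ('v, 'a, 'm) decorated \<Rightarrow> bool" where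
  "decorated_rep Q J \<M> \<longleftrightarrow>
     left_module (qalg Q J) (fst \<M>) \<and>
     vectorspace.fin_dim class_ring (restrict_scalars (qalg_scalar Q J) (fst \<M>))"

definition supported_in ::
  "('v, 'a) pre_digraph \<Rightarrow> (('v, 'a) qpath \<Rightarrow> complex) set \<Rightarrow> 'v set \<Rightarrow> ('v, 'a, 'm) decorated \<Rightarrow> bool" where
  "supported_in Q J V \<M> \<longleftrightarrow>
     (\<forall>j\<in>verts Q - V. vertex_space Q J (fst \<M>) j = {\<zero>\<^bsub>fst \<M>\<^esub>} \<and> snd \<M> j = 0)"

text \<open>The g-vector with entries indexed by \<open>V\<close>.\<close>

definition g_vector ::
  "('v, 'a) pre_digraph \<Rightarrow> (('v, 'a) qpath \<Rightarrow> complex) set \<Rightarrow> 'v set \<Rightarrow> ('v, 'a, 'm) decorated \<Rightarrow>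
   'v \<Rightarrow> int" where
  "g_vector Q J V \<M> = (\<lambda>i\<in>V.
     - int (cdim (hom_space (qalg_scalar Q J) (qalg Q J) (simple_module i) (fst \<M>)))
     + int (cdim (ext1 (qalg_scalar Q J) (qalg Q J) (simple_module i) (fst \<M>)))
     + int (snd \<M> i))"

text \<open>
  A representation of the quotient by \<open>\<rho> ` J\<close>, viewed as a representation of the quotient by \<open>J\<close>
  along the homomorphism induced by \<open>\<rho>\<close>.  Since \<open>\<rho>\<close> is additive and cosets of \<open>J\<close> are mapped onto
  cosets of \<open>\<rho> ` J\<close>, the induced homomorphism is just the image under \<open>\<rho>\<close>.
\<close>

definition inflate ::
  "((('v, 'a) qpath \<Rightarrow> complex) \<Rightarrow> (('v, 'a) qpath \<Rightarrow> complex)) \<Rightarrow>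
   ('v, 'a, 'm) decorated \<Rightarrow> ('v, 'a, 'm) decorated" where
  "inflate \<rho> \<M> = (restrict_scalars (\<lambda>X. \<rho> ` X) (fst \<M>), snd \<M>)"


section \<open>Basic facts\<close>

text \<open>
  The complete path algebra is a ring, the family used in \<^const>\<open>adic_topology\<close> is a topology,
  and homomorphisms as in \<^const>\<open>is_restriction_hom\<close> exist.
\<close>

lemma cas_target_unique:
  "pre_digraph.cas G u p v \<Longrightarrow> pre_digraph.cas G u p v' \<Longrightarrow> v = v'"
  by (induction p arbitrary: u) (auto simp: pre_digraph.cas.simps)

lemma cas_append:
  "pre_digraph.cas G u p v \<Longrightarrow> pre_digraph.cas G v q w \<Longrightarrow> pre_digraph.cas G u (p @ q) w"
  by (induction p arbitrary: u) (auto simp: pre_digraph.cas.simps)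

lemma pcomp_qpaths:
  "q \<in> qpaths Q \<Longrightarrow> r \<in> qpaths Q \<Longrightarrow> psource q = ptarget r \<Longrightarrow> pcomp q r \<in> qpaths Q"
  by (auto simp: qpaths_def pcomp_def pre_digraph.awalk_def intro: cas_append)

lemma qpaths_append:
  "(u, p, v) \<in> qpaths Q \<Longrightarrow> (v, q, w) \<in> qpaths Q \<Longrightarrow> (u, p @ q, w) \<in> qpaths Q"
  by (auto simp: qpaths_def pre_digraph.awalk_def intro: cas_append)

lemma finite_pfactors: "finite (pfactors Q x)"
proof (rule finite_imageD)
  show "finite ((\<lambda>(q, r). length (parrows r)) ` pfactors Q x)"
    by (rule finite_subset[of _ "{..length (parrows x)}"]) (auto simp: pfactors_def pcomp_def)
  show "inj_on (\<lambda>(q, r). length (parrows r)) (pfactors Q x)"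
    by (auto simp: inj_on_def pfactors_def pcomp_def qpaths_def pre_digraph.awalk_def
          dest: cas_target_unique)
qed

lemma pfactors_empty: "x \<notin> qpaths Q \<Longrightarrow> pfactors Q x = {}"
  by (auto simp: pfactors_def pcomp_qpaths)

lemma qpaths_trivial:
  "x \<in> qpaths Q \<Longrightarrow> (psource x, [], psource x) \<in> qpaths Q \<and> (ptarget x, [], ptarget x) \<in> qpaths Q"
  if "wf_digraph Q"
proof -
  interpret wf_digraph Q by fact
  assume "x \<in> qpaths Q"
  then show ?thesis
    by (cases x) (auto simp: qpaths_def awalk_Nil_iff)
qed

lemma cpa_one_left:
  assumes "wf_digraph Q" "f \<in> carrier (cpa Q)"
  shows "\<one>\<^bsub>cpa Q\<^esub> \<otimes>\<^bsub>cpa Q\<^esub> f = f"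
proof
  fix x :: "('a, 'b) qpath"
  show "(\<one>\<^bsub>cpa Q\<^esub> \<otimes>\<^bsub>cpa Q\<^esub> f) x = f x"
  proof (cases "x \<in> qpaths Q")
    case False
    with assms(2) show ?thesis by (cases x) (simp add: cpa_def pfactors_empty)
  next
    case True
    let ?y = "((ptarget x, [], ptarget x), x)"
    have y: "?y \<in> pfactors Q x"
      using True qpaths_trivial[OF assms(1) True] by (auto simp: pfactors_def pcomp_def)
    have "(\<one>\<^bsub>cpa Q\<^esub> \<otimes>\<^bsub>cpa Q\<^esub> f) x = (\<Sum>z\<in>pfactors Q x. if z = ?y then f x else 0)"
      unfolding cpa_def
      by (auto intro!: sum.cong simp: pfactors_def pcomp_def qpaths_def pre_digraph.awalk_def
            pre_digraph.cas.simps)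
    then show ?thesis using y by (simp add: finite_pfactors)
  qed
qed

lemma cpa_one_right:
  assumes "wf_digraph Q" "f \<in> carrier (cpa Q)"
  shows "f \<otimes>\<^bsub>cpa Q\<^esub> \<one>\<^bsub>cpa Q\<^esub> = f"
proof
  fix x :: "('a, 'b) qpath"
  show "(f \<otimes>\<^bsub>cpa Q\<^esub> \<one>\<^bsub>cpa Q\<^esub>) x = f x"
  proof (cases "x \<in> qpaths Q")
    case False
    with assms(2) show ?thesis by (cases x) (simp add: cpa_def pfactors_empty)
  next
    case True
    let ?y = "(x, (psource x, [], psource x))"
    have y: "?y \<in> pfactors Q x"
      using True qpaths_trivial[OF assms(1) True] by (auto simp: pfactors_def pcomp_def)
    have "(f \<otimes>\<^bsub>cpa Q\<^esub> \<one>\<^bsub>cpa Q\<^esub>) x = (\<Sum>z\<in>pfactors Q x. if z = ?y then f x else 0)"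
      unfolding cpa_def
      by (auto intro!: sum.cong simp: pfactors_def pcomp_def qpaths_def pre_digraph.awalk_def
            pre_digraph.cas.simps)
    then show ?thesis using y by (simp add: finite_pfactors)
  qed
qed

lemma cpa_assoc:
  "(f \<otimes>\<^bsub>cpa Q\<^esub> g) \<otimes>\<^bsub>cpa Q\<^esub> h = f \<otimes>\<^bsub>cpa Q\<^esub> (g \<otimes>\<^bsub>cpa Q\<^esub> h)"
proof
  fix x :: "('a, 'b) qpath"
  have "((f \<otimes>\<^bsub>cpa Q\<^esub> g) \<otimes>\<^bsub>cpa Q\<^esub> h) x =
    (\<Sum>(y, z)\<in>Sigma (pfactors Q x) (\<lambda>y. pfactors Q (fst y)). f (fst z) * g (snd z) * h (snd y))"
    by (simp add: cpa_def sum_distrib_right case_prod_beta sum.Sigma finite_pfactors)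
  also have "\<dots> =
    (\<Sum>(y, z)\<in>Sigma (pfactors Q x) (\<lambda>y. pfactors Q (snd y)). f (fst y) * (g (fst z) * h (snd z)))"
    by (rule sum.reindex_bij_witness
         [where i = "\<lambda>(y, z). ((pcomp (fst y) (fst z), snd z), (fst y, fst z))"
            and j = "\<lambda>(y, z). ((fst z, pcomp (snd z) (snd y)), (snd z, snd y))"])
       (auto simp: pfactors_def pcomp_def intro: qpaths_append)
  also have "\<dots> = (f \<otimes>\<^bsub>cpa Q\<^esub> (g \<otimes>\<^bsub>cpa Q\<^esub> h)) x"
    by (simp add: cpa_def sum_distrib_left case_prod_beta sum.Sigma finite_pfactors)
  finally show "((f \<otimes>\<^bsub>cpa Q\<^esub> g) \<otimes>\<^bsub>cpa Q\<^esub> h) x = (f \<otimes>\<^bsub>cpa Q\<^esub> (g \<otimes>\<^bsub>cpa Q\<^esub> h)) x" .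
qed

lemma ring_cpa:
  assumes "wf_digraph Q" shows "ring (cpa Q)"
proof (rule ringI)
  show "abelian_group (cpa Q)"
  proof (rule abelian_groupI)
    fix f assume "f \<in> carrier (cpa Q)"
    then show "\<exists>g\<in>carrier (cpa Q). g \<oplus>\<^bsub>cpa Q\<^esub> f = \<zero>\<^bsub>cpa Q\<^esub>"
      by (intro bexI[of _ "\<lambda>x. - f x"]) (auto simp: cpa_def)
  qed (auto simp: cpa_def)
  show "Group.monoid (cpa Q)"
  proof (rule monoidI)
    fix f g assume "f \<in> carrier (cpa Q)" "g \<in> carrier (cpa Q)"
    show "f \<otimes>\<^bsub>cpa Q\<^esub> g \<in> carrier (cpa Q)"
      by (simp add: cpa_def pfactors_empty)
  next
    show "\<one>\<^bsub>cpa Q\<^esub> \<in> carrier (cpa Q)" by (simp add: cpa_def)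
  qed (simp_all add: cpa_assoc cpa_one_left cpa_one_right assms)
qed (auto simp: cpa_def sum.distrib case_prod_beta distrib_left distrib_right)

lemma arrow_elem_carrier:
  assumes "wf_digraph Q" "a \<in> arcs Q" shows "arrow_elem Q a \<in> carrier (cpa Q)"
  using assms
  by (auto simp: cpa_def arrow_elem_def path_elem_def qpaths_def pre_digraph.awalk_def
      pre_digraph.cas.simps wf_digraph_def)

lemma ideal_arrow_ideal: assumes "wf_digraph Q" shows "ideal (arrow_ideal Q) (cpa Q)"
  unfolding arrow_ideal_def
  by (rule ring.genideal_ideal[OF ring_cpa[OF assms]]) (auto simp: arrow_elem_carrier assms)

lemma (in ring) ideal_power_ideal: "ideal I R \<Longrightarrow> ideal (ideal_power R I k) R"
  by (induction k) (simp_all add: oneideal ideal_prod_is_ideal)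

lemma (in ring) ideal_power_antimono:
  assumes "ideal I R" "k \<le> l" shows "ideal_power R I l \<subseteq> ideal_power R I k"
  using assms(2)
proof (induction rule: dec_induct)
  case (step l)
  then show ?case
    using ideal_prod_inter[OF assms(1) ideal_power_ideal[OF assms(1)], of l] by auto
qed simp

lemma (in ring) openin_adic_topology:
  assumes "ideal I R"
  shows "openin (adic_topology R I) U \<longleftrightarrow>
    U \<subseteq> carrier R \<and> (\<forall>x\<in>U. \<exists>k. ideal_power R I k +> x \<subseteq> U)"
proof -
  let ?P = "\<lambda>U. U \<subseteq> carrier R \<and> (\<forall>x\<in>U. \<exists>k. ideal_power R I k +> x \<subseteq> U)"
  have inter: "?P (S \<inter> T)" if S: "?P S" and T: "?P T" for S T
  proof (intro conjI ballI)
    show "S \<inter> T \<subseteq> carrier R" using S by blast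
    fix x assume "x \<in> S \<inter> T"
    then obtain k l where kl: "ideal_power R I k +> x \<subseteq> S" "ideal_power R I l +> x \<subseteq> T"
      using S T by blast
    have "ideal_power R I (max k l) +> x \<subseteq> ideal_power R I k +> x"
      "ideal_power R I (max k l) +> x \<subseteq> ideal_power R I l +> x"
      unfolding a_r_coset_def'
      using ideal_power_antimono[OF assms, of k "max k l"]
        ideal_power_antimono[OF assms, of l "max k l"]
      by force+
    with kl show "\<exists>k. ideal_power R I k +> x \<subseteq> S \<inter> T" by (meson Int_greatest subset_trans)
  qed
  have union: "?P (\<Union>\<K>)" if K: "\<forall>S\<in>\<K>. ?P S" for \<K>
  proof (intro conjI ballI)
    show "\<Union>\<K> \<subseteq> carrier R" using K by blast
    fix x assume "x \<in> \<Union>\<K>"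
    then obtain S where S: "S \<in> \<K>" "x \<in> S" by blast
    with K obtain k where "ideal_power R I k +> x \<subseteq> S" by blast
    with S(1) show "\<exists>k. ideal_power R I k +> x \<subseteq> \<Union>\<K>" by (meson Union_upper subset_trans)
  qed
  have "istopology ?P"
    unfolding istopology_def using inter union by presburger
  then show ?thesis
    unfolding adic_topology_def by (subst topology_inverse') simp_all
qed

lemma (in ring) topspace_adic_topology:
  assumes "ideal I R"
  shows "topspace (adic_topology R I) = carrier R"
proof (rule subset_antisym)
  show "topspace (adic_topology R I) \<subseteq> carrier R"
    using openin_topspace[of "adic_topology R I"] unfolding openin_adic_topology[OF assms] by blast
  have "ideal_power R I 0 +> x \<subseteq> carrier R" if "x \<in> carrier R" for x
    using that by (simp add: a_r_coset_subset_G)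
  then have "openin (adic_topology R I) (carrier R)"
    unfolding openin_adic_topology[OF assms] by blast
  then show "carrier R \<subseteq> topspace (adic_topology R I)"
    by (rule openin_subset)
qed

lemma cpa_arrow_restrict_pfactors:
  assumes "x \<in> qpaths (arrow_restrict Q V)"
  shows "pfactors (arrow_restrict Q V) x = pfactors Q x"
proof -
  have cas: "pre_digraph.cas (arrow_restrict Q V) u p v = pre_digraph.cas Q u p v" for u p v
    by (induction p arbitrary: u) (auto simp: pre_digraph.cas.simps arrow_restrict_def)
  show ?thesis using assms
    by (auto simp: pfactors_def pcomp_def qpaths_def pre_digraph.awalk_def cas)
       (auto simp: arrow_restrict_def)
qed

lemma qpaths_arrow_restrict: "qpaths (arrow_restrict Q V) \<subseteq> qpaths Q"
proof -
  have cas: "pre_digraph.cas (arrow_restrict Q V) u p v = pre_digraph.cas Q u p v" for u p v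
    by (induction p arbitrary: u) (auto simp: pre_digraph.cas.simps arrow_restrict_def)
  show ?thesis
    by (auto simp: qpaths_def pre_digraph.awalk_def cas) (auto simp: arrow_restrict_def)
qed

lemma wf_arrow_restrict: "wf_digraph Q \<Longrightarrow> wf_digraph (arrow_restrict Q V)"
  by (auto simp: wf_digraph_def arrow_restrict_def)

lemma is_restriction_hom_exists:
  fixes Q :: "('v, 'a) pre_digraph"
  assumes wf: "wf_digraph Q"
  shows "\<exists>\<rho>. is_restriction_hom Q (arrow_restrict Q V) \<rho>"
proof
  let ?R = "arrow_restrict Q V"
  define \<rho> where "\<rho> f = (\<lambda>x. if x \<in> qpaths ?R then f x else (0::complex))" for f
  interpret Q: ring "cpa Q" by (rule ring_cpa[OF wf])
  interpret R: ring "cpa ?R" by (rule ring_cpa[OF wf_arrow_restrict[OF wf]])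
  note mQ = ideal_arrow_ideal[OF wf]
  note mR = ideal_arrow_ideal[OF wf_arrow_restrict[OF wf, of V]]
  have hom: "\<rho> \<in> Ring.ring_hom (cpa Q) (cpa ?R)"
  proof (rule ring_hom_memI)
    fix f g assume "f \<in> carrier (cpa Q)" "g \<in> carrier (cpa Q)"
    show "\<rho> (f \<otimes>\<^bsub>cpa Q\<^esub> g) = \<rho> f \<otimes>\<^bsub>cpa ?R\<^esub> \<rho> g"
    proof
      fix x
      show "\<rho> (f \<otimes>\<^bsub>cpa Q\<^esub> g) x = (\<rho> f \<otimes>\<^bsub>cpa ?R\<^esub> \<rho> g) x"
      proof (cases "x \<in> qpaths ?R")
        case True
        have "(\<Sum>(q, r)\<in>pfactors ?R x. f q * g r) = (\<Sum>(q, r)\<in>pfactors ?R x. \<rho> f q * \<rho> g r)"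
          by (rule sum.cong) (auto simp: \<rho>_def pfactors_def)
        with True show ?thesis
          by (simp add: cpa_def \<rho>_def cpa_arrow_restrict_pfactors)
      qed (simp add: cpa_def \<rho>_def pfactors_empty)
    qed
  qed (use qpaths_arrow_restrict[of Q V] in \<open>auto simp: cpa_def \<rho>_def fun_eq_iff\<close>)
  then interpret h: ring_hom_ring "cpa Q" "cpa ?R" \<rho>
    by (intro ring_hom_ringI2 Q.ring_axioms R.ring_axioms)
  have idem: "\<rho> (idem_elem i) = idem_elem i" if "i \<in> verts Q" for i
    using that by (auto simp: \<rho>_def idem_elem_def path_elem_def fun_eq_iff qpaths_def
      pre_digraph.awalk_def pre_digraph.cas.simps arrow_restrict_def)
  have arr: "\<rho> (arrow_elem Q a) = arrow_elem ?R a" if "a \<in> arcs ?R" for a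
    using that wf by (auto simp: \<rho>_def arrow_elem_def path_elem_def fun_eq_iff qpaths_def
      pre_digraph.awalk_def pre_digraph.cas.simps arrow_restrict_def wf_digraph_def)
  have arr0: "\<rho> (arrow_elem Q a) = \<zero>\<^bsub>cpa ?R\<^esub>" if "a \<in> arcs Q - arcs ?R" for a
    using that by (auto simp: \<rho>_def arrow_elem_def path_elem_def fun_eq_iff qpaths_def
      pre_digraph.awalk_def cpa_def)
  have "ideal {f \<in> carrier (cpa Q). \<rho> f \<in> arrow_ideal ?R} (cpa Q)"
    by (rule h.ideal_vimage[OF mR])
  moreover have "arrow_elem Q ` arcs Q \<subseteq> {f \<in> carrier (cpa Q). \<rho> f \<in> arrow_ideal ?R}"
  proof -
    have "arrow_elem ?R ` arcs ?R \<subseteq> arrow_ideal ?R"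
      unfolding arrow_ideal_def
      by (rule R.genideal_self) (auto intro: arrow_elem_carrier wf_arrow_restrict wf)
    moreover have "\<zero>\<^bsub>cpa ?R\<^esub> \<in> arrow_ideal ?R"
      by (rule additive_subgroup.zero_closed[OF ideal.axioms(1)[OF mR]])
    ultimately show ?thesis
      using arr arr0 by (auto simp: arrow_elem_carrier wf) (metis DiffI image_subset_iff)
  qed
  ultimately have m: "\<rho> f \<in> arrow_ideal ?R" if "f \<in> arrow_ideal Q" for f
    using that Q.genideal_minimal unfolding arrow_ideal_def by blast
  have pow_carrier: "ideal_power (cpa Q) (arrow_ideal Q) k \<subseteq> carrier (cpa Q)" for k
    using Q.ideal_power_ideal[OF mQ, of k] by (simp add: ideal.Icarr subsetI)
  have m_carrier: "arrow_ideal Q \<subseteq> carrier (cpa Q)"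
    using mQ by (simp add: ideal.Icarr subsetI)
  have pow: "\<rho> f \<in> ideal_power (cpa ?R) (arrow_ideal ?R) k"
    if "f \<in> ideal_power (cpa Q) (arrow_ideal Q) k" for f k
    using that
  proof (induction k arbitrary: f)
    case 0 then show ?case by simp
  next
    case (Suc k)
    from Suc.prems have "f \<in> ideal_prod (cpa Q) (arrow_ideal Q) (ideal_power (cpa Q) (arrow_ideal Q) k)"
      by simp
    then have "f \<in> carrier (cpa Q) \<and> \<rho> f \<in> ideal_power (cpa ?R) (arrow_ideal ?R) (Suc k)"
    proof (induction rule: ideal_prod.induct)
      case (prod i j)
      then have "i \<in> carrier (cpa Q)" "j \<in> carrier (cpa Q)"
        using m_carrier pow_carrier by blast+
      with prod Suc.IH m show ?case by (auto intro: ideal_prod.prod)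
    qed (auto intro: ideal_prod.sum)
    then show ?case by simp
  qed
  have cont: "continuous_map (cpa_topology Q) (cpa_topology ?R) \<rho>"
  proof -
    note tQ = Q.topspace_adic_topology[OF mQ] and tR = R.topspace_adic_topology[OF mR]
    show ?thesis
      unfolding continuous_map_def tQ tR
    proof (intro conjI allI impI)
      fix U assume U: "openin (cpa_topology ?R) U"
      show "openin (cpa_topology Q) {x \<in> carrier (cpa Q). \<rho> x \<in> U}"
        unfolding Q.openin_adic_topology[OF mQ]
      proof (intro conjI ballI)
        fix x assume x: "x \<in> {x \<in> carrier (cpa Q). \<rho> x \<in> U}"
        then obtain k where k: "ideal_power (cpa ?R) (arrow_ideal ?R) k +>\<^bsub>cpa ?R\<^esub> \<rho> x \<subseteq> U"
          using U unfolding R.openin_adic_topology[OF mR] by blast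
        have "y \<in> carrier (cpa Q) \<and> \<rho> y \<in> U"
          if y: "y \<in> ideal_power (cpa Q) (arrow_ideal Q) k +>\<^bsub>cpa Q\<^esub> x" for y
        proof -
          from y obtain z where z: "z \<in> ideal_power (cpa Q) (arrow_ideal Q) k" "y = z \<oplus>\<^bsub>cpa Q\<^esub> x"
            by (auto simp: a_r_coset_def')
          then have zc: "z \<in> carrier (cpa Q)" using pow_carrier by blast
          have "\<rho> y = \<rho> z \<oplus>\<^bsub>cpa ?R\<^esub> \<rho> x" using z zc x by simp
          then have "\<rho> y \<in> ideal_power (cpa ?R) (arrow_ideal ?R) k +>\<^bsub>cpa ?R\<^esub> \<rho> x"
            using pow[OF z(1)] by (auto simp: a_r_coset_def')
          with k x zc z show ?thesis by auto
        qed
        then show "\<exists>k. ideal_power (cpa Q) (arrow_ideal Q) k +>\<^bsub>cpa Q\<^esub> x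
            \<subseteq> {x \<in> carrier (cpa Q). \<rho> x \<in> U}" by blast
      qed auto
    qed (use h.hom_closed in blast)
  qed
  show "is_restriction_hom Q ?R \<rho>"
    unfolding is_restriction_hom_def
    using hom cont idem arr arr0 by (intro conjI ballI allI) (simp_all add: \<rho>_def fun_eq_iff)
qed

end

theory Submission
  imports Defs
begin

text \<open>
  Every \<open>\<Lambda>\<close>-module is a module over the larger algebra \<open>\<Lambda>'\<close> along the surjection \<open>\<pi>\<close> induced by
  \<open>\<rho>\<close>, and so is the simple module \<open>S(i)\<close> for \<open>i\<close> in \<open>V = {1..n}\<close>.  As \<open>\<pi>\<close> is surjective, the two
  algebras have the same homomorphisms from \<open>S(i)\<close> to \<open>M\<close>.  The point is \<open>Ext\<^sup>1\<close>: an extension of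
  \<open>S(i)\<close> by \<open>M\<close> over \<open>\<Lambda>'\<close> has no part at the vertices outside \<open>V\<close>, so it should be a module
  over \<open>\<Lambda>\<close>.  Since the elements of the kernel of \<open>\<pi>\<close> are represented by infinite combinations of paths
  through the complement of \<open>V\<close>, this needs an argument, and the finite dimension of \<open>M\<close> enters there.

  Let \<open>P \<rightarrow> S(i)\<close> be the canonical free cover and \<open>K\<close> its kernel, the syzygy.  Then \<open>Ext\<^sup>1\<close> is the
  space of homomorphisms \<open>K \<rightarrow> M\<close> modulo those that extend to \<open>P\<close> (\<open>dim_ext1_eq_syzygy\<close>).  The free
  cover over \<open>\<Lambda>'\<close> maps onto the one over \<open>\<Lambda>\<close>, and a homomorphism on the syzygy over \<open>\<Lambda>'\<close> comes
  from the syzygy over \<open>\<Lambda>\<close> if and only if it kills \<open>s\<cdot>[x]\<close> for all \<open>x\<close> in \<open>S(i)\<close> and all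
  \<open>s\<close> in the kernel of \<open>\<pi>\<close>.  So both \<open>Ext\<close> spaces have the same dimension once all
  homomorphisms do so (\<open>dim_ext1_change_of_rings\<close>).

  Fix such a homomorphism \<open>\<phi>\<close> and an \<open>x\<close>, and let \<open>D\<close> be the set of series whose coefficients vanish
  on all paths that stay inside \<open>V\<close>.  Since \<open>\<rho>\<close> merely forgets the coefficients of the other
  paths (\<open>restriction_hom_apply\<close>), each element of the kernel of \<open>\<pi>\<close> has a representative in \<open>D\<close>.
  On \<open>D\<close> there is the linear map \<open>\<Psi> f = \<phi> (f\<cdot>[x])\<close>.  Each \<open>f\<close> in \<open>D\<close> is a finite sum of
  elements \<open>e\<^sub>j f\<close> with \<open>j\<close> outside \<open>V\<close>, on which \<open>\<Psi>\<close> is zero because \<open>e\<^sub>j M = 0\<close>, and of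
  elements \<open>a f\<^sub>a\<close> with an arrow \<open>a\<close> and \<open>f\<^sub>a\<close> in \<open>D\<close>.  Hence the image \<open>X\<close> of \<open>\<Psi>\<close> satisfies
  \<open>X = \<mm> X\<close> for the ideal \<open>\<mm>\<close> of series without constant terms.  Now \<open>X\<close> is finitely generated
  because \<open>M\<close> has finite dimension, and \<open>1 - a\<close> is invertible for \<open>a\<close> in \<open>\<mm>\<close> by the geometric series,
  so \<open>X = 0\<close> by Nakayama's lemma (\<open>outer_series_hom_zero\<close>).
\<close>

section \<open>Left modules over a noncommutative ring\<close>

context left_module
begin

lemma smult_r_null: "a \<in> carrier R \<Longrightarrow> a \<odot>\<^bsub>M\<^esub> \<zero>\<^bsub>M\<^esub> = \<zero>\<^bsub>M\<^esub>"
  by (metis M.add.l_cancel_one M.zero_closed smult_closed smult_r_distr)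

lemma smult_l_null: "x \<in> carrier M \<Longrightarrow> \<zero> \<odot>\<^bsub>M\<^esub> x = \<zero>\<^bsub>M\<^esub>"
  by (metis M.add.l_cancel_one R.zero_closed R.add.l_one smult_closed smult_l_distr)

lemma smult_l_minus: "\<lbrakk>a \<in> carrier R; x \<in> carrier M\<rbrakk> \<Longrightarrow> (\<ominus> a) \<odot>\<^bsub>M\<^esub> x = \<ominus>\<^bsub>M\<^esub> (a \<odot>\<^bsub>M\<^esub> x)"
  by (metis M.minus_equality R.add.inv_closed R.l_neg smult_closed smult_l_distr smult_l_null)

lemma smult_finsum:
  "\<lbrakk>a \<in> carrier R; g \<in> A \<rightarrow> carrier M\<rbrakk> \<Longrightarrow>
   a \<odot>\<^bsub>M\<^esub> (\<Oplus>\<^bsub>M\<^esub>x\<in>A. g x) = (\<Oplus>\<^bsub>M\<^esub>x\<in>A. a \<odot>\<^bsub>M\<^esub> g x)"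
proof (induction A rule: infinite_finite_induct)
  case (insert x A)
  then have "g x \<in> carrier M" "g \<in> A \<rightarrow> carrier M" by auto
  moreover from this insert.prems have "(\<lambda>x. a \<odot>\<^bsub>M\<^esub> g x) \<in> A \<rightarrow> carrier M"
    by (auto intro: smult_closed)
  ultimately show ?case
    using insert by (simp add: smult_r_distr smult_closed)
qed (simp_all add: smult_r_null)

end

lemma restrict_scalars_simps [simp]:
  "carrier (restrict_scalars h M) = carrier M"
  "zero (restrict_scalars h M) = zero M"
  "add (restrict_scalars h M) = add M"
  "smult (restrict_scalars h M) r x = h r \<odot>\<^bsub>M\<^esub> x"
  by (simp_all add: restrict_scalars_def)

lemma restrict_scalars_id: "restrict_scalars (\<lambda>r. r) M = M"
  by (simp add: restrict_scalars_def)

lemma restrict_scalars_comp: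
  "restrict_scalars g (restrict_scalars h M) = restrict_scalars (\<lambda>r. h (g r)) M"
  by (simp add: restrict_scalars_def)

lemma finsum_restrict_scalars [simp]: "finsum (restrict_scalars h M) f A = finsum M f A"
  by (simp add: finsum_def finprod_def restrict_scalars_def)

lemma abelian_group_cong:
  assumes "abelian_group M" "carrier N = carrier M" "zero N = zero M" "add N = add M"
  shows "abelian_group N"
proof -
  interpret abelian_group M by fact
  show ?thesis
    by (rule abelian_groupI)
      (use assms add.inv_closed l_neg in \<open>auto simp: a_assoc intro: a_comm\<close>)
qed

lemma left_module_restrict_scalars:
  assumes "left_module R M" "ring S" "h \<in> Ring.ring_hom S R"
  shows "left_module S (restrict_scalars h M)"
proof -
  interpret left_module R M by fact
  interpret S: ring S by fact
  have "abelian_group (restrict_scalars h M)"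
    by (rule abelian_group_cong[OF M.abelian_group_axioms]) simp_all
  then show ?thesis
    using assms(3)
    by (intro left_module.intro S.ring_axioms left_module_axioms.intro)
      (simp_all add: smult_closed smult_l_distr smult_r_distr smult_assoc1 smult_one
        ring_hom_closed ring_hom_add ring_hom_mult ring_hom_one)
qed

lemma left_module_submodule:
  assumes "left_module R M" "U \<subseteq> carrier M" "\<zero>\<^bsub>M\<^esub> \<in> U"
    and add: "\<And>x y. \<lbrakk>x \<in> U; y \<in> U\<rbrakk> \<Longrightarrow> x \<oplus>\<^bsub>M\<^esub> y \<in> U"
    and smult: "\<And>r x. \<lbrakk>r \<in> carrier R; x \<in> U\<rbrakk> \<Longrightarrow> r \<odot>\<^bsub>M\<^esub> x \<in> U"
  shows "left_module R (M\<lparr>carrier := U\<rparr>)"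
proof -
  interpret left_module R M by fact
  have neg: "\<ominus>\<^bsub>M\<^esub> x \<in> U" if "x \<in> U" for x
    using smult_l_minus[of "\<one>\<^bsub>R\<^esub>" x] smult[of "\<ominus>\<^bsub>R\<^esub> \<one>\<^bsub>R\<^esub>" x] that assms(2)
    by (auto simp: smult_one)
  have "\<exists>y\<in>U. y \<oplus>\<^bsub>M\<^esub> x = \<zero>\<^bsub>M\<^esub>" if "x \<in> U" for x
    using neg[OF that] M.l_neg that assms(2) by blast
  then have "abelian_group (M\<lparr>carrier := U\<rparr>)"
    by (intro abelian_groupI)
      (use assms(2-4) in \<open>auto simp: M.a_assoc subset_iff intro: M.a_comm\<close>)
  then show ?thesis
    using assms(2) smult
    by (intro left_module.intro R.ring_axioms left_module_axioms.intro)
      (auto simp: subset_iff smult_l_distr smult_r_distr smult_assoc1 smult_one)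
qed

lemma module_hom_zero:
  assumes "left_module R M" "left_module R N" "f \<in> module_hom R M N"
  shows "f \<zero>\<^bsub>M\<^esub> = \<zero>\<^bsub>N\<^esub>"
proof -
  interpret M: left_module R M by fact
  interpret N: left_module R N by fact
  have "f (\<zero>\<^bsub>R\<^esub> \<odot>\<^bsub>M\<^esub> \<zero>\<^bsub>M\<^esub>) = \<zero>\<^bsub>R\<^esub> \<odot>\<^bsub>N\<^esub> f \<zero>\<^bsub>M\<^esub>"
    using assms(3) by (auto simp: module_hom_def)
  moreover have "f \<zero>\<^bsub>M\<^esub> \<in> carrier N"
    using assms(3) by (auto simp: module_hom_def)
  ultimately show ?thesis by (simp add: M.smult_l_null N.smult_l_null)
qed

lemma module_homI:
  assumes "\<And>x. x \<in> carrier M \<Longrightarrow> f x \<in> carrier N"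
    and "\<And>x y. \<lbrakk>x \<in> carrier M; y \<in> carrier M\<rbrakk> \<Longrightarrow> f (x \<oplus>\<^bsub>M\<^esub> y) = f x \<oplus>\<^bsub>N\<^esub> f y"
    and "\<And>r x. \<lbrakk>r \<in> carrier R; x \<in> carrier M\<rbrakk> \<Longrightarrow> f (r \<odot>\<^bsub>M\<^esub> x) = r \<odot>\<^bsub>N\<^esub> f x"
  shows "f \<in> module_hom R M N"
  using assms by (auto simp: module_hom_def)


section \<open>The canonical free resolution\<close>

definition free_single :: "('r, 'b) ring_scheme \<Rightarrow> 'n \<Rightarrow> 'r \<Rightarrow> 'n \<Rightarrow> 'r" where
  "free_single R x r = (\<lambda>y. if y = x then r else \<zero>\<^bsub>R\<^esub>)"

lemma free_module_simps [simp]: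
  "zero (free_module R X) = (\<lambda>x. \<zero>\<^bsub>R\<^esub>)"
  "add (free_module R X) f g = (\<lambda>x. f x \<oplus>\<^bsub>R\<^esub> g x)"
  "smult (free_module R X) r f = (\<lambda>x. r \<otimes>\<^bsub>R\<^esub> f x)"
  by (simp_all add: free_module_def)

lemma mem_free_module:
  "f \<in> carrier (free_module R X) \<longleftrightarrow>
    (\<forall>x\<in>X. f x \<in> carrier R) \<and> (\<forall>x. x \<notin> X \<longrightarrow> f x = \<zero>\<^bsub>R\<^esub>) \<and> finite {x. f x \<noteq> \<zero>\<^bsub>R\<^esub>}"
  by (simp add: free_module_def)

lemma (in ring) free_module_value: "f \<in> carrier (free_module R X) \<Longrightarrow> f x \<in> carrier R"
  by (cases "x \<in> X") (auto simp: mem_free_module)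

lemma (in ring) free_single_closed:
  "\<lbrakk>x \<in> X; r \<in> carrier R\<rbrakk> \<Longrightarrow> free_single R x r \<in> carrier (free_module R X)"
  by (auto simp: mem_free_module free_single_def)

lemma (in ring) left_module_free: "left_module R (free_module R X)"
proof -
  have add: "(\<lambda>x. f x \<oplus> g x) \<in> carrier (free_module R X)"
    if "f \<in> carrier (free_module R X)" "g \<in> carrier (free_module R X)" for f g
  proof -
    have "{x. f x \<oplus> g x \<noteq> \<zero>} \<subseteq> {x. f x \<noteq> \<zero>} \<union> {x. g x \<noteq> \<zero>}" by auto
    with that show ?thesis by (auto simp: mem_free_module intro: finite_subset)
  qed
  have smult: "(\<lambda>x. r \<otimes> f x) \<in> carrier (free_module R X)"
    if "r \<in> carrier R" "f \<in> carrier (free_module R X)" for r f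
  proof -
    have "{x. r \<otimes> f x \<noteq> \<zero>} \<subseteq> {x. f x \<noteq> \<zero>}" using that(1) by auto
    with that show ?thesis by (auto simp: mem_free_module intro: finite_subset)
  qed
  note val = free_module_value
  have "abelian_group (free_module R X)"
  proof (rule abelian_groupI)
    fix f assume f: "f \<in> carrier (free_module R X)"
    show "\<exists>g\<in>carrier (free_module R X).
        g \<oplus>\<^bsub>free_module R X\<^esub> f = \<zero>\<^bsub>free_module R X\<^esub>"
      using smult[of "\<ominus> \<one>" f] f
      by (intro bexI[of _ "\<lambda>x. (\<ominus> \<one>) \<otimes> f x"]) (auto simp: val[OF f] l_minus l_neg)
  qed (auto simp: add val a_assoc fun_eq_iff intro: a_comm, simp add: mem_free_module)
  then show ?thesis
    by (intro left_module.intro ring_axioms left_module_axioms.intro)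
      (auto simp: smult val l_distr r_distr m_assoc)
qed

lemma free_module_support:
  assumes "f \<in> carrier (free_module R X)"
  shows "finite {x. f x \<noteq> \<zero>\<^bsub>R\<^esub>}" "{x. f x \<noteq> \<zero>\<^bsub>R\<^esub>} \<subseteq> X"
  using assms by (auto simp: mem_free_module)

lemma carrier_syzygy:
  "carrier (syzygy R N) =
    {f \<in> carrier (free_module R (carrier N)). free_cover R N f = \<zero>\<^bsub>N\<^esub>}"
  by (simp add: syzygy_def)

lemma syzygy_simps [simp]:
  "zero (syzygy R N) = (\<lambda>x. \<zero>\<^bsub>R\<^esub>)"
  "add (syzygy R N) f g = (\<lambda>x. f x \<oplus>\<^bsub>R\<^esub> g x)"
  "smult (syzygy R N) r f = (\<lambda>x. r \<otimes>\<^bsub>R\<^esub> f x)"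
  by (simp_all add: syzygy_def)

text \<open>The free module on the elements of a module is formed for records without extra fields.\<close>

locale plain_left_module = left_module R M
    for R :: "('r, 'b) ring_scheme" (structure) and M :: "('r, 'm) module" (structure)

context plain_left_module
begin

lemma free_cover_eq:
  assumes "f \<in> carrier (free_module R (carrier M))" "finite A" "A \<subseteq> carrier M"
    and "\<And>x. f x \<noteq> \<zero> \<Longrightarrow> x \<in> A"
  shows "free_cover R M f = (\<Oplus>\<^bsub>M\<^esub>x\<in>A. f x \<odot>\<^bsub>M\<^esub> x)"
  unfolding free_cover_def
proof (rule M.add.finprod_mono_neutral_cong_left)
  show "\<And>i. i \<in> A - {x \<in> carrier M. f x \<noteq> \<zero>} \<Longrightarrow> f i \<odot>\<^bsub>M\<^esub> i = \<zero>\<^bsub>M\<^esub>"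
    using assms(3) by (auto simp: smult_l_null)
  show "(\<lambda>x. f x \<odot>\<^bsub>M\<^esub> x) \<in> A \<rightarrow> carrier M"
    using assms(3) R.free_module_value[OF assms(1)] by (auto intro: smult_closed)
qed (use assms in auto)

lemma free_cover_hom:
  "free_cover R M \<in> module_hom R (free_module R (carrier M)) M"
proof (rule module_homI)
  let ?F = "free_module R (carrier M)"
  interpret F: left_module R ?F by (rule R.left_module_free)
  note val = R.free_module_value
  have closed: "(\<lambda>x. f x \<odot>\<^bsub>M\<^esub> x) \<in> A \<rightarrow> carrier M"
    if "f \<in> carrier ?F" "A \<subseteq> carrier M" for f A
    using that(2) val[OF that(1)] by (auto intro: smult_closed)
  {
    fix f assume f: "f \<in> carrier ?F"
    show "free_cover R M f \<in> carrier M"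
      unfolding free_cover_def by (rule M.finsum_closed) (use closed[OF f] in auto)
    fix r assume r: "r \<in> carrier R"
    let ?A = "{x. f x \<noteq> \<zero>}"
    have A: "finite ?A" "?A \<subseteq> carrier M" using free_module_support[OF f] by auto
    have rf: "(\<lambda>x. r \<otimes> f x) \<in> carrier ?F"
      using F.smult_closed[OF r f] by simp
    have "free_cover R M (\<lambda>x. r \<otimes> f x) = (\<Oplus>\<^bsub>M\<^esub>x\<in>?A. (r \<otimes> f x) \<odot>\<^bsub>M\<^esub> x)"
      by (rule free_cover_eq[OF rf A]) (use r in auto)
    also have "\<dots> = (\<Oplus>\<^bsub>M\<^esub>x\<in>?A. r \<odot>\<^bsub>M\<^esub> (f x \<odot>\<^bsub>M\<^esub> x))"
      by (rule M.finsum_cong') (use A r val[OF f] in \<open>auto simp: smult_assoc1 smult_closed subset_iff\<close>)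
    also have "\<dots> = r \<odot>\<^bsub>M\<^esub> (\<Oplus>\<^bsub>M\<^esub>x\<in>?A. f x \<odot>\<^bsub>M\<^esub> x)"
      by (rule smult_finsum[symmetric]) (use r closed[OF f A(2)] in auto)
    also have "(\<Oplus>\<^bsub>M\<^esub>x\<in>?A. f x \<odot>\<^bsub>M\<^esub> x) = free_cover R M f"
      by (rule free_cover_eq[OF f A, symmetric]) auto
    finally show "free_cover R M (r \<odot>\<^bsub>?F\<^esub> f) = r \<odot>\<^bsub>M\<^esub> free_cover R M f" by simp
  next
    fix f g assume f: "f \<in> carrier ?F" and g: "g \<in> carrier ?F"
    let ?A = "{x. f x \<noteq> \<zero>} \<union> {x. g x \<noteq> \<zero>}"
    have A: "finite ?A" "?A \<subseteq> carrier M"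
      using free_module_support[OF f] free_module_support[OF g] by auto
    have fg: "(\<lambda>x. f x \<oplus> g x) \<in> carrier ?F"
      using F.M.a_closed[OF f g] by simp
    have "free_cover R M (\<lambda>x. f x \<oplus> g x) = (\<Oplus>\<^bsub>M\<^esub>x\<in>?A. (f x \<oplus> g x) \<odot>\<^bsub>M\<^esub> x)"
      by (rule free_cover_eq[OF fg A]) auto
    also have "\<dots> = (\<Oplus>\<^bsub>M\<^esub>x\<in>?A. f x \<odot>\<^bsub>M\<^esub> x \<oplus>\<^bsub>M\<^esub> g x \<odot>\<^bsub>M\<^esub> x)"
      by (rule M.finsum_cong')
        (use A val[OF f] val[OF g] in \<open>auto simp: smult_l_distr smult_closed subset_iff\<close>)
    also have "\<dots> = (\<Oplus>\<^bsub>M\<^esub>x\<in>?A. f x \<odot>\<^bsub>M\<^esub> x) \<oplus>\<^bsub>M\<^esub> (\<Oplus>\<^bsub>M\<^esub>x\<in>?A. g x \<odot>\<^bsub>M\<^esub> x)"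
      by (rule M.finsum_addf) (use closed[OF f A(2)] closed[OF g A(2)] in auto)
    also have "(\<Oplus>\<^bsub>M\<^esub>x\<in>?A. f x \<odot>\<^bsub>M\<^esub> x) = free_cover R M f"
      by (rule free_cover_eq[OF f A, symmetric]) auto
    also have "(\<Oplus>\<^bsub>M\<^esub>x\<in>?A. g x \<odot>\<^bsub>M\<^esub> x) = free_cover R M g"
      by (rule free_cover_eq[OF g A, symmetric]) auto
    finally show "free_cover R M (f \<oplus>\<^bsub>?F\<^esub> g) = free_cover R M f \<oplus>\<^bsub>M\<^esub> free_cover R M g"
      by simp
  }
qed

lemma free_cover_single:
  assumes "x \<in> carrier M" "r \<in> carrier R"
  shows "free_cover R M (free_single R x r) = r \<odot>\<^bsub>M\<^esub> x"
  using assms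
  by (subst free_cover_eq[of _ "{x}"])
    (auto intro: R.free_single_closed simp: smult_closed, auto simp: free_single_def smult_closed split: if_splits)

lemma free_cover_surj:
  "free_cover R M ` carrier (free_module R (carrier M)) = carrier M"
proof
  show "carrier M \<subseteq> free_cover R M ` carrier (free_module R (carrier M))"
  proof
    fix x assume x: "x \<in> carrier M"
    then have "x = free_cover R M (free_single R x \<one>)"
      by (simp add: free_cover_single smult_one)
    with x show "x \<in> free_cover R M ` carrier (free_module R (carrier M))"
      by (auto intro: R.free_single_closed)
  qed
qed (use free_cover_hom in \<open>auto simp: module_hom_def\<close>)

lemma left_module_syzygy: "left_module R (syzygy R M)"
proof -
  interpret F: left_module R "free_module R (carrier M)" by (rule R.left_module_free)
  note hom = free_cover_hom
  have zero: "free_cover R M \<zero>\<^bsub>free_module R (carrier M)\<^esub> = \<zero>\<^bsub>M\<^esub>"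
    using module_hom_zero[OF F.left_module_axioms left_module_axioms hom] .
  show ?thesis
    unfolding syzygy_def
    by (rule left_module_submodule[OF F.left_module_axioms])
      (use module_hom_add[OF hom] module_hom_smult[OF hom] zero F.M.zero_closed
        F.M.a_closed F.smult_closed in \<open>auto simp: smult_r_null\<close>)
qed

end

section \<open>Dimensions of quotient spaces\<close>

text \<open>
  The dimension is the least size of a finite spanning set.  If there is no such set, it is an
  unspecified number, but the same one for all spaces, and an isomorphism preserves this case too.
\<close>

lemma (in linear_map) dim_eq_of_bij:
  assumes inj: "inj_on T (carrier V)" and surj: "T ` carrier V = carrier W"
  shows "vectorspace.dim K V = vectorspace.dim K W"
proof (cases "V.fin_dim")
  case True
  then show ?thesis by (rule dim_eq[OF _ inj surj])
next
  case False
  have "\<not> W.fin_dim"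
  proof
    assume "W.fin_dim"
    then obtain A where A: "finite A" "A \<subseteq> carrier W" "W.module.span A = carrier W"
      by (auto simp: W.fin_dim_def)
    let ?B = "inv_into (carrier V) T ` A"
    have B: "?B \<subseteq> carrier V" "T ` ?B = A"
      using A(2) surj by (auto simp: inv_into_into f_inv_into_f image_image subset_iff)
    have "x \<in> V.module.span ?B" if x: "x \<in> carrier V" for x
    proof -
      have "T x \<in> W.module.span (T ` ?B)" using A(3) B(2) x by simp
      then obtain a where a: "a \<in> T ` ?B \<rightarrow> carrier K" "T x = W.module.lincomb a (T ` ?B)"
        using W.module.finite_in_span[of "T ` ?B" "T x"] A B by auto
      have aT: "a \<circ> T \<in> ?B \<rightarrow> carrier K" using a(1) by auto
      have "T x = T (V.module.lincomb (a \<circ> T) ?B)"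
        using lincomb_linear_image[OF inj B(1) a(1)] a(2) A(1) by simp
      then have "x = V.module.lincomb (a \<circ> T) ?B"
        using inj x V.module.lincomb_closed[OF B(1) aT] by (auto dest: inj_onD)
      then show ?thesis unfolding V.module.span_def using A(1) aT by blast
    qed
    then have "V.module.span ?B = carrier V"
      using V.module.span_is_subset2[OF B(1)] by auto
    with A(1) B(1) False show False unfolding V.fin_dim_def by blast
  qed
  with False show ?thesis
    unfolding V.dim_def W.dim_def V.fin_dim_def W.fin_dim_def by (metis (no_types, lifting))
qed

lemma quotient_module_simps [simp]:
  "carrier (quotient_module V U) = a_rcosets\<^bsub>V\<^esub> U"
  "zero (quotient_module V U) = U"
  "add (quotient_module V U) = set_add V"
  "smult (quotient_module V U) c X = (\<Union>x\<in>X. U +>\<^bsub>V\<^esub> (c \<odot>\<^bsub>V\<^esub> x))"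
  by (simp_all add: quotient_module_def)

lemma (in vectorspace) abelian_subgroup_submodule:
  assumes "submodule K U V" shows "abelian_subgroup U V"
proof -
  interpret U: submodule K U V by fact
  have neg: "\<ominus>\<^bsub>V\<^esub> x \<in> U" if "x \<in> U" for x
    using U.smult_closed[of "\<ominus>\<^bsub>K\<^esub> \<one>\<^bsub>K\<^esub>" x] that U.subset smult_minus_1[of x]
    by (metis R.add.inv_closed R.one_closed subsetD)
  show ?thesis
  proof (rule abelian_subgroupI3)
    show "additive_subgroup U V"
      by (rule additive_subgroupI, rule M.add.subgroupI)
        (use U.subset neg U.zero_closed U.m_closed in \<open>auto simp: a_inv_def[symmetric] simp del: U.zero_closed\<close>)
  qed (rule M.abelian_group_axioms)
qed

lemma (in vectorspace) quotient_module_smult_coset: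
  assumes "submodule K U V" "c \<in> carrier K" "v \<in> carrier V"
  shows "(\<Union>x\<in>U +>\<^bsub>V\<^esub> v. U +>\<^bsub>V\<^esub> (c \<odot>\<^bsub>V\<^esub> x)) = U +>\<^bsub>V\<^esub> (c \<odot>\<^bsub>V\<^esub> v)"
proof -
  interpret U: submodule K U V by (rule assms)
  interpret G: abelian_subgroup U V by (rule abelian_subgroup_submodule[OF assms(1)])
  have "U +>\<^bsub>V\<^esub> (c \<odot>\<^bsub>V\<^esub> x) = U +>\<^bsub>V\<^esub> (c \<odot>\<^bsub>V\<^esub> v)" if x: "x \<in> U +>\<^bsub>V\<^esub> v" for x
  proof -
    obtain u where u: "u \<in> U" "x = u \<oplus>\<^bsub>V\<^esub> v" using x by (auto simp: a_r_coset_def')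
    then have "c \<odot>\<^bsub>V\<^esub> x = c \<odot>\<^bsub>V\<^esub> u \<oplus>\<^bsub>V\<^esub> c \<odot>\<^bsub>V\<^esub> v"
      using assms U.subset by (auto simp: smult_r_distr)
    then have "c \<odot>\<^bsub>V\<^esub> x \<in> U +>\<^bsub>V\<^esub> (c \<odot>\<^bsub>V\<^esub> v)"
      using u(1) assms(2) by (auto simp: a_r_coset_def')
    then show ?thesis
      using G.a_repr_independence' assms by auto
  qed
  moreover have "v \<in> U +>\<^bsub>V\<^esub> v" using G.a_rcos_self assms(3) by simp
  ultimately show ?thesis by blast
qed

lemma vectorspace_quotient:
  assumes "vectorspace K V" "submodule K U V"
  shows "vectorspace K (quotient_module V U)"
proof -
  interpret vectorspace K V by fact
  interpret U: submodule K U V by (rule assms)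
  interpret G: abelian_subgroup U V by (rule abelian_subgroup_submodule[OF assms(2)])
  have ex: "\<exists>v\<in>carrier V. X = U +>\<^bsub>V\<^esub> v" if "X \<in> a_rcosets\<^bsub>V\<^esub> U" for X
    using that by (auto simp: A_RCOSETS_def')
  have mem: "U +>\<^bsub>V\<^esub> v \<in> a_rcosets\<^bsub>V\<^esub> U" if "v \<in> carrier V" for v
    using that by (auto simp: A_RCOSETS_def')
  have zero: "U = U +>\<^bsub>V\<^esub> \<zero>\<^bsub>V\<^esub>" using U.subset by simp
  note sum = G.a_rcos_sum
  note smult = quotient_module_smult_coset[OF assms(2)]
  have "module K (quotient_module V U)"
  proof (rule module_criteria, unfold quotient_module_simps; (intro allI ballI impI; (elim conjE)?)?)
    show "cring K" by (rule R.is_cring)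
    show "U \<in> a_rcosets\<^bsub>V\<^esub> U" using mem[of "\<zero>\<^bsub>V\<^esub>"] zero by simp
  next
    fix X Y assume "X \<in> a_rcosets\<^bsub>V\<^esub> U" "Y \<in> a_rcosets\<^bsub>V\<^esub> U"
    then obtain x y where "x \<in> carrier V" "X = U +>\<^bsub>V\<^esub> x" "y \<in> carrier V" "Y = U +>\<^bsub>V\<^esub> y"
      using ex by meson
    then show "X <+>\<^bsub>V\<^esub> Y \<in> a_rcosets\<^bsub>V\<^esub> U" "X <+>\<^bsub>V\<^esub> Y = Y <+>\<^bsub>V\<^esub> X"
      by (auto simp: sum M.a_comm intro: mem)
  next
    fix X assume "X \<in> a_rcosets\<^bsub>V\<^esub> U"
    then obtain x where x: "x \<in> carrier V" "X = U +>\<^bsub>V\<^esub> x" using ex by meson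
    have "X <+>\<^bsub>V\<^esub> (U +>\<^bsub>V\<^esub> (\<ominus>\<^bsub>V\<^esub> x)) = U +>\<^bsub>V\<^esub> \<zero>\<^bsub>V\<^esub>"
      using x by (simp add: sum M.r_neg)
    with zero have "X <+>\<^bsub>V\<^esub> (U +>\<^bsub>V\<^esub> (\<ominus>\<^bsub>V\<^esub> x)) = U" by argo
    then show "\<exists>Y\<in>a_rcosets\<^bsub>V\<^esub> U. X <+>\<^bsub>V\<^esub> Y = U"
      using mem[of "\<ominus>\<^bsub>V\<^esub> x"] x by blast
    have "X <+>\<^bsub>V\<^esub> (U +>\<^bsub>V\<^esub> \<zero>\<^bsub>V\<^esub>) = X" using x by (simp add: sum del: M.a_coset_add_zero)
    with zero show "X <+>\<^bsub>V\<^esub> U = X" by argo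
    show "(\<Union>x\<in>X. U +>\<^bsub>V\<^esub> (\<one>\<^bsub>K\<^esub> \<odot>\<^bsub>V\<^esub> x)) = X" using x by (simp add: smult)
  next
    fix c X assume c: "c \<in> carrier K" and "X \<in> a_rcosets\<^bsub>V\<^esub> U"
    then obtain x where x: "x \<in> carrier V" "X = U +>\<^bsub>V\<^esub> x" using ex by meson
    with c show "(\<Union>x\<in>X. U +>\<^bsub>V\<^esub> (c \<odot>\<^bsub>V\<^esub> x)) \<in> a_rcosets\<^bsub>V\<^esub> U" by (simp add: smult mem)
  next
    fix X Y Z assume "X \<in> a_rcosets\<^bsub>V\<^esub> U" "Y \<in> a_rcosets\<^bsub>V\<^esub> U" "Z \<in> a_rcosets\<^bsub>V\<^esub> U"
    then obtain x y z where "x \<in> carrier V" "X = U +>\<^bsub>V\<^esub> x" "y \<in> carrier V" "Y = U +>\<^bsub>V\<^esub> y"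
      "z \<in> carrier V" "Z = U +>\<^bsub>V\<^esub> z"
      using ex by meson
    then show "X <+>\<^bsub>V\<^esub> Y <+>\<^bsub>V\<^esub> Z = X <+>\<^bsub>V\<^esub> (Y <+>\<^bsub>V\<^esub> Z)" by (simp add: sum M.a_assoc)
  next
    fix a b X assume c: "a \<in> carrier K" "b \<in> carrier K" and "X \<in> a_rcosets\<^bsub>V\<^esub> U"
    then obtain x where "x \<in> carrier V" "X = U +>\<^bsub>V\<^esub> x" using ex by meson
    with c show
      "(\<Union>x\<in>X. U +>\<^bsub>V\<^esub> (a \<otimes>\<^bsub>K\<^esub> b) \<odot>\<^bsub>V\<^esub> x) =
        (\<Union>x\<in>\<Union>x\<in>X. U +>\<^bsub>V\<^esub> b \<odot>\<^bsub>V\<^esub> x. U +>\<^bsub>V\<^esub> a \<odot>\<^bsub>V\<^esub> x)"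
      "(\<Union>x\<in>X. U +>\<^bsub>V\<^esub> (a \<oplus>\<^bsub>K\<^esub> b) \<odot>\<^bsub>V\<^esub> x) =
        (\<Union>x\<in>X. U +>\<^bsub>V\<^esub> a \<odot>\<^bsub>V\<^esub> x) <+>\<^bsub>V\<^esub> (\<Union>x\<in>X. U +>\<^bsub>V\<^esub> b \<odot>\<^bsub>V\<^esub> x)"
      by (simp_all add: smult sum smult_assoc1 smult_l_distr)
  next
    fix c X Y
    assume c: "c \<in> carrier K" and "X \<in> a_rcosets\<^bsub>V\<^esub> U" "Y \<in> a_rcosets\<^bsub>V\<^esub> U"
    then obtain x y where "x \<in> carrier V" "X = U +>\<^bsub>V\<^esub> x" "y \<in> carrier V" "Y = U +>\<^bsub>V\<^esub> y"
      using ex by meson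
    with c show "(\<Union>x\<in>X <+>\<^bsub>V\<^esub> Y. U +>\<^bsub>V\<^esub> c \<odot>\<^bsub>V\<^esub> x) =
        (\<Union>x\<in>X. U +>\<^bsub>V\<^esub> c \<odot>\<^bsub>V\<^esub> x) <+>\<^bsub>V\<^esub> (\<Union>x\<in>Y. U +>\<^bsub>V\<^esub> c \<odot>\<^bsub>V\<^esub> x)"
      by (simp add: sum smult smult_r_distr)
  qed
  then show ?thesis by (rule vectorspace.intro) (rule field_axioms)
qed


text \<open>
  An injective linear map acts on cosets by taking images.
\<close>

lemma dim_quotient_inj_image:
  fixes V :: "('k, 'v) module" and W :: "('k, 'w) module"
  assumes T: "linear_map K V W T" and inj: "inj_on T (carrier V)" and U: "submodule K U V"
  shows "vectorspace.dim K (quotient_module V U) =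
    vectorspace.dim K (quotient_module (W\<lparr>carrier := T ` carrier V\<rparr>) (T ` U))"
proof -
  interpret T: linear_map K V W T by fact
  interpret U: submodule K U V by fact
  let ?W = "W\<lparr>carrier := T ` carrier V\<rparr>"
  have W: "vectorspace K ?W"
    using T.W.subspace_is_vs[OF T.imT_is_subspace] by (simp add: T.im_def)
  interpret W: vectorspace K ?W by (rule W)
  have TU: "submodule K (T ` U) ?W"
  proof (rule submodule.intro)
    show "module K ?W" by (rule W.module_axioms)
    show "T ` U \<subseteq> carrier ?W" using U.subset by auto
    show "\<zero>\<^bsub>?W\<^esub> \<in> T ` U" using imageI[OF U.zero_closed, of T] by simp
  next
    fix v w assume "v \<in> T ` U" "w \<in> T ` U"
    then obtain x y where "x \<in> U" "y \<in> U" "v = T x" "w = T y" by blast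
    then show "v \<oplus>\<^bsub>?W\<^esub> w \<in> T ` U"
      using U.subset by (auto simp del: T.T_add simp: T.T_add[symmetric] subset_iff)
  next
    fix c v assume "c \<in> carrier K" "v \<in> T ` U"
    then obtain x where "x \<in> U" "v = T x" by blast
    then show "c \<odot>\<^bsub>?W\<^esub> v \<in> T ` U"
      using U.subset \<open>c \<in> carrier K\<close>
      by (auto simp del: T.T_smult simp: T.T_smult[symmetric] subset_iff)
  qed
  interpret GV: abelian_subgroup U V by (rule T.V.abelian_subgroup_submodule[OF U])
  interpret GW: abelian_subgroup "T ` U" ?W by (rule W.abelian_subgroup_submodule[OF TU])
  let ?V' = "quotient_module V U" and ?W' = "quotient_module ?W (T ` U)"
  have V': "vectorspace K ?V'" by (rule vectorspace_quotient[OF T.V.vectorspace_axioms U])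
  have W': "vectorspace K ?W'" by (rule vectorspace_quotient[OF W TU])
  have img: "T ` (U +>\<^bsub>V\<^esub> v) = T ` U +>\<^bsub>?W\<^esub> T v" if "v \<in> carrier V" for v
  proof -
    have "T (u \<oplus>\<^bsub>V\<^esub> v) = T u \<oplus>\<^bsub>W\<^esub> T v" if "u \<in> U" for u
      using \<open>v \<in> carrier V\<close> that U.subset by auto
    then have "(\<lambda>u. T (u \<oplus>\<^bsub>V\<^esub> v)) ` U = (\<lambda>u. T u \<oplus>\<^bsub>W\<^esub> T v) ` U"
      by (rule image_cong[OF refl])
    then show ?thesis by (simp only: a_r_coset_def' UNION_singleton_eq_range image_image partial_object.update_convs
          ring.simps module.simps) simp
  qed
  have carrV: "X \<in> carrier ?V' \<longleftrightarrow> (\<exists>v\<in>carrier V. X = U +>\<^bsub>V\<^esub> v)" for X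
    by (auto simp: A_RCOSETS_def')
  have carrW: "carrier ?W' = (\<lambda>v. T ` U +>\<^bsub>?W\<^esub> T v) ` carrier V"
    unfolding quotient_module_simps A_RCOSETS_def' by simp blast
  have hom: "(`) T \<in> module_hom K ?V' ?W'"
  proof (rule module_homI)
    fix X assume "X \<in> carrier ?V'"
    then obtain x where "x \<in> carrier V" "X = U +>\<^bsub>V\<^esub> x" using carrV by meson
    then show "T ` X \<in> carrier ?W'" unfolding carrW using img by simp
  next
    fix X Y assume "X \<in> carrier ?V'" "Y \<in> carrier ?V'"
    then obtain x y where "x \<in> carrier V" "X = U +>\<^bsub>V\<^esub> x" "y \<in> carrier V" "Y = U +>\<^bsub>V\<^esub> y"
      using carrV by meson
    then show "T ` (X \<oplus>\<^bsub>?V'\<^esub> Y) = T ` X \<oplus>\<^bsub>?W'\<^esub> T ` Y"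
      by (simp add: img GV.a_rcos_sum GW.a_rcos_sum)
  next
    fix c X assume c: "c \<in> carrier K" and "X \<in> carrier ?V'"
    then obtain x where "x \<in> carrier V" "X = U +>\<^bsub>V\<^esub> x" using carrV by meson
    with c show "T ` (c \<odot>\<^bsub>?V'\<^esub> X) = c \<odot>\<^bsub>?W'\<^esub> T ` X"
      using W.quotient_module_smult_coset[OF TU c, of "T x"]
      by (simp add: img T.V.quotient_module_smult_coset[OF U])
  qed
  then interpret Q: linear_map K ?V' ?W' "(`) T"
    by (intro linear_map.intro V' W' mod_hom.intro mod_hom_axioms.intro
        vectorspace.axioms(1)[OF V'] vectorspace.axioms(1)[OF W'])
  show ?thesis
  proof (rule Q.dim_eq_of_bij)
    have "carrier ?V' \<subseteq> Pow (carrier V)"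
    proof
      fix X assume "X \<in> carrier ?V'"
      then obtain v where "v \<in> carrier V" "X = U +>\<^bsub>V\<^esub> v" using carrV by blast
      then show "X \<in> Pow (carrier V)"
        using U.subset by (auto simp: a_r_coset_def' subset_iff)
    qed
    then show "inj_on ((`) T) (carrier ?V')"
      by (rule inj_on_subset[OF inj_on_image_Pow[OF inj]])
    show "(`) T ` carrier ?V' = carrier ?W'"
    proof -
      have "carrier ?V' = (\<lambda>v. U +>\<^bsub>V\<^esub> v) ` carrier V" using carrV by blast
      then have "(`) T ` carrier ?V' = (`) T ` (\<lambda>v. U +>\<^bsub>V\<^esub> v) ` carrier V"
        by (rule arg_cong)
      also have "\<dots> = (\<lambda>v. T ` (U +>\<^bsub>V\<^esub> v)) ` carrier V"
        by (rule image_image)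
      also have "\<dots> = (\<lambda>v. T ` U +>\<^bsub>?W\<^esub> T v) ` carrier V"
        by (rule image_cong[OF refl img])
      finally show ?thesis unfolding carrW .
    qed
  qed
qed

section \<open>Spaces of homomorphisms and change of rings\<close>

locale complex_algebra = ring R for R :: "('r, 'b) ring_scheme" (structure) +
  fixes \<eta> :: "complex \<Rightarrow> 'r"
  assumes scalar_closed: "\<eta> c \<in> carrier R"
    and scalar_add: "\<eta> (c + d) = \<eta> c \<oplus> \<eta> d"
    and scalar_mult: "\<eta> (c * d) = \<eta> c \<otimes> \<eta> d"
    and scalar_one: "\<eta> 1 = \<one>"
    and scalar_central: "r \<in> carrier R \<Longrightarrow> \<eta> c \<otimes> r = r \<otimes> \<eta> c"

lemma vectorspace_of_left_module:
  assumes "left_module (class_ring :: complex ring) V"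
  shows "vectorspace (class_ring :: complex ring) V"
proof -
  interpret left_module "class_ring :: complex ring" V by fact
  have "module (class_ring :: complex ring) V"
    by (intro module.intro class_cring.is_cring M.abelian_group_axioms module_axioms.intro)
      (use smult_closed smult_l_distr smult_r_distr smult_assoc1 smult_one in auto)
  then show ?thesis by (rule vectorspace.intro) (rule class_field)
qed

lemma (in complex_algebra) vectorspace_scalars:
  assumes "left_module R M"
  shows "vectorspace (class_ring :: complex ring) (restrict_scalars \<eta> M)"
proof -
  have "\<eta> \<in> Ring.ring_hom (class_ring :: complex ring) R"
    by (rule ring_hom_memI) (simp_all add: scalar_closed scalar_add scalar_mult scalar_one)
  then show ?thesis
    by (intro vectorspace_of_left_module left_module_restrict_scalars[OF assms])
      (rule class_ring.ring_axioms)
qed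

lemma hom_space_simps [simp]:
  "carrier (hom_space \<eta> R N M) = module_hom R N M \<inter> extensional (carrier N)"
  "zero (hom_space \<eta> R N M) = (\<lambda>x\<in>carrier N. \<zero>\<^bsub>M\<^esub>)"
  "add (hom_space \<eta> R N M) f g = (\<lambda>x\<in>carrier N. f x \<oplus>\<^bsub>M\<^esub> g x)"
  "smult (hom_space \<eta> R N M) c f = (\<lambda>x\<in>carrier N. \<eta> c \<odot>\<^bsub>M\<^esub> f x)"
  by (simp_all add: hom_space_def)

lemma hom_spaceD:
  assumes "f \<in> carrier (hom_space \<eta> R N M)"
  shows "x \<in> carrier N \<Longrightarrow> f x \<in> carrier M"
    and "\<lbrakk>x \<in> carrier N; y \<in> carrier N\<rbrakk> \<Longrightarrow> f (x \<oplus>\<^bsub>N\<^esub> y) = f x \<oplus>\<^bsub>M\<^esub> f y"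
    and "\<lbrakk>r \<in> carrier R; x \<in> carrier N\<rbrakk> \<Longrightarrow> f (r \<odot>\<^bsub>N\<^esub> x) = r \<odot>\<^bsub>M\<^esub> f x"
    and "x \<notin> carrier N \<Longrightarrow> f x = undefined"
  using assms by (auto simp: module_hom_def extensional_def)

lemma hom_spaceI:
  assumes "\<And>x. x \<in> carrier N \<Longrightarrow> f x \<in> carrier M"
    and "\<And>x y. \<lbrakk>x \<in> carrier N; y \<in> carrier N\<rbrakk> \<Longrightarrow> f (x \<oplus>\<^bsub>N\<^esub> y) = f x \<oplus>\<^bsub>M\<^esub> f y"
    and "\<And>r x. \<lbrakk>r \<in> carrier R; x \<in> carrier N\<rbrakk> \<Longrightarrow> f (r \<odot>\<^bsub>N\<^esub> x) = r \<odot>\<^bsub>M\<^esub> f x"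
    and "\<And>x. x \<notin> carrier N \<Longrightarrow> f x = undefined"
  shows "f \<in> carrier (hom_space \<eta> R N M)"
  using assms by (auto simp: module_hom_def extensional_def)

lemma hom_space_eqI:
  assumes "f \<in> carrier (hom_space \<eta> R N M)" "g \<in> carrier (hom_space \<eta> R N M)"
    and "\<And>x. x \<in> carrier N \<Longrightarrow> f x = g x"
  shows "f = g"
  using assms by (auto intro: extensionalityI[of f "carrier N" g])

lemma (in complex_algebra) vectorspace_hom_space:
  assumes "left_module R N" "left_module R M"
  shows "vectorspace (class_ring :: complex ring) (hom_space \<eta> R N M)"
proof -
  interpret N: left_module R N by fact
  interpret M: left_module R M by fact
  let ?H = "hom_space \<eta> R N M"
  note clo = M.smult_closed scalar_closed M.M.a_closed M.M.zero_closed N.M.a_closed N.smult_closed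
  have zero: "\<zero>\<^bsub>?H\<^esub> \<in> carrier ?H"
    by (rule hom_spaceI) (simp_all add: clo M.smult_r_null)
  have add: "f \<oplus>\<^bsub>?H\<^esub> g \<in> carrier ?H" if "f \<in> carrier ?H" "g \<in> carrier ?H" for f g
    using hom_spaceD[OF that(1)] hom_spaceD[OF that(2)]
    by (intro hom_spaceI)
      (simp_all add: clo M.smult_r_distr M.M.a_assoc M.M.a_lcomm M.M.a_comm)
  have smult: "c \<odot>\<^bsub>?H\<^esub> f \<in> carrier ?H" if "f \<in> carrier ?H" for c f
  proof (rule hom_spaceI)
    fix r x assume r: "r \<in> carrier R" and x: "x \<in> carrier N"
    have "\<eta> c \<odot>\<^bsub>M\<^esub> (r \<odot>\<^bsub>M\<^esub> f x) = r \<odot>\<^bsub>M\<^esub> (\<eta> c \<odot>\<^bsub>M\<^esub> f x)"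
      using hom_spaceD(1)[OF that x] r by (simp add: M.smult_assoc1[symmetric] clo scalar_central)
    then show "(c \<odot>\<^bsub>?H\<^esub> f) (r \<odot>\<^bsub>N\<^esub> x) = r \<odot>\<^bsub>M\<^esub> (c \<odot>\<^bsub>?H\<^esub> f) x"
      using r x hom_spaceD(3)[OF that r x] by (simp add: clo)
  qed (use hom_spaceD[OF that] in \<open>simp_all add: clo M.smult_r_distr\<close>)
  have "abelian_group ?H"
  proof (rule abelian_groupI)
    fix f assume f: "f \<in> carrier ?H"
    have "(- 1) \<odot>\<^bsub>?H\<^esub> f \<oplus>\<^bsub>?H\<^esub> f = \<zero>\<^bsub>?H\<^esub>"
    proof (rule hom_space_eqI[OF add[OF smult[OF f] f] zero])
      fix x assume x: "x \<in> carrier N"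
      have "\<eta> (- 1) \<odot>\<^bsub>M\<^esub> f x \<oplus>\<^bsub>M\<^esub> f x = \<eta> (- 1 + 1) \<odot>\<^bsub>M\<^esub> f x"
        unfolding scalar_add using hom_spaceD(1)[OF f x] clo
        by (subst M.smult_l_distr) (simp_all add: scalar_one M.smult_one)
      also have "\<dots> = \<zero>\<^bsub>M\<^esub>"
        using scalar_add[of 0 0] scalar_closed[of 0] hom_spaceD(1)[OF f x]
        by (simp add: M.smult_l_null)
      finally show "((- 1) \<odot>\<^bsub>?H\<^esub> f \<oplus>\<^bsub>?H\<^esub> f) x = \<zero>\<^bsub>?H\<^esub> x" using x by simp
    qed
    with smult[OF f] show "\<exists>g\<in>carrier ?H. g \<oplus>\<^bsub>?H\<^esub> f = \<zero>\<^bsub>?H\<^esub>" by blast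
    show "\<zero>\<^bsub>?H\<^esub> \<oplus>\<^bsub>?H\<^esub> f = f"
      by (rule hom_space_eqI[OF add[OF zero f] f]) (use hom_spaceD(1)[OF f] in simp)
  next
    fix f g assume fg: "f \<in> carrier ?H" "g \<in> carrier ?H"
    show "f \<oplus>\<^bsub>?H\<^esub> g = g \<oplus>\<^bsub>?H\<^esub> f"
      by (rule hom_space_eqI[OF add[OF fg] add[OF fg(2,1)]])
        (use hom_spaceD(1)[OF fg(1)] hom_spaceD(1)[OF fg(2)] in \<open>simp add: M.M.a_comm\<close>)
    fix h assume h: "h \<in> carrier ?H"
    show "f \<oplus>\<^bsub>?H\<^esub> g \<oplus>\<^bsub>?H\<^esub> h = f \<oplus>\<^bsub>?H\<^esub> (g \<oplus>\<^bsub>?H\<^esub> h)"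
      by (rule hom_space_eqI[OF add[OF add[OF fg] h] add[OF fg(1) add[OF fg(2) h]]])
        (use hom_spaceD(1)[OF fg(1)] hom_spaceD(1)[OF fg(2)] hom_spaceD(1)[OF h]
          in \<open>simp add: M.M.a_assoc\<close>)
  qed (use zero add in simp_all)
  then have "left_module (class_ring :: complex ring) ?H"
  proof (intro left_module.intro left_module_axioms.intro class_ring.ring_axioms)
    fix c d f assume f: "f \<in> carrier ?H"
    show "(c \<otimes>\<^bsub>class_ring\<^esub> d) \<odot>\<^bsub>?H\<^esub> f = c \<odot>\<^bsub>?H\<^esub> (d \<odot>\<^bsub>?H\<^esub> f)"
      by (rule hom_space_eqI[OF smult[OF f] smult[OF smult[OF f]]])
        (use hom_spaceD(1)[OF f] in \<open>simp add: scalar_mult M.smult_assoc1 clo\<close>)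
    show "(c \<oplus>\<^bsub>class_ring\<^esub> d) \<odot>\<^bsub>?H\<^esub> f = c \<odot>\<^bsub>?H\<^esub> f \<oplus>\<^bsub>?H\<^esub> d \<odot>\<^bsub>?H\<^esub> f"
      by (rule hom_space_eqI[OF smult[OF f] add[OF smult[OF f] smult[OF f]]])
        (use hom_spaceD(1)[OF f] in \<open>simp add: scalar_add M.smult_l_distr clo\<close>)
    show "\<one>\<^bsub>class_ring\<^esub> \<odot>\<^bsub>?H\<^esub> f = f"
      by (rule hom_space_eqI[OF smult[OF f] f])
        (use hom_spaceD(1)[OF f] in \<open>simp add: scalar_one M.smult_one\<close>)
    fix g assume g: "g \<in> carrier ?H"
    show "c \<odot>\<^bsub>?H\<^esub> (f \<oplus>\<^bsub>?H\<^esub> g) = c \<odot>\<^bsub>?H\<^esub> f \<oplus>\<^bsub>?H\<^esub> c \<odot>\<^bsub>?H\<^esub> g"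
      by (rule hom_space_eqI[OF smult[OF add[OF f g]] add[OF smult[OF f] smult[OF g]]])
        (use hom_spaceD(1)[OF f] hom_spaceD(1)[OF g] in \<open>simp add: M.smult_r_distr clo\<close>)
  qed (assumption | rule smult)+
  then show ?thesis by (rule vectorspace_of_left_module)
qed

text \<open>The result is extensional, as the elements of a space of homomorphisms are.\<close>

definition precomp :: "('s, 'x) module \<Rightarrow> ('x \<Rightarrow> 'y) \<Rightarrow> ('y \<Rightarrow> 'm) \<Rightarrow> 'x \<Rightarrow> 'm" where
  "precomp X g \<psi> = (\<lambda>x\<in>carrier X. \<psi> (g x))"

text \<open>
  A surjection \<open>\<pi>\<close> of complex algebras.  A map \<open>g\<close> from an \<open>S\<close>-module to an \<open>R\<close>-module is
  semilinear along \<open>\<pi>\<close> if it is \<open>S\<close>-linear after restriction of scalars on the target.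
\<close>

locale scalar_change =
  S?: complex_algebra S \<theta> + R?: complex_algebra R \<eta>
  for S :: "('s, 'd) ring_scheme" and \<theta> and R :: "('r, 'b) ring_scheme" and \<eta> +
  fixes \<pi> :: "'s \<Rightarrow> 'r"
  assumes hom: "\<pi> \<in> Ring.ring_hom S R"
    and surj: "\<pi> ` carrier S = carrier R"
    and scalar: "\<pi> (\<theta> c) = \<eta> c"
begin

context
  fixes X :: "('s, 'x) module" and Y :: "('r, 'y) module" and M :: "('r, 'm) module" and g
  assumes X: "left_module S X" and Y: "left_module R Y" and M: "left_module R M"
    and g: "g \<in> module_hom S X (restrict_scalars \<pi> Y)"
begin

lemma semilinearD:
  "x \<in> carrier X \<Longrightarrow> g x \<in> carrier Y"
  "\<lbrakk>x \<in> carrier X; y \<in> carrier X\<rbrakk> \<Longrightarrow> g (x \<oplus>\<^bsub>X\<^esub> y) = g x \<oplus>\<^bsub>Y\<^esub> g y"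
  "\<lbrakk>s \<in> carrier S; x \<in> carrier X\<rbrakk> \<Longrightarrow> g (s \<odot>\<^bsub>X\<^esub> x) = \<pi> s \<odot>\<^bsub>Y\<^esub> g x"
  using g by (auto simp: module_hom_def)

lemma precomp_hom:
  assumes \<psi>: "\<psi> \<in> carrier (hom_space \<eta> R Y M)"
  shows "precomp X g \<psi> \<in> carrier (hom_space \<theta> S X (restrict_scalars \<pi> M))"
proof -
  interpret X: left_module S X by (rule X)
  note \<psi>D = hom_spaceD[OF \<psi>]
  show ?thesis
    by (rule hom_spaceI)
      (simp_all add: precomp_def semilinearD \<psi>D X.smult_closed X.M.a_closed ring_hom_closed[OF hom])
qed

lemma precomp_linear:
  "linear_map (class_ring :: complex ring) (hom_space \<eta> R Y M)
    (hom_space \<theta> S X (restrict_scalars \<pi> M)) (precomp X g)"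
proof -
  let ?V = "hom_space \<eta> R Y M" and ?W = "hom_space \<theta> S X (restrict_scalars \<pi> M)"
  have V: "vectorspace (class_ring :: complex ring) ?V"
    by (rule R.vectorspace_hom_space[OF Y M])
  have W: "vectorspace (class_ring :: complex ring) ?W"
    by (rule S.vectorspace_hom_space[OF X left_module_restrict_scalars[OF M S.ring_axioms hom]])
  have "precomp X g \<in> module_hom (class_ring :: complex ring) ?V ?W"
  proof (rule module_homI)
    show "precomp X g \<psi> \<in> carrier ?W" if "\<psi> \<in> carrier ?V" for \<psi>
      using that by (rule precomp_hom)
  qed (auto simp: precomp_def semilinearD scalar fun_eq_iff)
  then show ?thesis
    by (intro linear_map.intro V W mod_hom.intro mod_hom_axioms.intro
        vectorspace.axioms(1)[OF V] vectorspace.axioms(1)[OF W])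
qed

lemma precomp_inj:
  assumes "g ` carrier X = carrier Y"
  shows "inj_on (precomp X g) (carrier (hom_space \<eta> R Y M))"
proof (rule inj_onI)
  fix \<psi> \<chi> assume \<psi>: "\<psi> \<in> carrier (hom_space \<eta> R Y M)" and \<chi>: "\<chi> \<in> carrier (hom_space \<eta> R Y M)"
    and eq: "precomp X g \<psi> = precomp X g \<chi>"
  show "\<psi> = \<chi>"
  proof (rule hom_space_eqI[OF \<psi> \<chi>])
    fix y assume "y \<in> carrier Y"
    then obtain x where "x \<in> carrier X" "y = g x" using assms by blast
    then show "\<psi> y = \<chi> y" using fun_cong[OF eq, of x] by (simp add: precomp_def)
  qed
qed

text \<open>A homomorphism killing the kernel of a semilinear surjection descends along it.\<close>

lemma precomp_image:
  assumes gsurj: "g ` carrier X = carrier Y"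
  shows "precomp X g ` carrier (hom_space \<eta> R Y M) =
    {\<phi> \<in> carrier (hom_space \<theta> S X (restrict_scalars \<pi> M)).
      \<forall>x\<in>carrier X. g x = \<zero>\<^bsub>Y\<^esub> \<longrightarrow> \<phi> x = \<zero>\<^bsub>M\<^esub>}" (is "?L = ?R")
proof
  interpret X: left_module S X by (rule X)
  interpret Y: left_module R Y by (rule Y)
  interpret M: left_module R M by (rule M)
  interpret SM: left_module S "restrict_scalars \<pi> M"
    by (rule left_module_restrict_scalars[OF M S.ring_axioms hom])
  show "?L \<subseteq> ?R"
  proof
    fix \<phi> assume "\<phi> \<in> ?L"
    then obtain \<psi> where \<psi>: "\<psi> \<in> carrier (hom_space \<eta> R Y M)" "\<phi> = precomp X g \<psi>" by blast
    have "\<psi> \<zero>\<^bsub>Y\<^esub> = \<zero>\<^bsub>M\<^esub>"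
      using module_hom_zero[OF Y M, of \<psi>] \<psi>(1) by simp
    with \<psi> precomp_hom[OF \<psi>(1)] show "\<phi> \<in> ?R" by (simp add: precomp_def)
  qed
  show "?R \<subseteq> ?L"
  proof
    fix \<phi> assume "\<phi> \<in> ?R"
    then have \<phi>: "\<phi> \<in> carrier (hom_space \<theta> S X (restrict_scalars \<pi> M))"
      and ker: "\<And>x. \<lbrakk>x \<in> carrier X; g x = \<zero>\<^bsub>Y\<^esub>\<rbrakk> \<Longrightarrow> \<phi> x = \<zero>\<^bsub>M\<^esub>" by auto
    note \<phi>D = hom_spaceD[OF \<phi>, unfolded restrict_scalars_simps]
    have eq: "\<phi> x = \<phi> y" if x: "x \<in> carrier X" and y: "y \<in> carrier X" and gxy: "g x = g y" for x y
    proof -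
      let ?y = "\<ominus>\<^bsub>X\<^esub> y"
      have y': "?y \<in> carrier X" "y \<oplus>\<^bsub>X\<^esub> ?y = \<zero>\<^bsub>X\<^esub>"
        using y by (simp_all add: X.M.r_neg)
      have "g y \<oplus>\<^bsub>Y\<^esub> g ?y = \<zero>\<^bsub>Y\<^esub>"
        using semilinearD(2)[OF y y'(1)] y'(2) module_hom_zero[OF X _ g]
          left_module_restrict_scalars[OF Y S.ring_axioms hom] by simp
      then have "g (x \<oplus>\<^bsub>X\<^esub> ?y) = \<zero>\<^bsub>Y\<^esub>"
        using semilinearD(2)[OF x y'(1)] gxy by simp
      then have "\<phi> x \<oplus>\<^bsub>M\<^esub> \<phi> ?y = \<phi> y \<oplus>\<^bsub>M\<^esub> \<phi> ?y"
        using ker[of "x \<oplus>\<^bsub>X\<^esub> ?y"] ker[of "y \<oplus>\<^bsub>X\<^esub> ?y"] x y y'(1)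
          \<open>g y \<oplus>\<^bsub>Y\<^esub> g ?y = \<zero>\<^bsub>Y\<^esub>\<close> semilinearD(2)[OF y y'(1)]
          \<phi>D(2)[OF x y'(1)] \<phi>D(2)[OF y y'(1)] X.M.a_closed by simp
      then show ?thesis
        using \<phi>D(1)[OF x] \<phi>D(1)[OF y] \<phi>D(1)[OF y'(1)] by simp
    qed
    define s where "s y = inv_into (carrier X) g y" for y
    have s: "s y \<in> carrier X" "g (s y) = y" if "y \<in> carrier Y" for y
      using that gsurj unfolding s_def by (auto simp: inv_into_into f_inv_into_f)
    define \<psi> where "\<psi> = (\<lambda>y\<in>carrier Y. \<phi> (s y))"
    have \<psi>g: "\<psi> (g x) = \<phi> x" if "x \<in> carrier X" for x
      using that semilinearD(1)[OF that] s eq[of "s (g x)" x] by (simp add: \<psi>_def)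
    have "\<psi> \<in> carrier (hom_space \<eta> R Y M)"
    proof (rule hom_spaceI)
      fix x y assume "x \<in> carrier Y" "y \<in> carrier Y"
      then obtain x' y' where "x' \<in> carrier X" "x = g x'" "y' \<in> carrier X" "y = g y'"
        using gsurj by blast
      then show "\<psi> (x \<oplus>\<^bsub>Y\<^esub> y) = \<psi> x \<oplus>\<^bsub>M\<^esub> \<psi> y"
        by (simp add: semilinearD(2)[symmetric] \<psi>g \<phi>D)
    next
      fix r y assume "r \<in> carrier R" "y \<in> carrier Y"
      then obtain r' y' where "r' \<in> carrier S" "r = \<pi> r'" "y' \<in> carrier X" "y = g y'"
        using gsurj surj by blast
      then show "\<psi> (r \<odot>\<^bsub>Y\<^esub> y) = r \<odot>\<^bsub>M\<^esub> \<psi> y"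
        by (simp add: semilinearD(3)[symmetric] \<psi>g \<phi>D X.smult_closed)
    qed (use s \<phi>D in \<open>simp_all add: \<psi>_def\<close>)
    moreover have "\<phi> = precomp X g \<psi>"
      using \<phi>D(4) \<psi>g by (auto simp: precomp_def fun_eq_iff)
    ultimately show "\<phi> \<in> ?L" by blast
  qed
qed

end

end

section \<open>The first extension space\<close>

lemma (in scalar_change) submodule_precomp_image:
  assumes "left_module S X" "left_module R Y" "left_module R M"
    and "g \<in> module_hom S X (restrict_scalars \<pi> Y)"
  shows "submodule (class_ring :: complex ring)
    (precomp X g ` carrier (hom_space \<eta> R Y M)) (hom_space \<theta> S X (restrict_scalars \<pi> M))"
proof -
  interpret linear_map "class_ring :: complex ring" "hom_space \<eta> R Y M"
    "hom_space \<theta> S X (restrict_scalars \<pi> M)" "precomp X g"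
    by (rule precomp_linear[OF assms])
  show ?thesis using im_is_submodule by (simp add: im_def)
qed

lemma (in complex_algebra) scalar_change_id: "scalar_change R \<eta> R \<eta> (\<lambda>r. r)"
  by (intro scalar_change.intro scalar_change_axioms.intro complex_algebra_axioms)
    (auto intro: ring_hom_memI)

lemma (in plain_left_module) syzygy_inclusion:
  "(\<lambda>f. f) \<in> module_hom R (syzygy R M) (free_module R (carrier M))"
  by (rule module_homI) (simp_all add: carrier_syzygy)

text \<open>
  A cocycle vanishes on the kernel of the differential \<open>P\<^sub>1 \<rightarrow> P\<^sub>0\<close>, hence descends to the image of
  that differential, the first syzygy.  So \<open>Ext\<^sup>1\<close> is the space of homomorphisms on the first syzygy
  modulo those that extend to the free module \<open>P\<^sub>0\<close>.
\<close>

theorem (in complex_algebra) dim_ext1_eq_syzygy: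
  fixes N :: "('r, 'n) module" and M :: "('r, 'm) module"
  assumes N: "left_module R N" and M: "left_module R M"
  shows "cdim (ext1 \<eta> R N M) =
    cdim (quotient_module (hom_space \<eta> R (syzygy R N) M)
      (precomp (syzygy R N) (\<lambda>f. f) ` carrier (hom_space \<eta> R (free_module R (carrier N)) M)))"
proof -
  interpret scalar_change R \<eta> R \<eta> "\<lambda>r. r" by (rule scalar_change_id)
  let ?K0 = "syzygy R N" and ?P0 = "free_module R (carrier N)"
  interpret N: plain_left_module R N using N by (simp add: plain_left_module_def)
  have K0: "left_module R ?K0" by (rule N.left_module_syzygy)
  interpret K0: plain_left_module R ?K0 using K0 by (simp add: plain_left_module_def)
  let ?K1 = "syzygy R ?K0" and ?P1 = "free_module R (carrier ?K0)"
  have K1: "left_module R ?K1" by (rule K0.left_module_syzygy)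
  interpret K1: plain_left_module R ?K1 using K1 by (simp add: plain_left_module_def)
  let ?P2 = "free_module R (carrier ?K1)"
  let ?d1 = "free_cover R ?K0" and ?d2 = "free_cover R ?K1"
  have P0: "left_module R ?P0" and P1: "left_module R ?P1" by (rule left_module_free)+
  let ?H0 = "hom_space \<eta> R ?K0 M" and ?H1 = "hom_space \<eta> R ?P1 M"
  let ?U = "precomp ?K0 (\<lambda>f. f) ` carrier (hom_space \<eta> R ?P0 M)"
  note [simp] = restrict_scalars_id
  have d1: "?d1 \<in> module_hom R ?P1 (restrict_scalars (\<lambda>r. r) ?K0)"
    using K0.free_cover_hom by simp
  have U: "submodule (class_ring :: complex ring) ?U ?H0"
    using submodule_precomp_image[OF K0 P0 M] N.syzygy_inclusion by simp
  have lin: "linear_map (class_ring :: complex ring) ?H0 ?H1 (precomp ?P1 ?d1)"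
    using precomp_linear[OF P1 K0 M d1] by simp
  have Z: "precomp ?P1 ?d1 ` carrier ?H0 =
    {\<phi> \<in> carrier ?H1. \<forall>y\<in>carrier ?P2. \<phi> (?d2 y) = \<zero>\<^bsub>M\<^esub>}"
  proof -
    have img: "?d2 ` carrier ?P2 = {x \<in> carrier ?P1. ?d1 x = \<zero>\<^bsub>?K0\<^esub>}"
      unfolding K1.free_cover_surj by (simp add: carrier_syzygy[of R ?K0])
    have iff: "(\<forall>x\<in>carrier ?P1. ?d1 x = \<zero>\<^bsub>?K0\<^esub> \<longrightarrow> \<phi> x = \<zero>\<^bsub>M\<^esub>) \<longleftrightarrow>
      (\<forall>y\<in>carrier ?P2. \<phi> (?d2 y) = \<zero>\<^bsub>M\<^esub>)" for \<phi> :: "_ \<Rightarrow> 'm"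
    proof -
      have "(\<forall>y\<in>carrier ?P2. \<phi> (?d2 y) = \<zero>\<^bsub>M\<^esub>) \<longleftrightarrow>
        (\<forall>x\<in>?d2 ` carrier ?P2. \<phi> x = \<zero>\<^bsub>M\<^esub>)" by blast
      then show ?thesis unfolding img by blast
    qed
    show ?thesis
      unfolding precomp_image[OF P1 K0 M d1 K0.free_cover_surj] iff restrict_scalars_id ..
  qed
  have B: "(\<lambda>\<psi>. \<lambda>x\<in>carrier ?P1. \<psi> (?d1 x)) ` carrier (hom_space \<eta> R ?P0 M) =
    precomp ?P1 ?d1 ` ?U"
    unfolding image_image
  proof (rule image_cong[OF refl])
    fix \<psi> :: "_ \<Rightarrow> 'm"
    have "?d1 x \<in> carrier ?K0" if "x \<in> carrier ?P1" for x
      using K0.free_cover_hom that by (auto simp: module_hom_def)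
    then show "(\<lambda>x\<in>carrier ?P1. \<psi> (?d1 x)) = precomp ?P1 ?d1 (precomp ?K0 (\<lambda>f. f) \<psi>)"
      by (auto simp: precomp_def fun_eq_iff)
  qed
  show ?thesis
    unfolding ext1_def Let_def B Z[symmetric]
    by (rule dim_quotient_inj_image[OF lin precomp_inj[OF P1 K0 M d1 K0.free_cover_surj] U,
          symmetric])
qed

context scalar_change
begin

context
  fixes N :: "('r, 'n) module"
  assumes N: "left_module R N"
begin

lemma plain_modules:
  "plain_left_module R N" "plain_left_module S (restrict_scalars \<pi> N)"
  using N left_module_restrict_scalars[OF N S.ring_axioms hom]
  by (simp_all add: plain_left_module_def)

lemma hom_zero: "\<pi> \<zero>\<^bsub>S\<^esub> = \<zero>\<^bsub>R\<^esub>"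
  by (rule ring_hom_zero[OF hom S.ring_axioms R.ring_axioms])

lemma free_module_map:
  assumes f: "f \<in> carrier (free_module S (carrier N))"
  shows "(\<lambda>x. \<pi> (f x)) \<in> carrier (free_module R (carrier N))"
    and "free_cover R N (\<lambda>x. \<pi> (f x)) = free_cover S (restrict_scalars \<pi> N) f"
proof -
  interpret N: plain_left_module R N by (rule plain_modules)
  interpret SN: plain_left_module S "restrict_scalars \<pi> N" by (rule plain_modules)
  let ?A = "{x. f x \<noteq> \<zero>\<^bsub>S\<^esub>}"
  have A: "finite ?A" "?A \<subseteq> carrier N" using free_module_support[OF f] by auto
  have "{x. \<pi> (f x) \<noteq> \<zero>\<^bsub>R\<^esub>} \<subseteq> ?A" using hom_zero by auto
  then show mem: "(\<lambda>x. \<pi> (f x)) \<in> carrier (free_module R (carrier N))"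
    using f A hom_zero by (auto simp: mem_free_module ring_hom_closed[OF hom] intro: finite_subset)
  have "free_cover R N (\<lambda>x. \<pi> (f x)) = (\<Oplus>\<^bsub>N\<^esub>x\<in>?A. \<pi> (f x) \<odot>\<^bsub>N\<^esub> x)"
    by (rule N.free_cover_eq[OF mem A]) (use hom_zero in auto)
  also have "\<dots> = free_cover S (restrict_scalars \<pi> N) f"
    using SN.free_cover_eq[of f ?A] f A by simp
  finally show "free_cover R N (\<lambda>x. \<pi> (f x)) = free_cover S (restrict_scalars \<pi> N) f" .
qed

lemma free_module_map_semilinear:
  "(\<lambda>f x. \<pi> (f x)) \<in> module_hom S (free_module S (carrier N))
    (restrict_scalars \<pi> (free_module R (carrier N)))"
  by (rule module_homI)
    (simp_all add: free_module_map S.free_module_value ring_hom_add[OF hom] ring_hom_mult[OF hom])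

lemma free_module_map_surj:
  "(\<lambda>f x. \<pi> (f x)) ` carrier (free_module S (carrier N)) = carrier (free_module R (carrier N))"
proof
  show "carrier (free_module R (carrier N)) \<subseteq> (\<lambda>f x. \<pi> (f x)) ` carrier (free_module S (carrier N))"
  proof
    fix f assume f: "f \<in> carrier (free_module R (carrier N))"
    \<comment> \<open>Zero must be lifted to zero to keep the support finite.\<close>
    define h where "h x = (if f x = \<zero>\<^bsub>R\<^esub> then \<zero>\<^bsub>S\<^esub> else inv_into (carrier S) \<pi> (f x))" for x
    have val: "f x \<in> \<pi> ` carrier S" for x
      using R.free_module_value[OF f] surj by simp
    have "{x. h x \<noteq> \<zero>\<^bsub>S\<^esub>} \<subseteq> {x. f x \<noteq> \<zero>\<^bsub>R\<^esub>}" by (auto simp: h_def)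
    then have "h \<in> carrier (free_module S (carrier N))"
      using free_module_support[OF f] inv_into_into[OF val]
      by (auto simp: mem_free_module h_def intro: finite_subset)
    moreover have "f = (\<lambda>x. \<pi> (h x))"
      using f_inv_into_f[OF val] hom_zero by (auto simp: h_def)
    ultimately show "f \<in> (\<lambda>f x. \<pi> (f x)) ` carrier (free_module S (carrier N))" by blast
  qed
qed (use free_module_map in blast)

lemma syzygy_map_semilinear:
  "(\<lambda>f x. \<pi> (f x)) \<in> module_hom S (syzygy S (restrict_scalars \<pi> N))
    (restrict_scalars \<pi> (syzygy R N))"
  by (rule module_homI)
    (auto simp: carrier_syzygy free_module_map S.free_module_value
      ring_hom_add[OF hom] ring_hom_mult[OF hom])

lemma syzygy_map_surj:
  "(\<lambda>f x. \<pi> (f x)) ` carrier (syzygy S (restrict_scalars \<pi> N)) = carrier (syzygy R N)"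
proof
  show "(\<lambda>f x. \<pi> (f x)) ` carrier (syzygy S (restrict_scalars \<pi> N)) \<subseteq> carrier (syzygy R N)"
    by (auto simp: carrier_syzygy free_module_map)
  show "carrier (syzygy R N) \<subseteq> (\<lambda>f x. \<pi> (f x)) ` carrier (syzygy S (restrict_scalars \<pi> N))"
  proof
    fix f assume f: "f \<in> carrier (syzygy R N)"
    then have "f \<in> (\<lambda>f x. \<pi> (f x)) ` carrier (free_module S (carrier N))"
      unfolding free_module_map_surj by (simp add: carrier_syzygy)
    then obtain h where "h \<in> carrier (free_module S (carrier N))" "f = (\<lambda>x. \<pi> (h x))" by blast
    with f show "f \<in> (\<lambda>f x. \<pi> (f x)) ` carrier (syzygy S (restrict_scalars \<pi> N))"
      by (auto simp: carrier_syzygy free_module_map)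
  qed
qed

text \<open>
  Such an \<open>f\<close> is a finite sum of multiples of basis elements by elements of the kernel of \<open>\<pi>\<close>, and
  each summand is mapped to zero by the free cover and by \<open>\<phi>\<close>.
\<close>

lemma hom_kills_kernel_coefficients:
  assumes \<phi>: "\<phi> \<in> module_hom S (syzygy S (restrict_scalars \<pi> N)) L" and L: "left_module S L"
    and kills: "\<And>x s. \<lbrakk>x \<in> carrier N; s \<in> carrier S; \<pi> s = \<zero>\<^bsub>R\<^esub>\<rbrakk> \<Longrightarrow>
      \<phi> (free_single S x s) = \<zero>\<^bsub>L\<^esub>"
    and f: "f \<in> carrier (free_module S (carrier N))" and 0: "\<And>x. \<pi> (f x) = \<zero>\<^bsub>R\<^esub>"
  shows "f \<in> carrier (syzygy S (restrict_scalars \<pi> N)) \<and> \<phi> f = \<zero>\<^bsub>L\<^esub>"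
proof -
  interpret L: left_module S L by (rule L)
  interpret SN: plain_left_module S "restrict_scalars \<pi> N" by (rule plain_modules)
  interpret N: plain_left_module R N by (rule plain_modules)
  let ?K = "syzygy S (restrict_scalars \<pi> N)"
  interpret K: left_module S ?K by (rule SN.left_module_syzygy)
  have "\<forall>f. {x. f x \<noteq> \<zero>\<^bsub>S\<^esub>} \<subseteq> A \<and> f \<in> carrier (free_module S (carrier N)) \<and>
      (\<forall>x. \<pi> (f x) = \<zero>\<^bsub>R\<^esub>) \<longrightarrow> f \<in> carrier ?K \<and> \<phi> f = \<zero>\<^bsub>L\<^esub>" if "finite A" for A
    using that
  proof (induction A)
    case empty
    have "f = \<zero>\<^bsub>?K\<^esub>" if "{x. f x \<noteq> \<zero>\<^bsub>S\<^esub>} \<subseteq> {}" for f using that by auto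
    then show ?case
      using module_hom_zero[OF K.left_module_axioms L \<phi>] K.M.zero_closed by metis
  next
    case (insert a A)
    show ?case
    proof (intro allI impI, elim conjE)
      fix f assume sup: "{x. f x \<noteq> \<zero>\<^bsub>S\<^esub>} \<subseteq> insert a A"
        and f: "f \<in> carrier (free_module S (carrier N))" and 0: "\<forall>x. \<pi> (f x) = \<zero>\<^bsub>R\<^esub>"
      note val = S.free_module_value[OF f]
      let ?g = "f(a := \<zero>\<^bsub>S\<^esub>)" and ?s = "free_single S a (f a)"
      have "{x. ?g x \<noteq> \<zero>\<^bsub>S\<^esub>} \<subseteq> {x. f x \<noteq> \<zero>\<^bsub>S\<^esub>}" by auto
      then have "?g \<in> carrier (free_module S (carrier N))"
        using f by (auto simp: mem_free_module intro: finite_subset)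
      moreover have "{x. ?g x \<noteq> \<zero>\<^bsub>S\<^esub>} \<subseteq> A" using sup by auto
      ultimately have g: "?g \<in> carrier ?K \<and> \<phi> ?g = \<zero>\<^bsub>L\<^esub>"
        using insert.IH[rule_format, of ?g] 0 hom_zero by simp
      show "f \<in> carrier ?K \<and> \<phi> f = \<zero>\<^bsub>L\<^esub>"
      proof (cases "a \<in> carrier N")
        case False
        then have "f = ?g" using f by (auto simp: mem_free_module)
        with g show ?thesis by simp
      next
        case True
        have "free_cover S (restrict_scalars \<pi> N) ?s = \<zero>\<^bsub>N\<^esub>"
          using SN.free_cover_single[of a "f a"] True val 0 N.smult_l_null by simp
        then have s: "?s \<in> carrier ?K" "\<phi> ?s = \<zero>\<^bsub>L\<^esub>"
          using True val 0 kills[of a "f a"] by (auto simp: carrier_syzygy S.free_single_closed)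
        have f_eq: "f = ?s \<oplus>\<^bsub>?K\<^esub> ?g"
          using val by (auto simp: free_single_def)
        have "f \<in> carrier ?K" using f_eq K.M.a_closed[OF s(1)] g by metis
        moreover have "\<phi> f = \<phi> ?s \<oplus>\<^bsub>L\<^esub> \<phi> ?g"
          using module_hom_add[OF \<phi> s(1)] g f_eq by metis
        ultimately show ?thesis using s g by simp
      qed
    qed
  qed
  then show ?thesis using free_module_support(1)[OF f] f 0 by blast
qed

text \<open>
  Linearity forces homomorphisms on the free module to kill the elements with coefficients in the kernel
  of \<open>\<pi>\<close>.  If homomorphisms on the syzygy over \<open>S\<close> kill them too, they are the homomorphisms on the
  syzygy over \<open>R\<close>.
\<close>

theorem dim_ext1_change_of_rings:
  fixes M :: "('r, 'm) module"
  assumes M: "left_module R M"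
    and kills: "\<And>\<phi> x s. \<lbrakk>\<phi> \<in> module_hom S (syzygy S (restrict_scalars \<pi> N)) (restrict_scalars \<pi> M);
      x \<in> carrier N; s \<in> carrier S; \<pi> s = \<zero>\<^bsub>R\<^esub>\<rbrakk> \<Longrightarrow> \<phi> (free_single S x s) = \<zero>\<^bsub>M\<^esub>"
  shows "cdim (ext1 \<theta> S (restrict_scalars \<pi> N) (restrict_scalars \<pi> M)) = cdim (ext1 \<eta> R N M)"
proof -
  let ?SN = "restrict_scalars \<pi> N" and ?SM = "restrict_scalars \<pi> M"
  have SM: "left_module S ?SM" by (rule left_module_restrict_scalars[OF M S.ring_axioms hom])
  interpret N: plain_left_module R N by (rule plain_modules)
  interpret SN: plain_left_module S ?SN by (rule plain_modules)
  interpret SM: left_module S ?SM by (rule SM)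
  let ?K = "syzygy R N" and ?SK = "syzygy S ?SN"
  let ?P = "free_module R (carrier N)" and ?SP = "free_module S (carrier N)"
  let ?\<pi> = "\<lambda>f x. \<pi> (f x)"
  let ?H = "hom_space \<eta> R ?K M" and ?SH = "hom_space \<theta> S ?SK ?SM"
  let ?U = "precomp ?K (\<lambda>f. f) ` carrier (hom_space \<eta> R ?P M)"
  note K = N.left_module_syzygy and SK = SN.left_module_syzygy
  have P: "left_module R ?P" and SP: "left_module S ?SP"
    by (rule R.left_module_free S.left_module_free)+
  have U: "submodule (class_ring :: complex ring) ?U ?H"
    using scalar_change.submodule_precomp_image[OF R.scalar_change_id K P M] N.syzygy_inclusion
    by (simp add: restrict_scalars_id)
  have SH: "precomp ?SK ?\<pi> ` carrier ?H = carrier ?SH"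
    unfolding precomp_image[OF SK K M syzygy_map_semilinear syzygy_map_surj]
  proof (intro equalityI subsetI CollectI conjI ballI impI)
    fix \<phi> f assume \<phi>: "\<phi> \<in> carrier ?SH" and f: "f \<in> carrier ?SK" and "?\<pi> f = \<zero>\<^bsub>?K\<^esub>"
    then have "\<pi> (f x) = \<zero>\<^bsub>R\<^esub>" for x by (auto dest: fun_cong)
    with \<phi> f kills show "\<phi> f = \<zero>\<^bsub>M\<^esub>"
      using hom_kills_kernel_coefficients[of \<phi> ?SM f] SM by (simp add: carrier_syzygy)
  qed auto
  have SHP: "precomp ?SP ?\<pi> ` carrier (hom_space \<eta> R ?P M) = carrier (hom_space \<theta> S ?SP ?SM)"
    unfolding precomp_image[OF SP P M free_module_map_semilinear free_module_map_surj]
  proof (intro equalityI subsetI CollectI conjI ballI impI)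
    fix \<phi> f assume \<phi>: "\<phi> \<in> carrier (hom_space \<theta> S ?SP ?SM)" and f: "f \<in> carrier ?SP"
      and "?\<pi> f = \<zero>\<^bsub>?P\<^esub>"
    then have 0: "\<pi> (f x) = \<zero>\<^bsub>R\<^esub>" for x by (auto dest: fun_cong)
    have "\<phi> (free_single S x s) = \<zero>\<^bsub>?SM\<^esub>"
      if x: "x \<in> carrier N" and s: "s \<in> carrier S" "\<pi> s = \<zero>\<^bsub>R\<^esub>" for x s
    proof -
      have "free_single S x s = s \<odot>\<^bsub>?SP\<^esub> free_single S x \<one>\<^bsub>S\<^esub>"
        using s by (auto simp: free_single_def)
      then have "\<phi> (free_single S x s) = s \<odot>\<^bsub>?SM\<^esub> \<phi> (free_single S x \<one>\<^bsub>S\<^esub>)"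
        using hom_spaceD(3)[OF \<phi> s(1) S.free_single_closed[OF x S.one_closed]] by simp
      moreover have "\<phi> (free_single S x \<one>\<^bsub>S\<^esub>) \<in> carrier M"
        using hom_spaceD(1)[OF \<phi> S.free_single_closed[OF x S.one_closed]] by simp
      ultimately show ?thesis
        using s left_module.smult_l_null[OF M] by simp
    qed
    moreover have "\<phi> \<in> module_hom S ?SK ?SM"
      using \<phi> by (auto simp: module_hom_def carrier_syzygy)
    ultimately show "\<phi> f = \<zero>\<^bsub>M\<^esub>"
      using hom_kills_kernel_coefficients[of \<phi> ?SM f] SM f 0 by simp
  qed auto
  have SU: "precomp ?SK ?\<pi> ` ?U = precomp ?SK (\<lambda>f. f) ` carrier (hom_space \<theta> S ?SP ?SM)"
    unfolding SHP[symmetric] image_image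
  proof (rule image_cong[OF refl])
    fix \<psi> :: "_ \<Rightarrow> 'm"
    have "?\<pi> f \<in> carrier ?K" "f \<in> carrier ?SP" if "f \<in> carrier ?SK" for f
      using syzygy_map_surj that by (auto simp: carrier_syzygy)
    then show "precomp ?SK ?\<pi> (precomp ?K (\<lambda>f. f) \<psi>) = precomp ?SK (\<lambda>f. f) (precomp ?SP ?\<pi> \<psi>)"
      by (auto simp: precomp_def fun_eq_iff)
  qed
  have "cdim (quotient_module ?H ?U) =
    cdim (quotient_module (?SH\<lparr>carrier := precomp ?SK ?\<pi> ` carrier ?H\<rparr>) (precomp ?SK ?\<pi> ` ?U))"
    by (rule dim_quotient_inj_image[OF precomp_linear[OF SK K M syzygy_map_semilinear]
          precomp_inj[OF SK K M syzygy_map_semilinear syzygy_map_surj] U])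
  also have "?SH\<lparr>carrier := precomp ?SK ?\<pi> ` carrier ?H\<rparr> = ?SH"
    unfolding SH by simp
  finally show ?thesis
    unfolding S.dim_ext1_eq_syzygy[OF SN.left_module_axioms SM] R.dim_ext1_eq_syzygy[OF N M] SU
    by simp
qed

end

end

section \<open>Nakayama's lemma for quasi-regular ideals\<close>

context left_module
begin

definition lin_span :: "'r set \<Rightarrow> 'm set \<Rightarrow> 'm set" where
  "lin_span I B = {\<Oplus>\<^bsub>M\<^esub>b\<in>B. c b \<odot>\<^bsub>M\<^esub> b | c. c \<in> B \<rightarrow> I}"

context
  fixes I B
  assumes I: "ideal I R" and B: "B \<subseteq> carrier M"
begin

lemma coeff_closed: "c \<in> B \<rightarrow> I \<Longrightarrow> (\<lambda>b. c b \<odot>\<^bsub>M\<^esub> b) \<in> B \<rightarrow> carrier M"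
  using B ideal.Icarr[OF I] by (auto intro!: smult_closed)

lemma lin_span_closed: "lin_span I B \<subseteq> carrier M"
  unfolding lin_span_def using coeff_closed by (auto intro: M.finsum_closed)

lemma zero_in_lin_span: "\<zero>\<^bsub>M\<^esub> \<in> lin_span I B"
proof -
  interpret I: ideal I R by (rule I)
  have "(\<Oplus>\<^bsub>M\<^esub>b\<in>B. \<zero> \<odot>\<^bsub>M\<^esub> b) = (\<Oplus>\<^bsub>M\<^esub>b\<in>B. \<zero>\<^bsub>M\<^esub>)"
    by (rule M.finsum_cong') (use B smult_l_null in auto)
  then show ?thesis
    unfolding lin_span_def using I.zero_closed by (intro CollectI exI[of _ "\<lambda>b. \<zero>"]) auto
qed

lemma add_in_lin_span:
  assumes "x \<in> lin_span I B" "y \<in> lin_span I B" shows "x \<oplus>\<^bsub>M\<^esub> y \<in> lin_span I B"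
proof -
  interpret I: ideal I R by (rule I)
  obtain c d where cd: "c \<in> B \<rightarrow> I" "d \<in> B \<rightarrow> I"
    "x = (\<Oplus>\<^bsub>M\<^esub>b\<in>B. c b \<odot>\<^bsub>M\<^esub> b)" "y = (\<Oplus>\<^bsub>M\<^esub>b\<in>B. d b \<odot>\<^bsub>M\<^esub> b)"
    using assms by (auto simp: lin_span_def)
  have "x \<oplus>\<^bsub>M\<^esub> y = (\<Oplus>\<^bsub>M\<^esub>b\<in>B. c b \<odot>\<^bsub>M\<^esub> b \<oplus>\<^bsub>M\<^esub> d b \<odot>\<^bsub>M\<^esub> b)"
    unfolding cd by (rule M.finsum_addf[symmetric]) (use cd coeff_closed in auto)
  also have "\<dots> = (\<Oplus>\<^bsub>M\<^esub>b\<in>B. (c b \<oplus> d b) \<odot>\<^bsub>M\<^esub> b)"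
    by (rule M.finsum_cong')
      (use cd B I.Icarr in \<open>auto simp: smult_l_distr[symmetric] Pi_iff subset_iff intro!: smult_closed\<close>)
  finally show ?thesis
    unfolding lin_span_def using cd by (intro CollectI exI[of _ "\<lambda>b. c b \<oplus> d b"]) auto
qed

lemma smult_in_lin_span:
  assumes "a \<in> I" "y \<in> lin_span (carrier R) B" shows "a \<odot>\<^bsub>M\<^esub> y \<in> lin_span I B"
proof -
  interpret I: ideal I R by (rule I)
  obtain c where c: "c \<in> B \<rightarrow> carrier R" "y = (\<Oplus>\<^bsub>M\<^esub>b\<in>B. c b \<odot>\<^bsub>M\<^esub> b)"
    using assms(2) by (auto simp: lin_span_def)
  have "a \<odot>\<^bsub>M\<^esub> y = (\<Oplus>\<^bsub>M\<^esub>b\<in>B. a \<odot>\<^bsub>M\<^esub> (c b \<odot>\<^bsub>M\<^esub> b))"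
    unfolding c by (rule smult_finsum) (use c B assms(1) I.Icarr in \<open>auto intro!: smult_closed\<close>)
  also have "\<dots> = (\<Oplus>\<^bsub>M\<^esub>b\<in>B. (a \<otimes> c b) \<odot>\<^bsub>M\<^esub> b)"
    by (rule M.finsum_cong')
      (use c B assms(1) I.Icarr in \<open>auto simp: smult_assoc1 Pi_iff subset_iff intro!: smult_closed\<close>)
  finally show ?thesis
    unfolding lin_span_def using c assms(1) I.I_r_closed
    by (intro CollectI exI[of _ "\<lambda>b. a \<otimes> c b"]) auto
qed

end

lemma lin_span_of_zero:
  assumes "B \<subseteq> {\<zero>\<^bsub>M\<^esub>}" shows "lin_span (carrier R) B \<subseteq> {\<zero>\<^bsub>M\<^esub>}"
proof
  fix y assume "y \<in> lin_span (carrier R) B"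
  then obtain c where c: "c \<in> B \<rightarrow> carrier R" "y = (\<Oplus>\<^bsub>M\<^esub>b\<in>B. c b \<odot>\<^bsub>M\<^esub> b)"
    by (auto simp: lin_span_def)
  have "y = (\<Oplus>\<^bsub>M\<^esub>b\<in>B. \<zero>\<^bsub>M\<^esub>)"
    unfolding c(2) by (rule M.finsum_cong') (use c(1) assms smult_r_null in auto)
  then show "y \<in> {\<zero>\<^bsub>M\<^esub>}" by simp
qed

text \<open>
  An element \<open>a\<close> is quasi-regular here if \<open>\<one> - a\<close> has a left inverse \<open>b\<close>, that is, \<open>b = \<one> + ba\<close>.
  The relation for one generator then expresses it by the others, so the generators can be
  eliminated one at a time.
\<close>

lemma nakayama:
  assumes I: "ideal I R"
    and quasi: "\<And>a. a \<in> I \<Longrightarrow> \<exists>b\<in>carrier R. b = \<one> \<oplus> b \<otimes> a"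
    and B: "finite B" "B \<subseteq> carrier M" "B \<subseteq> lin_span I B"
  shows "B \<subseteq> {\<zero>\<^bsub>M\<^esub>}"
  using B
proof (induction B)
  case (insert x B)
  interpret I: ideal I R by (rule I)
  have x: "x \<in> carrier M" and B: "B \<subseteq> carrier M" using insert.prems(1) by auto
  note span_closed = lin_span_closed[OF I B, THEN subsetD]
  have split: "\<exists>a\<in>I. \<exists>z\<in>lin_span I B. y = a \<odot>\<^bsub>M\<^esub> x \<oplus>\<^bsub>M\<^esub> z" if y: "y \<in> lin_span I (insert x B)" for y
  proof -
    obtain c where c: "c \<in> insert x B \<rightarrow> I" "y = (\<Oplus>\<^bsub>M\<^esub>b\<in>insert x B. c b \<odot>\<^bsub>M\<^esub> b)"
      using y unfolding lin_span_def by blast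
    have "(\<lambda>b. c b \<odot>\<^bsub>M\<^esub> b) \<in> B \<rightarrow> carrier M" "c x \<odot>\<^bsub>M\<^esub> x \<in> carrier M"
      using coeff_closed[OF I insert.prems(1) c(1)] by auto
    then have "y = c x \<odot>\<^bsub>M\<^esub> x \<oplus>\<^bsub>M\<^esub> (\<Oplus>\<^bsub>M\<^esub>b\<in>B. c b \<odot>\<^bsub>M\<^esub> b)"
      unfolding c(2) using insert.hyps by simp
    moreover have "(\<Oplus>\<^bsub>M\<^esub>b\<in>B. c b \<odot>\<^bsub>M\<^esub> b) \<in> lin_span I B"
      using c(1) by (auto simp: lin_span_def)
    ultimately show ?thesis using c(1) by blast
  qed
  obtain a z where a: "a \<in> I" and z: "z \<in> lin_span I B" and xz: "x = a \<odot>\<^bsub>M\<^esub> x \<oplus>\<^bsub>M\<^esub> z"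
    using split insert.prems(2) by blast
  obtain b where b: "b \<in> carrier R" "b = \<one> \<oplus> b \<otimes> a" using quasi[OF a] by blast
  have ac: "a \<in> carrier R" using a I.Icarr by blast
  have zc: "z \<in> carrier M" using z by (rule span_closed)
  have bax: "(b \<otimes> a) \<odot>\<^bsub>M\<^esub> x \<in> carrier M" "b \<odot>\<^bsub>M\<^esub> z \<in> carrier M"
    using b(1) ac x zc by (auto intro: smult_closed)
  have "(b \<otimes> a) \<odot>\<^bsub>M\<^esub> x \<oplus>\<^bsub>M\<^esub> x = (\<one> \<oplus> b \<otimes> a) \<odot>\<^bsub>M\<^esub> x"
    using b(1) ac x bax by (simp add: smult_l_distr smult_one M.a_comm)
  also have "\<dots> = b \<odot>\<^bsub>M\<^esub> (a \<odot>\<^bsub>M\<^esub> x \<oplus>\<^bsub>M\<^esub> z)" using b(2) xz by simp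
  also have "\<dots> = (b \<otimes> a) \<odot>\<^bsub>M\<^esub> x \<oplus>\<^bsub>M\<^esub> b \<odot>\<^bsub>M\<^esub> z"
    using b(1) ac x zc by (simp add: smult_r_distr smult_assoc1 smult_closed)
  finally have x_eq: "x = b \<odot>\<^bsub>M\<^esub> z" using bax x by simp
  have sub: "lin_span I B \<subseteq> lin_span (carrier R) B"
    unfolding lin_span_def using I.a_subset by blast
  have bz: "x \<in> lin_span (carrier R) B"
    unfolding x_eq using smult_in_lin_span[OF oneideal B b(1)] z sub by blast
  have "B \<subseteq> lin_span I B"
  proof
    fix y assume "y \<in> B"
    then obtain c w where "c \<in> I" "w \<in> lin_span I B" "y = c \<odot>\<^bsub>M\<^esub> x \<oplus>\<^bsub>M\<^esub> w"
      using split[of y] insert.prems(2) by blast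
    then show "y \<in> lin_span I B"
      using add_in_lin_span[OF I B] smult_in_lin_span[OF I B _ bz] by blast
  qed
  then have B0: "B \<subseteq> {\<zero>\<^bsub>M\<^esub>}" using insert.IH B by blast
  have "lin_span (carrier R) B \<subseteq> {\<zero>\<^bsub>M\<^esub>}"
    using B0 by (rule lin_span_of_zero)
  with bz B0 show ?case by blast
qed simp

end

text \<open>
  A linearly independent subset of \<open>X\<close> of maximal size spans every element of \<open>X\<close>.
\<close>

lemma (in vectorspace) finite_subset_spanning:
  assumes fd: fin_dim and X: "X \<subseteq> carrier V"
  shows "\<exists>B. finite B \<and> B \<subseteq> X \<and> X \<subseteq> span B"
proof -
  let ?P = "\<lambda>B. B \<subseteq> X \<and> lin_indpt B"
  have "?P {}" by (auto simp: lin_dep_def)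
  moreover have "\<forall>B. ?P B \<longrightarrow> card B \<le> dim"
    using li_le_dim(2)[OF fd] X by blast
  ultimately have "\<exists>B. ?P B \<and> (\<forall>C. ?P C \<longrightarrow> card C \<le> card B)"
    by (intro ex_has_greatest_nat[of ?P "{}" card "Suc dim"]) (simp_all add: less_Suc_eq_le)
  then obtain B where B: "?P B" "\<And>C. ?P C \<Longrightarrow> card C \<le> card B" by metis
  have Bc: "B \<subseteq> carrier V" using B(1) X by blast
  have fin: "finite B" using li_le_dim(1)[OF fd Bc] B(1) by blast
  have "x \<in> span B" if x: "x \<in> X" for x
  proof (cases "x \<in> B")
    case True
    then show ?thesis using in_own_span[OF Bc] by blast
  next
    case False
    then have "lin_dep (B \<union> {x})"
      using B(1) B(2)[of "B \<union> {x}"] fin x by force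
    then show ?thesis
      using lin_dep_iff_in_span[OF Bc _ _ False] B(1) x X by blast
  qed
  with B(1) fin show ?thesis by blast
qed

section \<open>Arithmetic in the complete path algebra\<close>

lemma cpa_simps:
  "carrier (cpa Q) = {f. \<forall>x. x \<notin> qpaths Q \<longrightarrow> f x = 0}"
  "(f \<otimes>\<^bsub>cpa Q\<^esub> g) x = (\<Sum>(q, r)\<in>pfactors Q x. f q * g r)"
  "\<one>\<^bsub>cpa Q\<^esub> x = (if x \<in> qpaths Q \<and> parrows x = [] then 1 else 0)"
  "\<zero>\<^bsub>cpa Q\<^esub> x = 0"
  "(f \<oplus>\<^bsub>cpa Q\<^esub> g) x = f x + g x"
  by (simp_all add: cpa_def)

lemma cpa_mult_outside: "x \<notin> qpaths Q \<Longrightarrow> (f \<otimes>\<^bsub>cpa Q\<^esub> g) x = 0"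
  by (simp add: cpa_simps pfactors_empty)

lemma cpa_mult_closed: "f \<otimes>\<^bsub>cpa Q\<^esub> g \<in> carrier (cpa Q)"
  by (simp add: cpa_simps(1) cpa_mult_outside)

lemma qpaths_Cons:
  assumes "wf_digraph Q"
  shows "(u, a # p, w) \<in> qpaths Q \<longleftrightarrow> a \<in> arcs Q \<and> u = tail Q a \<and> (head Q a, p, w) \<in> qpaths Q"
proof -
  interpret wf_digraph Q by fact
  show ?thesis by (auto simp: qpaths_def awalk_Cons_iff)
qed

lemma qpaths_Nil: "(u, [], w) \<in> qpaths Q \<longleftrightarrow> u = w \<and> u \<in> verts Q"
  by (auto simp: qpaths_def pre_digraph.awalk_def pre_digraph.cas.simps)

lemma qpaths_snoc:
  assumes "wf_digraph Q"
  shows "(u, p @ [a], w) \<in> qpaths Q \<longleftrightarrow> a \<in> arcs Q \<and> w = head Q a \<and> (u, p, tail Q a) \<in> qpaths Q"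
proof -
  interpret wf_digraph Q by fact
  show ?thesis
    by (induction p arbitrary: u) (auto simp: qpaths_Cons[OF assms] qpaths_Nil)
qed

lemma cpa_mult_path_right:
  "(f \<otimes>\<^bsub>cpa Q\<^esub> path_elem r) x =
    (\<Sum>z\<in>pfactors Q x. if snd z = r then f (fst z) else 0)"
  unfolding cpa_simps(2) by (rule sum.cong) (auto simp: path_elem_def)

lemma cpa_mult_path_left:
  "(path_elem q \<otimes>\<^bsub>cpa Q\<^esub> f) x =
    (\<Sum>z\<in>pfactors Q x. if fst z = q then f (snd z) else 0)"
  unfolding cpa_simps(2) by (rule sum.cong) (auto simp: path_elem_def)

text \<open>
  A path has at most one factorization with a given left or right factor, so multiplying by a path
  shifts coefficients.
\<close>

lemma cpa_mult_arrow_right: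
  assumes wf: "wf_digraph Q" and x: "(u, p, w) \<in> qpaths Q"
  shows "(f \<otimes>\<^bsub>cpa Q\<^esub> arrow_elem Q a) (u, p, w) =
    (case p of [] \<Rightarrow> 0 | b # p' \<Rightarrow> if b = a then f (head Q a, p', w) else 0)"
proof (cases p)
  case Nil
  have "snd z \<noteq> (tail Q a, [a], head Q a)" if "z \<in> pfactors Q (u, p, w)" for z
    using that Nil by (auto simp: pfactors_def pcomp_def)
  then show ?thesis
    unfolding arrow_elem_def cpa_mult_path_right using Nil by (simp add: sum.neutral)
next
  case (Cons b p')
  let ?y = "((head Q a, p', w), (tail Q a, [a], head Q a))"
  have uniq: "snd z = (tail Q a, [a], head Q a) \<longleftrightarrow> z = ?y \<and> b = a"
    if "z \<in> pfactors Q (u, p, w)" for z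
    using that Cons by (auto simp: pfactors_def pcomp_def)
  have mem: "?y \<in> pfactors Q (u, p, w)" if "b = a"
    using x that Cons wf qpaths_Cons[OF wf]
    by (auto simp: pfactors_def pcomp_def qpaths_Nil wf_digraph.head_in_verts)
  have "(f \<otimes>\<^bsub>cpa Q\<^esub> arrow_elem Q a) (u, p, w) =
    (\<Sum>z\<in>pfactors Q (u, p, w). if z = ?y then (if b = a then f (head Q a, p', w) else 0) else 0)"
    unfolding arrow_elem_def cpa_mult_path_right by (rule sum.cong) (auto simp: uniq)
  then show ?thesis using mem Cons by (simp add: finite_pfactors)
qed

lemma cpa_mult_arrow_left_snoc:
  assumes wf: "wf_digraph Q" and x: "(u, p @ [b], w) \<in> qpaths Q"
  shows "(arrow_elem Q a \<otimes>\<^bsub>cpa Q\<^esub> f) (u, p @ [b], w) = (if b = a then f (u, p, tail Q a) else 0)"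
proof -
  let ?y = "((tail Q a, [a], head Q a), (u, p, tail Q a))"
  have uniq: "fst z = (tail Q a, [a], head Q a) \<longleftrightarrow> z = ?y \<and> b = a"
    if "z \<in> pfactors Q (u, p @ [b], w)" for z
    using that by (auto simp: pfactors_def pcomp_def)
  have mem: "?y \<in> pfactors Q (u, p @ [b], w)" if "b = a"
    using x that wf qpaths_snoc[OF wf] qpaths_Cons[OF wf]
    by (auto simp: pfactors_def pcomp_def qpaths_Nil wf_digraph.head_in_verts)
  have "(arrow_elem Q a \<otimes>\<^bsub>cpa Q\<^esub> f) (u, p @ [b], w) =
    (\<Sum>z\<in>pfactors Q (u, p @ [b], w). if z = ?y then (if b = a then f (u, p, tail Q a) else 0) else 0)"
    unfolding arrow_elem_def cpa_mult_path_left by (rule sum.cong) (auto simp: uniq)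
  then show ?thesis using mem by (simp add: finite_pfactors)
qed

lemma cpa_mult_arrow_left_Nil: "(arrow_elem Q a \<otimes>\<^bsub>cpa Q\<^esub> f) (u, [], w) = 0"
proof -
  have "fst z \<noteq> (tail Q a, [a], head Q a)" if "z \<in> pfactors Q (u, [], w)" for z
    using that by (auto simp: pfactors_def pcomp_def)
  then show ?thesis
    unfolding arrow_elem_def cpa_mult_path_left by (simp add: sum.neutral)
qed

lemma cpa_mult_idem_left:
  assumes wf: "wf_digraph Q" and x: "x \<in> qpaths Q"
  shows "(idem_elem j \<otimes>\<^bsub>cpa Q\<^esub> f) x = (if ptarget x = j then f x else 0)"
proof -
  let ?y = "((j, [], j), x)"
  have uniq: "fst z = (j, [], j) \<longleftrightarrow> z = ?y \<and> ptarget x = j" if "z \<in> pfactors Q x" for z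
    using that by (cases x) (auto simp: pfactors_def pcomp_def)
  have mem: "?y \<in> pfactors Q x" if "ptarget x = j"
    using x that qpaths_trivial[OF wf x] by (cases x) (auto simp: pfactors_def pcomp_def)
  have "(idem_elem j \<otimes>\<^bsub>cpa Q\<^esub> f) x =
    (\<Sum>z\<in>pfactors Q x. if z = ?y then (if ptarget x = j then f x else 0) else 0)"
    unfolding idem_elem_def cpa_mult_path_left by (rule sum.cong) (auto simp: uniq)
  then show ?thesis using mem by (simp add: finite_pfactors)
qed

lemma cpa_mult_trivial:
  assumes f: "f \<in> carrier (cpa Q)"
  shows "(f \<otimes>\<^bsub>cpa Q\<^esub> g) (v, [], v) = f (v, [], v) * g (v, [], v)"
proof (cases "v \<in> verts Q")
  case True
  then have "pfactors Q (v, [], v) = {((v, [], v), (v, [], v))}"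
    by (auto simp: pfactors_def pcomp_def qpaths_Nil)
  then show ?thesis by (simp add: cpa_simps)
next
  case False
  then show ?thesis using f by (simp add: cpa_mult_outside qpaths_Nil cpa_simps(1))
qed

text \<open>
  For a finite quiver this is the arrow ideal and the Jacobson radical.  Defining it by coefficients
  gives the description that the geometric series needs.
\<close>

definition cpa_radical :: "('v, 'a) pre_digraph \<Rightarrow> (('v, 'a) qpath \<Rightarrow> complex) set" where
  "cpa_radical Q = {f \<in> carrier (cpa Q). \<forall>v. f (v, [], v) = 0}"

lemma cpa_uminus:
  assumes "wf_digraph Q" "f \<in> carrier (cpa Q)"
  shows "\<ominus>\<^bsub>cpa Q\<^esub> f = (\<lambda>x. - f x)"
proof -
  interpret ring "cpa Q" by (rule ring_cpa[OF assms(1)])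
  show ?thesis
    by (rule minus_equality) (use assms(2) in \<open>auto simp: cpa_simps fun_eq_iff\<close>)
qed

lemma ideal_cpa_radical:
  assumes "wf_digraph Q" shows "ideal (cpa_radical Q) (cpa Q)"
proof -
  interpret ring "cpa Q" by (rule ring_cpa[OF assms])
  show ?thesis
  proof (rule idealI[OF ring_axioms])
    have "\<ominus>\<^bsub>cpa Q\<^esub> f \<in> cpa_radical Q" if "f \<in> cpa_radical Q" for f
      using that cpa_uminus[OF assms, of f] by (simp add: cpa_radical_def cpa_simps(1))
    moreover have "\<zero>\<^bsub>cpa Q\<^esub> \<in> cpa_radical Q"
      by (simp add: cpa_radical_def cpa_simps)
    ultimately show "subgroup (cpa_radical Q) (add_monoid (cpa Q))"
      by (intro add.subgroupI) (auto simp: a_inv_def[symmetric] cpa_radical_def cpa_simps(1,5))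
  qed (auto simp: cpa_radical_def cpa_mult_trivial)
qed

text \<open>
  The geometric series \<open>\<Sum>\<^sub>k a\<^sup>k\<close> is defined coefficientwise: powers beyond the length of a path do
  not contribute to its coefficient.
\<close>

lemma cpa_radical_pow:
  assumes wf: "wf_digraph Q" and a: "a \<in> cpa_radical Q"
  shows "length (parrows x) < k \<Longrightarrow> (a [^]\<^bsub>cpa Q\<^esub> k) x = 0"
proof (induction k arbitrary: x)
  case (Suc k)
  interpret ring "cpa Q" by (rule ring_cpa[OF wf])
  have "(a [^]\<^bsub>cpa Q\<^esub> k) q * a r = 0" if "(q, r) \<in> pfactors Q x" for q r
  proof (cases "parrows r = []")
    case True
    then have "a r = 0"
      using that a by (cases r) (auto simp: pfactors_def cpa_radical_def qpaths_Nil)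
    then show ?thesis by simp
  next
    case False
    then have "length (parrows q) < length (parrows x)"
      using that by (auto simp: pfactors_def pcomp_def)
    then show ?thesis using Suc by simp
  qed
  then show ?case by (auto simp: cpa_simps(2) intro: sum.neutral)
qed simp

lemma cpa_radical_quasi_regular:
  fixes Q :: "('v, 'a) pre_digraph"
  assumes wf: "wf_digraph Q" and a: "a \<in> cpa_radical Q"
  shows "\<exists>b\<in>carrier (cpa Q). b = \<one>\<^bsub>cpa Q\<^esub> \<oplus>\<^bsub>cpa Q\<^esub> b \<otimes>\<^bsub>cpa Q\<^esub> a"
proof
  interpret ring "cpa Q" by (rule ring_cpa[OF wf])
  have ac: "a \<in> carrier (cpa Q)" using a by (simp add: cpa_radical_def)
  define pw where "pw k = a [^]\<^bsub>cpa Q\<^esub> (k::nat)" for k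
  have pw: "pw k x = 0" if "length (parrows x) < k" for k and x :: "('v, 'a) qpath"
    unfolding pw_def by (rule cpa_radical_pow[OF wf a that])
  define b where "b x = (\<Sum>k\<le>length (parrows x). pw k x)" for x :: "('v, 'a) qpath"
  have b: "b x = (\<Sum>k\<le>n. pw k x)" if "length (parrows x) \<le> n" for n and x :: "('v, 'a) qpath"
    unfolding b_def by (rule sum.mono_neutral_left) (use that pw in auto)
  show "b \<in> carrier (cpa Q)"
    using nat_pow_closed[OF ac] by (simp add: b_def pw_def cpa_simps(1))
  show "b = \<one>\<^bsub>cpa Q\<^esub> \<oplus>\<^bsub>cpa Q\<^esub> b \<otimes>\<^bsub>cpa Q\<^esub> a"
  proof
    fix x :: "('v, 'a) qpath"
    let ?n = "length (parrows x)"
    have "(b \<otimes>\<^bsub>cpa Q\<^esub> a) x = (\<Sum>z\<in>pfactors Q x. (\<Sum>k\<le>?n. pw k (fst z)) * a (snd z))"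
      unfolding cpa_simps(2) by (rule sum.cong) (auto simp: pfactors_def pcomp_def intro!: b)
    also have "\<dots> = (\<Sum>k\<le>?n. \<Sum>z\<in>pfactors Q x. pw k (fst z) * a (snd z))"
      by (subst sum.swap) (simp add: sum_distrib_right)
    also have "\<dots> = (\<Sum>k\<le>?n. pw (Suc k) x)"
      by (simp add: pw_def cpa_simps(2) case_prod_beta)
    also have "\<one>\<^bsub>cpa Q\<^esub> x + \<dots> = (\<Sum>k\<le>Suc ?n. pw k x)"
      unfolding sum.atMost_Suc_shift by (simp add: pw_def)
    also have "\<dots> = b x" by (rule b[symmetric]) simp
    finally show "b x = (\<one>\<^bsub>cpa Q\<^esub> \<oplus>\<^bsub>cpa Q\<^esub> b \<otimes>\<^bsub>cpa Q\<^esub> a) x"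
      by (simp add: cpa_simps(5))
  qed
qed

lemma cpa_sum_closed:
  assumes "\<And>i. i \<in> A \<Longrightarrow> g i \<in> carrier (cpa Q)"
  shows "(\<lambda>x. \<Sum>i\<in>A. g i x) \<in> carrier (cpa Q)"
  using assms by (auto simp: cpa_simps(1) intro: sum.neutral)

section \<open>The restriction homomorphism forgets coefficients\<close>

lemma arrow_restrict_simps [simp]:
  "verts (arrow_restrict Q V) = verts Q" "tail (arrow_restrict Q V) = tail Q"
  "head (arrow_restrict Q V) = head Q"
  "arcs (arrow_restrict Q V) = {a \<in> arcs Q. tail Q a \<in> V \<and> head Q a \<in> V}"
  by (simp_all add: arrow_restrict_def)

text \<open>
  Sorting the paths of positive length by their first arrow writes a series without constant terms
  as \<open>\<Sum>\<^sub>a f\<^sub>a a\<close>; this is \<open>f\<^sub>a\<close>.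
\<close>

definition right_quotient ::
  "('v, 'a) pre_digraph \<Rightarrow> 'a \<Rightarrow> (('v, 'a) qpath \<Rightarrow> complex) \<Rightarrow> ('v, 'a) qpath \<Rightarrow> complex" where
  "right_quotient Q a f = (\<lambda>(u, p, w).
    if u = head Q a \<and> (u, p, w) \<in> qpaths Q then f (tail Q a, a # p, w) else 0)"

lemma right_quotient_closed: "right_quotient Q a f \<in> carrier (cpa Q)"
  by (auto simp: cpa_simps(1) right_quotient_def)

lemma cpa_right_decomposition:
  fixes Q :: "('v, 'a) pre_digraph"
  assumes "fin_digraph Q" and f: "f \<in> carrier (cpa Q)"
  shows "f = (\<lambda>x. \<Sum>v\<in>verts Q. f (v, [], v) * idem_elem v x) \<oplus>\<^bsub>cpa Q\<^esub>
    (\<lambda>x. \<Sum>a\<in>arcs Q. (right_quotient Q a f \<otimes>\<^bsub>cpa Q\<^esub> arrow_elem Q a) x)"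
proof
  fix x :: "('v, 'a) qpath"
  interpret fin_digraph Q by fact
  have wf: "wf_digraph Q" by unfold_locales
  obtain u p w where x: "x = (u, p, w)" by (cases x)
  let ?l = "\<Sum>v\<in>verts Q. f (v, [], v) * idem_elem v x"
  let ?r = "\<Sum>a\<in>arcs Q. (right_quotient Q a f \<otimes>\<^bsub>cpa Q\<^esub> arrow_elem Q a) x"
  have "f x = ?l + ?r"
  proof (cases "x \<in> qpaths Q")
    case False
    then have "?l = 0"
      by (intro sum.neutral) (auto simp: idem_elem_def path_elem_def qpaths_Nil)
    moreover have "?r = 0" using False by (simp add: cpa_mult_outside)
    ultimately show ?thesis using f False x by (simp add: cpa_simps(1))
  next
    case True
    show ?thesis
    proof (cases p)
      case Nil
      then have u: "w = u" "u \<in> verts Q" using True x by (auto simp: qpaths_Nil)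
      have "?r = 0" using True x Nil by (simp add: cpa_mult_arrow_right[OF wf])
      moreover have "?l = (\<Sum>v\<in>verts Q. if v = u then f x else 0)"
        by (rule sum.cong) (auto simp: idem_elem_def path_elem_def x Nil u)
      ultimately show ?thesis using u by (simp add: finite_verts)
    next
      case (Cons b p')
      then have b: "b \<in> arcs Q" "u = tail Q b" "(head Q b, p', w) \<in> qpaths Q"
        using True x qpaths_Cons[OF wf] by auto
      have "?l = 0" using x Cons by (intro sum.neutral) (auto simp: idem_elem_def path_elem_def)
      moreover have "?r = (\<Sum>a\<in>arcs Q. if a = b then f x else 0)"
        using True x Cons b
        by (intro sum.cong) (auto simp: cpa_mult_arrow_right[OF wf] right_quotient_def)
      ultimately show ?thesis using b by (simp add: finite_arcs)
    qed
  qed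
  then show "f x = ((\<lambda>x. \<Sum>v\<in>verts Q. f (v, [], v) * idem_elem v x) \<oplus>\<^bsub>cpa Q\<^esub>
    (\<lambda>x. \<Sum>a\<in>arcs Q. (right_quotient Q a f \<otimes>\<^bsub>cpa Q\<^esub> arrow_elem Q a) x)) x"
    by (simp add: cpa_simps(5))
qed

lemma cpa_hom_sum:
  assumes "wf_digraph Q'" "wf_digraph Q" "\<rho> \<in> Ring.ring_hom (cpa Q') (cpa Q)"
    and "finite A" "\<And>i. i \<in> A \<Longrightarrow> g i \<in> carrier (cpa Q')"
  shows "\<rho> (\<lambda>x. \<Sum>i\<in>A. g i x) = (\<lambda>x. \<Sum>i\<in>A. \<rho> (g i) x)"
  using assms(4,5)
proof (induction A)
  case empty
  have "\<rho> \<zero>\<^bsub>cpa Q'\<^esub> = \<zero>\<^bsub>cpa Q\<^esub>"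
    by (rule ring_hom_zero[OF assms(3) ring_cpa[OF assms(1)] ring_cpa[OF assms(2)]])
  then show ?case by (simp add: cpa_def)
next
  case (insert i A)
  have "\<rho> (g i \<oplus>\<^bsub>cpa Q'\<^esub> (\<lambda>x. \<Sum>i\<in>A. g i x)) = \<rho> (g i) \<oplus>\<^bsub>cpa Q\<^esub> \<rho> (\<lambda>x. \<Sum>i\<in>A. g i x)"
    using insert by (intro ring_hom_add[OF assms(3)] cpa_sum_closed) auto
  with insert show ?case by (simp add: cpa_def)
qed

text \<open>
  Splitting off the first arrow reduces the coefficient of a path in \<open>\<rho> f\<close> to that of a shorter
  path, so \<open>\<rho>\<close> is determined by its values on idempotents and arrows.
\<close>

theorem restriction_hom_apply:
  fixes Qt :: "('v, 'a) pre_digraph"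
  assumes fin: "fin_digraph Qt" and \<rho>: "is_restriction_hom Qt (arrow_restrict Qt V) \<rho>"
    and f: "f \<in> carrier (cpa Qt)"
  shows "\<rho> f = (\<lambda>x. if x \<in> qpaths (arrow_restrict Qt V) then f x else 0)"
proof
  let ?Q = "arrow_restrict Qt V"
  interpret fin_digraph Qt by fact
  have wft: "wf_digraph Qt" by unfold_locales
  note wf = wf_arrow_restrict[OF wft, of V]
  have hom: "\<rho> \<in> Ring.ring_hom (cpa Qt) (cpa ?Q)"
    and lin: "\<And>c f. f \<in> carrier (cpa Qt) \<Longrightarrow> \<rho> (\<lambda>x. c * f x) = (\<lambda>x. c * \<rho> f x)"
    and idem: "\<And>i. i \<in> verts Qt \<Longrightarrow> \<rho> (idem_elem i) = idem_elem i"
    and arr: "\<And>a. a \<in> arcs ?Q \<Longrightarrow> \<rho> (arrow_elem Qt a) = arrow_elem ?Q a"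
    and arr0: "\<And>a. a \<in> arcs Qt - arcs ?Q \<Longrightarrow> \<rho> (arrow_elem Qt a) = \<zero>\<^bsub>cpa ?Q\<^esub>"
    using \<rho> unfolding is_restriction_hom_def by blast+
  have idem_carrier: "idem_elem v \<in> carrier (cpa Qt)" if "v \<in> verts Qt" for v
    using that by (auto simp: cpa_simps(1) idem_elem_def path_elem_def qpaths_Nil)
  have formula: "\<rho> f x = (\<Sum>v\<in>verts Qt. f (v, [], v) * idem_elem v x) +
      (\<Sum>a\<in>arcs Qt. (\<rho> (right_quotient Qt a f) \<otimes>\<^bsub>cpa ?Q\<^esub> \<rho> (arrow_elem Qt a)) x)"
    if f: "f \<in> carrier (cpa Qt)" for f and x :: "('v, 'a) qpath"
  proof -
    let ?l = "\<lambda>x. \<Sum>v\<in>verts Qt. f (v, [], v) * idem_elem v x"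
    let ?r = "\<lambda>x. \<Sum>a\<in>arcs Qt. (right_quotient Qt a f \<otimes>\<^bsub>cpa Qt\<^esub> arrow_elem Qt a) x"
    have lc: "(\<lambda>x. f (v, [], v) * idem_elem v x) \<in> carrier (cpa Qt)" if "v \<in> verts Qt" for v
      using idem_carrier[OF that] by (simp add: cpa_simps(1))
    have "\<rho> f = \<rho> (?l \<oplus>\<^bsub>cpa Qt\<^esub> ?r)"
      using cpa_right_decomposition[OF fin f] by simp
    also have "\<dots> = \<rho> ?l \<oplus>\<^bsub>cpa ?Q\<^esub> \<rho> ?r"
      by (intro ring_hom_add[OF hom] cpa_sum_closed lc cpa_mult_closed)
    also have "\<rho> ?l = ?l"
      using lc idem_carrier
      by (subst cpa_hom_sum[OF wft wf hom]) (auto simp: finite_verts lin idem intro!: sum.cong)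
    also have "\<rho> ?r =
      (\<lambda>x. \<Sum>a\<in>arcs Qt. (\<rho> (right_quotient Qt a f) \<otimes>\<^bsub>cpa ?Q\<^esub> \<rho> (arrow_elem Qt a)) x)"
      by (subst cpa_hom_sum[OF wft wf hom])
        (auto simp: finite_arcs cpa_mult_closed ring_hom_mult[OF hom] right_quotient_closed
          arrow_elem_carrier[OF wft])
    finally show ?thesis by (simp add: cpa_simps(5))
  qed
  have zero: "(g \<otimes>\<^bsub>cpa ?Q\<^esub> \<zero>\<^bsub>cpa ?Q\<^esub>) x = 0" for g and x :: "('v, 'a) qpath"
    by (simp add: cpa_simps case_prod_beta)
  have inside: "\<rho> f (u, p, w) = f (u, p, w)"
    if "f \<in> carrier (cpa Qt)" "(u, p, w) \<in> qpaths ?Q" for u p w f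
    using that
  proof (induction p arbitrary: u f)
    case Nil
    then have u: "w = u" "u \<in> verts Qt" by (auto simp: qpaths_Nil)
    have "(\<rho> (right_quotient Qt a f) \<otimes>\<^bsub>cpa ?Q\<^esub> \<rho> (arrow_elem Qt a)) (u, [], w) = 0"
      if "a \<in> arcs Qt" for a
      using that Nil arr[of a] arr0[of a] zero cpa_mult_arrow_right[OF wf Nil.prems(2), of _ a]
      by (cases "a \<in> arcs ?Q") auto
    moreover have "(\<Sum>v\<in>verts Qt. f (v, [], v) * idem_elem v (u, [], w)) =
        (\<Sum>v\<in>verts Qt. if v = u then f (u, [], w) else 0)"
      by (rule sum.cong) (auto simp: idem_elem_def path_elem_def u)
    ultimately show ?case using formula[OF Nil.prems(1)] u by (simp add: finite_verts)
  next
    case (Cons b p)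
    then have b: "b \<in> arcs ?Q" "u = tail Qt b" "(head Qt b, p, w) \<in> qpaths ?Q"
      using qpaths_Cons[OF wf] by auto
    have "(\<rho> (right_quotient Qt a f) \<otimes>\<^bsub>cpa ?Q\<^esub> \<rho> (arrow_elem Qt a)) (u, b # p, w) =
        (if a = b then f (u, b # p, w) else 0)" if "a \<in> arcs Qt" for a
    proof (cases "a \<in> arcs ?Q")
      case True
      have "\<rho> (right_quotient Qt b f) (head Qt b, p, w) = f (u, b # p, w)"
        using Cons.IH[OF right_quotient_closed b(3)] b qpaths_arrow_restrict[of Qt V]
        by (auto simp: right_quotient_def)
      then show ?thesis
        using arr[OF True] cpa_mult_arrow_right[OF wf Cons.prems(2), of _ a] by auto
    next
      case False
      then show ?thesis using arr0[of a] that b zero by auto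
    qed
    moreover have "(\<Sum>v\<in>verts Qt. f (v, [], v) * idem_elem v (u, b # p, w)) = 0"
      by (rule sum.neutral) (auto simp: idem_elem_def path_elem_def)
    ultimately show ?case
      using formula[OF Cons.prems(1)] b by (simp add: finite_arcs)
  qed
  fix x :: "('v, 'a) qpath"
  show "\<rho> f x = (if x \<in> qpaths ?Q then f x else 0)"
    using inside[OF f] ring_hom_closed[OF hom f] by (cases x) (auto simp: cpa_simps(1))
qed

section \<open>Series supported on the paths that leave a set of vertices\<close>

text \<open>
  A path of the restricted quiver that starts in \<open>V\<close> stays in \<open>V\<close>; the condition on the source
  excludes only the trivial paths outside \<open>V\<close>.  So this is the kernel of the restriction homomorphism
  enlarged by the idempotents of the vertices outside \<open>V\<close>.  They are included because they remain when
  the last arrow of a path is removed that has just left them.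
\<close>

definition outer_series ::
  "('v, 'a) pre_digraph \<Rightarrow> 'v set \<Rightarrow> (('v, 'a) qpath \<Rightarrow> complex) set" where
  "outer_series Q V =
    {f \<in> carrier (cpa Q). \<forall>x\<in>qpaths (arrow_restrict Q V). psource x \<in> V \<longrightarrow> f x = 0}"

text \<open>
  Sorting the paths of positive length by their last arrow writes a series without constant terms
  as \<open>\<Sum>\<^sub>a a f\<^sub>a\<close>; this is \<open>f\<^sub>a\<close>.
\<close>

definition left_quotient ::
  "('v, 'a) pre_digraph \<Rightarrow> 'a \<Rightarrow> (('v, 'a) qpath \<Rightarrow> complex) \<Rightarrow> ('v, 'a) qpath \<Rightarrow> complex" where
  "left_quotient Q a f = (\<lambda>(u, p, w).
    if w = tail Q a \<and> (u, p, w) \<in> qpaths Q then f (u, p @ [a], head Q a) else 0)"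

lemma outer_series_mult:
  assumes "f \<in> outer_series Q V"
  shows "g \<otimes>\<^bsub>cpa Q\<^esub> f \<in> outer_series Q V"
proof -
  have "(g \<otimes>\<^bsub>cpa Q\<^esub> f) x = 0" if x: "x \<in> qpaths (arrow_restrict Q V)" "psource x \<in> V" for x
  proof -
    have "f r = 0" if "(q, r) \<in> pfactors (arrow_restrict Q V) x" for q r
      using that assms x(2) by (auto simp: outer_series_def pfactors_def pcomp_def)
    then show ?thesis
      unfolding cpa_simps(2) cpa_arrow_restrict_pfactors[OF x(1), symmetric]
      by (intro sum.neutral) auto
  qed
  then show ?thesis by (simp add: outer_series_def cpa_mult_closed)
qed

lemma qpaths_arrow_restrict_target:
  assumes "wf_digraph Q" "(u, p, w) \<in> qpaths (arrow_restrict Q V)" "u \<in> V"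
  shows "w \<in> V"
  using assms(2,3)
  by (induction p arbitrary: u)
    (auto simp: qpaths_Nil qpaths_Cons[OF wf_arrow_restrict[OF assms(1)]])

lemma left_quotient_outer:
  assumes wf: "wf_digraph Q" and f: "f \<in> outer_series Q V" and a: "a \<in> arcs Q" "head Q a \<in> V"
  shows "left_quotient Q a f \<in> outer_series Q V"
proof -
  have "left_quotient Q a f (u, p, w) = 0"
    if x: "(u, p, w) \<in> qpaths (arrow_restrict Q V)" "u \<in> V" for u p w
  proof (cases "w = tail Q a")
    case True
    then have "a \<in> arcs (arrow_restrict Q V)"
      using qpaths_arrow_restrict_target[OF wf x] a by simp
    then have "(u, p @ [a], head Q a) \<in> qpaths (arrow_restrict Q V)"
      using qpaths_snoc[OF wf_arrow_restrict[OF wf]] x True by auto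
    then show ?thesis using f x(2) by (force simp: outer_series_def left_quotient_def)
  qed (simp add: left_quotient_def)
  then show ?thesis by (auto simp: outer_series_def left_quotient_def cpa_simps(1))
qed

text \<open>
  A path that is not contained in \<open>V\<close> either ends outside \<open>V\<close>, or ends with an arrow into \<open>V\<close> whose removal
  still leaves a path that visits the complement of \<open>V\<close>.
\<close>

lemma outer_series_decomposition:
  fixes Q :: "('v, 'a) pre_digraph"
  assumes "fin_digraph Q" and f: "f \<in> outer_series Q V"
  shows "f = (\<lambda>x. \<Sum>j\<in>verts Q - V. (idem_elem j \<otimes>\<^bsub>cpa Q\<^esub> f) x) \<oplus>\<^bsub>cpa Q\<^esub>
    (\<lambda>x. \<Sum>a\<in>{a \<in> arcs Q. head Q a \<in> V}. (arrow_elem Q a \<otimes>\<^bsub>cpa Q\<^esub> left_quotient Q a f) x)"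
    (is "f = ?l \<oplus>\<^bsub>cpa Q\<^esub> ?r")
proof
  fix x :: "('v, 'a) qpath"
  interpret fin_digraph Q by fact
  have wf: "wf_digraph Q" by unfold_locales
  obtain u p w where x: "x = (u, p, w)" by (cases x)
  have "f x = ?l x + ?r x"
  proof (cases "x \<in> qpaths Q")
    case False
    moreover from this have "f x = 0" using f x by (simp add: outer_series_def cpa_simps(1))
    ultimately show ?thesis by (simp add: cpa_mult_outside)
  next
    case True
    have w: "w \<in> verts Q" using qpaths_trivial[OF wf True] x by (simp add: qpaths_Nil)
    have "?l x = (\<Sum>j\<in>verts Q - V. if j = w then f x else 0)"
      by (rule sum.cong) (simp_all add: cpa_mult_idem_left[OF wf True] x[symmetric], simp add: x)
    then have l: "?l x = (if w \<in> V then 0 else f x)"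
      using w by (simp add: finite_verts)
    show ?thesis
    proof (cases p rule: rev_cases)
      case Nil
      have "f x = 0" if "w \<in> V"
        using f True that x Nil by (auto simp: outer_series_def qpaths_Nil)
      moreover have "?r x = 0" by (simp add: x Nil cpa_mult_arrow_left_Nil)
      ultimately show ?thesis using l by simp
    next
      case (snoc p' b)
      then have b: "b \<in> arcs Q" "w = head Q b" "(u, p', tail Q b) \<in> qpaths Q"
        using True x qpaths_snoc[OF wf] by auto
      have "?r x = (\<Sum>a\<in>{a \<in> arcs Q. head Q a \<in> V}. if a = b then f x else 0)"
        using True b by (intro sum.cong) (auto simp: x snoc cpa_mult_arrow_left_snoc[OF wf] left_quotient_def)
      then show ?thesis using l b by (simp add: finite_arcs)
    qed
  qed
  then show "f x = (?l \<oplus>\<^bsub>cpa Q\<^esub> ?r) x" by (simp add: cpa_simps(5))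
qed

lemma idem_elem_carrier: "v \<in> verts Q \<Longrightarrow> idem_elem v \<in> carrier (cpa Q)"
  by (auto simp: cpa_simps(1) idem_elem_def path_elem_def qpaths_Nil)

lemma arrow_elem_radical:
  assumes "wf_digraph Q" "a \<in> arcs Q" shows "arrow_elem Q a \<in> cpa_radical Q"
  using arrow_elem_carrier[OF assms] by (simp add: cpa_radical_def arrow_elem_def path_elem_def)

text \<open>
  The image of \<open>\<Psi>\<close> equals its product with the radical: the summands \<open>e\<^sub>j f\<close> of an element of
  \<open>outer_series Q V\<close> contribute nothing, and the summands \<open>a f\<^sub>a\<close> contribute multiples by arrows of
  elements of the image.  Nakayama's lemma applies to a finite set that spans the image.
\<close>

theorem outer_series_hom_zero:
  fixes Q :: "('v, 'a) pre_digraph" and M :: "(('v, 'a) qpath \<Rightarrow> complex, 'm) module"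
  assumes fin: "fin_digraph Q" and M: "left_module (cpa Q) M"
    and gen: "\<And>X. X \<subseteq> carrier M \<Longrightarrow>
      \<exists>B. finite B \<and> B \<subseteq> X \<and> X \<subseteq> left_module.lin_span M (carrier (cpa Q)) B"
    and supp: "\<And>j m. \<lbrakk>j \<in> verts Q - V; m \<in> carrier M\<rbrakk> \<Longrightarrow> idem_elem j \<odot>\<^bsub>M\<^esub> m = \<zero>\<^bsub>M\<^esub>"
    and closed: "\<And>f. f \<in> outer_series Q V \<Longrightarrow> \<Psi> f \<in> carrier M"
    and add: "\<And>f g. \<lbrakk>f \<in> outer_series Q V; g \<in> outer_series Q V\<rbrakk> \<Longrightarrow>
      \<Psi> (f \<oplus>\<^bsub>cpa Q\<^esub> g) = \<Psi> f \<oplus>\<^bsub>M\<^esub> \<Psi> g"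
    and smult: "\<And>g f. \<lbrakk>g \<in> carrier (cpa Q); f \<in> outer_series Q V\<rbrakk> \<Longrightarrow>
      \<Psi> (g \<otimes>\<^bsub>cpa Q\<^esub> f) = g \<odot>\<^bsub>M\<^esub> \<Psi> f"
    and f: "f \<in> outer_series Q V"
  shows "\<Psi> f = \<zero>\<^bsub>M\<^esub>"
proof -
  interpret fin_digraph Q by fact
  have wf: "wf_digraph Q" by unfold_locales
  interpret left_module "cpa Q" M by fact
  let ?D = "outer_series Q V"
  let ?X = "\<Psi> ` ?D"
  have Xc: "?X \<subseteq> carrier M" using closed by blast
  obtain B where B: "finite B" "B \<subseteq> ?X" "?X \<subseteq> lin_span (carrier (cpa Q)) B"
    using gen[OF Xc] by blast
  have Bc: "B \<subseteq> carrier M" using B Xc by blast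
  note I = ideal_cpa_radical[OF wf]
  \<comment> \<open>The radical times the image; the decomposition shows that the image is contained in it.\<close>
  let ?S = "lin_span (cpa_radical Q) B"
  have zero: "\<zero>\<^bsub>cpa Q\<^esub> \<in> ?D" by (simp add: outer_series_def cpa_simps(4))
  have \<Psi>0: "\<Psi> \<zero>\<^bsub>cpa Q\<^esub> = \<zero>\<^bsub>M\<^esub>"
    using smult[OF R.zero_closed zero] smult_l_null[OF closed[OF zero]] by simp
  have sum: "(\<lambda>x. \<Sum>i\<in>A. g i x) \<in> ?D \<and> \<Psi> (\<lambda>x. \<Sum>i\<in>A. g i x) \<in> ?S"
    if "finite A" "\<And>i. i \<in> A \<Longrightarrow> g i \<in> ?D \<and> \<Psi> (g i) \<in> ?S"
    for A :: "'i set" and g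
    using that
  proof (induction A)
    case empty
    have "(\<lambda>x. \<Sum>i\<in>{}. g i x) = \<zero>\<^bsub>cpa Q\<^esub>" by (simp add: cpa_def)
    then show ?case using zero \<Psi>0 zero_in_lin_span[OF I Bc] by simp
  next
    case (insert i A)
    have eq: "(\<lambda>x. \<Sum>i\<in>insert i A. g i x) = g i \<oplus>\<^bsub>cpa Q\<^esub> (\<lambda>x. \<Sum>i\<in>A. g i x)"
      using insert.hyps by (simp add: cpa_def)
    have "g i \<oplus>\<^bsub>cpa Q\<^esub> (\<lambda>x. \<Sum>i\<in>A. g i x) \<in> ?D"
      using insert by (auto simp: outer_series_def cpa_simps)
    then show ?case
      unfolding eq using insert add add_in_lin_span[OF I Bc] by simp
  qed
  have "\<Psi> f \<in> ?S" if f: "f \<in> ?D" for f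
  proof -
    have l: "idem_elem j \<otimes>\<^bsub>cpa Q\<^esub> f \<in> ?D \<and> \<Psi> (idem_elem j \<otimes>\<^bsub>cpa Q\<^esub> f) \<in> ?S"
      if "j \<in> verts Q - V" for j
      using outer_series_mult[OF f] smult[OF idem_elem_carrier f] supp[OF that closed[OF f]] that
        zero_in_lin_span[OF I Bc] by simp
    have r: "arrow_elem Q a \<otimes>\<^bsub>cpa Q\<^esub> left_quotient Q a f \<in> ?D \<and>
        \<Psi> (arrow_elem Q a \<otimes>\<^bsub>cpa Q\<^esub> left_quotient Q a f) \<in> ?S"
      if "a \<in> {a \<in> arcs Q. head Q a \<in> V}" for a
    proof -
      have q: "left_quotient Q a f \<in> ?D" using left_quotient_outer[OF wf f] that by simp
      then have "\<Psi> (left_quotient Q a f) \<in> lin_span (carrier (cpa Q)) B" using B(3) by blast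
      then have "arrow_elem Q a \<odot>\<^bsub>M\<^esub> \<Psi> (left_quotient Q a f) \<in> ?S"
        using smult_in_lin_span[OF I Bc] arrow_elem_radical[OF wf] that by simp
      then show ?thesis
        using outer_series_mult[OF q] smult[OF arrow_elem_carrier[OF wf] q] that by simp
    qed
    have "\<Psi> (g \<oplus>\<^bsub>cpa Q\<^esub> h) \<in> ?S" if "g \<in> ?D \<and> \<Psi> g \<in> ?S" "h \<in> ?D \<and> \<Psi> h \<in> ?S" for g h
      using that add add_in_lin_span[OF I Bc] by simp
    from this[OF sum[OF _ l, of "verts Q - V" "\<lambda>j. j"]
        sum[OF _ r, of "{a \<in> arcs Q. head Q a \<in> V}" "\<lambda>a. a"]]
    show ?thesis
      unfolding outer_series_decomposition[OF fin f, symmetric] by (simp add: finite_verts finite_arcs)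
  qed
  then have XS: "?X \<subseteq> ?S" by blast
  have "B \<subseteq> {\<zero>\<^bsub>M\<^esub>}"
    using nakayama[OF I cpa_radical_quasi_regular[OF wf] B(1) Bc] B(2) XS by blast
  then show ?thesis using lin_span_of_zero B(3) f by blast
qed

section \<open>Quotient algebras and their simple modules\<close>

lemma carrier_Quot: "carrier (R Quot I) = (\<lambda>r. I +>\<^bsub>R\<^esub> r) ` carrier R"
  unfolding FactRing_def A_RCOSETS_def' by auto

lemma (in complex_algebra) complex_algebra_quotient:
  assumes "ideal I R"
  shows "complex_algebra (R Quot I) (\<lambda>c. I +> \<eta> c)"
proof -
  interpret I: ideal I R by fact
  have hom: "(+>) I \<in> Ring.ring_hom R (R Quot I)" by (rule I.rcos_ring_hom)
  show ?thesis
  proof (intro complex_algebra.intro complex_algebra_axioms.intro I.quotient_is_ring)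
    fix r c assume "r \<in> carrier (R Quot I)"
    then obtain s where s: "s \<in> carrier R" "r = I +> s"
      unfolding carrier_Quot by blast
    show "(I +> \<eta> c) \<otimes>\<^bsub>R Quot I\<^esub> r = r \<otimes>\<^bsub>R Quot I\<^esub> (I +> \<eta> c)"
      unfolding s(2) ring_hom_mult[OF hom scalar_closed s(1), symmetric]
        ring_hom_mult[OF hom s(1) scalar_closed, symmetric] scalar_central[OF s(1)] ..
  next
    fix c d
    show "I +> \<eta> c \<in> carrier (R Quot I)" by (rule ring_hom_closed[OF hom scalar_closed])
    show "I +> \<eta> (c + d) = (I +> \<eta> c) \<oplus>\<^bsub>R Quot I\<^esub> (I +> \<eta> d)"
      unfolding scalar_add by (rule ring_hom_add[OF hom scalar_closed scalar_closed])
    show "I +> \<eta> (c * d) = (I +> \<eta> c) \<otimes>\<^bsub>R Quot I\<^esub> (I +> \<eta> d)"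
      unfolding scalar_mult by (rule ring_hom_mult[OF hom scalar_closed scalar_closed])
  next
    show "I +> \<eta> 1 = \<one>\<^bsub>R Quot I\<^esub>"
      unfolding scalar_one by (rule ring_hom_one[OF hom])
  qed
qed

lemma complex_algebra_cpa:
  assumes wf: "wf_digraph Q"
  shows "complex_algebra (cpa Q) (\<lambda>c x. c * \<one>\<^bsub>cpa Q\<^esub> x)"
proof -
  interpret ring "cpa Q" by (rule ring_cpa[OF wf])
  have left: "(\<lambda>x. c * \<one>\<^bsub>cpa Q\<^esub> x) \<otimes>\<^bsub>cpa Q\<^esub> f = (\<lambda>x. c * f x)" if f: "f \<in> carrier (cpa Q)" for c f
  proof
    fix x
    have "((\<lambda>x. c * \<one>\<^bsub>cpa Q\<^esub> x) \<otimes>\<^bsub>cpa Q\<^esub> f) x = c * (\<one>\<^bsub>cpa Q\<^esub> \<otimes>\<^bsub>cpa Q\<^esub> f) x"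
      by (simp add: cpa_simps(2) sum_distrib_left case_prod_beta mult.assoc)
    then show "((\<lambda>x. c * \<one>\<^bsub>cpa Q\<^esub> x) \<otimes>\<^bsub>cpa Q\<^esub> f) x = c * f x" using f by simp
  qed
  have right: "f \<otimes>\<^bsub>cpa Q\<^esub> (\<lambda>x. c * \<one>\<^bsub>cpa Q\<^esub> x) = (\<lambda>x. c * f x)" if f: "f \<in> carrier (cpa Q)" for c f
  proof
    fix x
    have "(f \<otimes>\<^bsub>cpa Q\<^esub> (\<lambda>x. c * \<one>\<^bsub>cpa Q\<^esub> x)) x = c * (f \<otimes>\<^bsub>cpa Q\<^esub> \<one>\<^bsub>cpa Q\<^esub>) x"
      by (simp add: cpa_simps(2) sum_distrib_left case_prod_beta mult.left_commute)
    then show "(f \<otimes>\<^bsub>cpa Q\<^esub> (\<lambda>x. c * \<one>\<^bsub>cpa Q\<^esub> x)) x = c * f x" using f by simp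
  qed
  have closed: "(\<lambda>x. c * \<one>\<^bsub>cpa Q\<^esub> x) \<in> carrier (cpa Q)" for c
    by (simp add: cpa_simps(1,3))
  show ?thesis
    by (intro complex_algebra.intro complex_algebra_axioms.intro ring_axioms)
      (simp_all add: left right closed, simp_all add: cpa_simps fun_eq_iff distrib_right)
qed

lemma complex_algebra_qalg:
  assumes "wf_digraph Q" "ideal J (cpa Q)"
  shows "complex_algebra (qalg Q J) (qalg_scalar Q J)"
  using complex_algebra.complex_algebra_quotient[OF complex_algebra_cpa[OF assms(1)] assms(2)]
  unfolding qalg_scalar_def[abs_def] .

lemma quotient_hom:
  assumes "ring R" "ring S" and h: "h \<in> Ring.ring_hom R S" and surj: "h ` carrier R = carrier S"
    and "ideal I R"
  shows "ideal (h ` I) S"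
    and "\<And>r. r \<in> carrier R \<Longrightarrow> h ` (I +>\<^bsub>R\<^esub> r) = h ` I +>\<^bsub>S\<^esub> h r"
    and "(`) h \<in> Ring.ring_hom (R Quot I) (S Quot (h ` I))"
    and "(`) h ` carrier (R Quot I) = carrier (S Quot (h ` I))"
proof -
  interpret R: ring R by fact
  interpret S: ring S by fact
  interpret h: ring_hom_ring R S h
    by (intro ring_hom_ringI2 R.ring_axioms S.ring_axioms h)
  interpret I: ideal I R by fact
  show hI: "ideal (h ` I) S"
  proof (rule idealI[OF S.ring_axioms])
    show "subgroup (h ` I) (add_monoid S)"
    proof (rule S.add.subgroupI)
      show "h ` I \<subseteq> carrier S" using I.Icarr h.hom_closed by blast
      show "h ` I \<noteq> {}" using I.zero_closed by blast
    next
      fix a assume "a \<in> h ` I"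
      then obtain i where i: "i \<in> I" "a = h i" by blast
      show "\<ominus>\<^bsub>S\<^esub> a \<in> h ` I"
        unfolding i(2) h.hom_a_inv[OF I.Icarr[OF i(1)], symmetric]
        by (rule imageI[OF I.a_inv_closed[OF i(1)]])
    next
      fix a b assume "a \<in> h ` I" "b \<in> h ` I"
      then obtain i j where i: "i \<in> I" "a = h i" and j: "j \<in> I" "b = h j" by blast
      show "a \<oplus>\<^bsub>S\<^esub> b \<in> h ` I"
        unfolding i(2) j(2) h.hom_add[OF I.Icarr[OF i(1)] I.Icarr[OF j(1)], symmetric]
        by (rule imageI[OF I.a_closed[OF i(1) j(1)]])
    qed
  next
    fix a s assume "a \<in> h ` I" "s \<in> carrier S"
    then obtain i r where i: "i \<in> I" "a = h i" and r: "r \<in> carrier R" "s = h r"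
      using surj by blast
    show "s \<otimes>\<^bsub>S\<^esub> a \<in> h ` I"
      unfolding i(2) r(2) h.hom_mult[OF r(1) I.Icarr[OF i(1)], symmetric]
      by (rule imageI[OF I.I_l_closed[OF i(1) r(1)]])
    show "a \<otimes>\<^bsub>S\<^esub> s \<in> h ` I"
      unfolding i(2) r(2) h.hom_mult[OF I.Icarr[OF i(1)] r(1), symmetric]
      by (rule imageI[OF I.I_r_closed[OF i(1) r(1)]])
  qed
  interpret hI: ideal "h ` I" S by (rule hI)
  show coset: "h ` (I +>\<^bsub>R\<^esub> r) = h ` I +>\<^bsub>S\<^esub> h r" if r: "r \<in> carrier R" for r
  proof -
    have "(\<lambda>i. h (i \<oplus>\<^bsub>R\<^esub> r)) ` I = (\<lambda>i. h i \<oplus>\<^bsub>S\<^esub> h r) ` I"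
      by (rule image_cong[OF refl]) (use r in simp)
    then show ?thesis
      by (simp only: a_r_coset_def' UNION_singleton_eq_range image_image)
  qed
  have rep: "\<exists>r\<in>carrier R. X = I +>\<^bsub>R\<^esub> r" if "X \<in> carrier (R Quot I)" for X
    using that unfolding carrier_Quot by blast
  have carrS: "carrier (S Quot (h ` I)) = (\<lambda>r. h ` I +>\<^bsub>S\<^esub> h r) ` carrier R"
    unfolding carrier_Quot surj[symmetric] by (rule image_image)
  show "(`) h ` carrier (R Quot I) = carrier (S Quot (h ` I))"
    unfolding carrier_Quot[of R] carrS image_image by (rule image_cong[OF refl coset])
  note qR = I.rcos_ring_hom and qS = hI.rcos_ring_hom
  show "(`) h \<in> Ring.ring_hom (R Quot I) (S Quot (h ` I))"
  proof (rule ring_hom_memI)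
    fix X assume "X \<in> carrier (R Quot I)"
    then obtain r where r: "r \<in> carrier R" "X = I +>\<^bsub>R\<^esub> r" using rep by meson
    show "h ` X \<in> carrier (S Quot (h ` I))"
      unfolding carrS r(2) coset[OF r(1)] by (rule imageI[OF r(1)])
    fix Y assume "Y \<in> carrier (R Quot I)"
    then obtain r s where rs: "r \<in> carrier R" "X = I +>\<^bsub>R\<^esub> r" "s \<in> carrier R" "Y = I +>\<^bsub>R\<^esub> s"
      using rep \<open>X \<in> carrier (R Quot I)\<close> by meson
    show "h ` (X \<otimes>\<^bsub>R Quot I\<^esub> Y) = h ` X \<otimes>\<^bsub>S Quot (h ` I)\<^esub> h ` Y"
      unfolding rs(2,4) ring_hom_mult[OF qR rs(1,3), symmetric] coset[OF rs(1)] coset[OF rs(3)]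
        coset[OF R.m_closed[OF rs(1,3)]] ring_hom_mult[OF h rs(1,3)]
      by (rule ring_hom_mult[OF qS]) (use rs in auto)
    show "h ` (X \<oplus>\<^bsub>R Quot I\<^esub> Y) = h ` X \<oplus>\<^bsub>S Quot (h ` I)\<^esub> h ` Y"
      unfolding rs(2,4) ring_hom_add[OF qR rs(1,3), symmetric] coset[OF rs(1)] coset[OF rs(3)]
        coset[OF R.a_closed[OF rs(1,3)]] ring_hom_add[OF h rs(1,3)]
      by (rule ring_hom_add[OF qS]) (use rs in auto)
  next
    show "h ` \<one>\<^bsub>R Quot I\<^esub> = \<one>\<^bsub>S Quot (h ` I)\<^esub>"
      unfolding ring_hom_one[OF qR, symmetric] coset[OF R.one_closed] ring_hom_one[OF h]
      by (rule ring_hom_one[OF qS])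
  qed
qed

lemma simple_module_simps [simp]:
  "carrier (simple_module i) = UNIV"
  "zero (simple_module i) = 0"
  "add (simple_module i) = (+)"
  by (simp_all add: simple_module_def)

text \<open>
  All elements of a coset of \<open>J\<close> have the same constant terms, so the action does not depend on the
  representative.
\<close>

lemma simple_module_smult:
  assumes "ideal J (cpa Q)" "J \<subseteq> cpa_radical Q" "f \<in> carrier (cpa Q)"
  shows "(J +>\<^bsub>cpa Q\<^esub> f) \<odot>\<^bsub>simple_module i\<^esub> z = f (i, [], i) * z"
proof -
  have "(\<lambda>f. f (i, [], i)) ` (J +>\<^bsub>cpa Q\<^esub> f) = {f (i, [], i)}"
    using assms(2) additive_subgroup.zero_closed[OF ideal.axioms(1)[OF assms(1)]]
    by (auto simp: a_r_coset_def' cpa_simps(4,5) cpa_radical_def image_iff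
        intro!: bexI[of _ "\<zero>\<^bsub>cpa Q\<^esub>"])
  then show ?thesis by (simp add: simple_module_def)
qed

lemma left_module_simple:
  assumes wf: "wf_digraph Q" and J: "ideal J (cpa Q)" "J \<subseteq> cpa_radical Q" and i: "i \<in> verts Q"
  shows "left_module (qalg Q J) (simple_module i)"
proof -
  interpret P: ring "cpa Q" by (rule ring_cpa[OF wf])
  interpret J: ideal J "cpa Q" by (rule J)
  note q = J.rcos_ring_hom and smult = simple_module_smult[OF J]
  have ab: "abelian_group (simple_module i)"
  proof (rule abelian_groupI)
    fix x show "\<exists>y\<in>carrier (simple_module i). y \<oplus>\<^bsub>simple_module i\<^esub> x = \<zero>\<^bsub>simple_module i\<^esub>"
      by (rule bexI[of _ "- x"]) simp_all
  qed simp_all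
  have rep: "\<exists>f\<in>carrier (cpa Q). X = J +>\<^bsub>cpa Q\<^esub> f" if "X \<in> carrier (qalg Q J)" for X
    using that unfolding carrier_Quot by blast
  show ?thesis
  proof (intro left_module.intro left_module_axioms.intro J.quotient_is_ring ab)
    fix X z assume "X \<in> carrier (qalg Q J)"
    then obtain f where f: "f \<in> carrier (cpa Q)" "X = J +>\<^bsub>cpa Q\<^esub> f" using rep by meson
    fix y show "X \<odot>\<^bsub>simple_module i\<^esub> (z \<oplus>\<^bsub>simple_module i\<^esub> y) =
        X \<odot>\<^bsub>simple_module i\<^esub> z \<oplus>\<^bsub>simple_module i\<^esub> X \<odot>\<^bsub>simple_module i\<^esub> y"
      unfolding f(2) smult[OF f(1)] simple_module_simps by (rule distrib_left)
  next
    fix X Y z assume "X \<in> carrier (qalg Q J)" "Y \<in> carrier (qalg Q J)"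
    then obtain f g where f: "f \<in> carrier (cpa Q)" "X = J +>\<^bsub>cpa Q\<^esub> f"
      and g: "g \<in> carrier (cpa Q)" "Y = J +>\<^bsub>cpa Q\<^esub> g" using rep by meson
    show "(X \<oplus>\<^bsub>qalg Q J\<^esub> Y) \<odot>\<^bsub>simple_module i\<^esub> z =
        X \<odot>\<^bsub>simple_module i\<^esub> z \<oplus>\<^bsub>simple_module i\<^esub> Y \<odot>\<^bsub>simple_module i\<^esub> z"
      unfolding f(2) g(2) ring_hom_add[OF q f(1) g(1), symmetric] smult[OF f(1)] smult[OF g(1)]
        smult[OF P.a_closed[OF f(1) g(1)]] cpa_simps(5) simple_module_simps
      by (rule distrib_right)
    show "(X \<otimes>\<^bsub>qalg Q J\<^esub> Y) \<odot>\<^bsub>simple_module i\<^esub> z =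
        X \<odot>\<^bsub>simple_module i\<^esub> (Y \<odot>\<^bsub>simple_module i\<^esub> z)"
      unfolding f(2) g(2) ring_hom_mult[OF q f(1) g(1), symmetric] smult[OF f(1)] smult[OF g(1)]
        smult[OF cpa_mult_closed] cpa_mult_trivial[OF f(1)]
      by (rule mult.assoc)
  next
    fix z
    have "\<one>\<^bsub>cpa Q\<^esub> (i, [], i) = (1 :: complex)" using i by (simp add: cpa_simps(3) qpaths_Nil)
    then show "\<one>\<^bsub>qalg Q J\<^esub> \<odot>\<^bsub>simple_module i\<^esub> z = z"
      unfolding ring_hom_one[OF q, symmetric] smult[OF P.one_closed] by simp
  qed simp_all
qed

section \<open>Dependence of Hom and Ext on the scalar action\<close>

lemma finsum_cong_record:
  assumes "carrier N = carrier N'" "zero N = zero N'" "add N = add N'"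
  shows "finsum N = finsum N'"
  by (intro ext) (simp add: finsum_def finprod_def assms)

lemma syzygy_cong:
  assumes N: "left_module R N"
    and eq: "carrier N' = carrier N" "zero N' = zero N" "add N' = add N"
    and smult: "\<And>r x. \<lbrakk>r \<in> carrier R; x \<in> carrier N\<rbrakk> \<Longrightarrow> r \<odot>\<^bsub>N'\<^esub> x = r \<odot>\<^bsub>N\<^esub> x"
  shows "syzygy R N' = syzygy R N"
proof -
  interpret left_module R N by (rule N)
  have "free_cover R N' f = free_cover R N f" if f: "f \<in> carrier (free_module R (carrier N))" for f
    unfolding free_cover_def finsum_cong_record[OF eq] eq
    by (rule M.finsum_cong') (use R.free_module_value[OF f] smult in \<open>auto intro: smult_closed\<close>)
  then show ?thesis unfolding syzygy_def eq by (simp cong: conj_cong)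
qed

lemma ext1_cong:
  assumes "left_module R N"
    and "carrier N' = carrier N" "zero N' = zero N" "add N' = add N"
    and "\<And>r x. \<lbrakk>r \<in> carrier R; x \<in> carrier N\<rbrakk> \<Longrightarrow> r \<odot>\<^bsub>N'\<^esub> x = r \<odot>\<^bsub>N\<^esub> x"
  shows "ext1 \<eta> R N' M = ext1 \<eta> R N M"
proof -
  have "syzygy R N' = syzygy R N"
    by (rule syzygy_cong) (use assms in auto)
  then show ?thesis by (simp only: ext1_def assms(2))
qed

text \<open>
  The simple module at \<open>i\<close> is the same record over both algebras, while restriction of scalars produces
  one that agrees with it only for scalars in the carrier.  Together with \<open>ext1_cong\<close> this lemma
  identifies the two.
\<close>

lemma hom_space_cong:
  assumes "carrier N' = carrier N" "zero N' = zero N" "add N' = add N"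
    and "\<And>r x. \<lbrakk>r \<in> carrier R; x \<in> carrier N\<rbrakk> \<Longrightarrow> r \<odot>\<^bsub>N'\<^esub> x = r \<odot>\<^bsub>N\<^esub> x"
  shows "hom_space \<eta> R N' M = hom_space \<eta> R N M"
proof -
  have "module_hom R N' M = module_hom R N M"
  proof (intro equalityI subsetI)
    fix f assume f: "f \<in> module_hom R N' M"
    show "f \<in> module_hom R N M"
      by (rule module_homI)
        (use module_hom_closed[OF f] module_hom_add[OF f] module_hom_smult[OF f] in
          \<open>auto simp: assms\<close>)
  next
    fix f assume f: "f \<in> module_hom R N M"
    show "f \<in> module_hom R N' M"
      by (rule module_homI)
        (use module_hom_closed[OF f] module_hom_add[OF f] module_hom_smult[OF f] in
          \<open>auto simp: assms\<close>)
  qed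
  then show ?thesis unfolding hom_space_def assms(1) by simp
qed

lemma (in scalar_change) hom_space_restrict_scalars:
  "hom_space \<theta> S (restrict_scalars \<pi> N) (restrict_scalars \<pi> M) = hom_space \<eta> R N M"
proof -
  have eq: "module_hom S (restrict_scalars \<pi> N) (restrict_scalars \<pi> M) = module_hom R N M"
  proof (intro equalityI subsetI)
    fix f assume f: "f \<in> module_hom S (restrict_scalars \<pi> N) (restrict_scalars \<pi> M)"
    show "f \<in> module_hom R N M"
    proof (rule module_homI)
      fix r x assume "r \<in> carrier R" and x: "x \<in> carrier N"
      then obtain s where "s \<in> carrier S" "r = \<pi> s" using surj by blast
      then show "f (r \<odot>\<^bsub>N\<^esub> x) = r \<odot>\<^bsub>M\<^esub> f x" using module_hom_smult[OF f] x by simp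
    qed (use module_hom_closed[OF f] module_hom_add[OF f] in auto)
  next
    fix f assume f: "f \<in> module_hom R N M"
    show "f \<in> module_hom S (restrict_scalars \<pi> N) (restrict_scalars \<pi> M)"
      by (rule module_homI)
        (use module_hom_closed[OF f] in
          \<open>auto simp: module_hom_add[OF f] module_hom_smult[OF f] ring_hom_closed[OF hom]\<close>)
  qed
  show ?thesis unfolding hom_space_def eq restrict_scalars_simps scalar ..
qed

lemma (in complex_algebra) finitely_spanned:
  assumes M: "left_module R M"
    and fd: "vectorspace.fin_dim (class_ring :: complex ring) (restrict_scalars \<eta> M)"
    and X: "X \<subseteq> carrier M"
  shows "\<exists>B. finite B \<and> B \<subseteq> X \<and> X \<subseteq> left_module.lin_span M (carrier R) B"
proof -
  interpret M: left_module R M by (rule M)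
  interpret V: vectorspace "class_ring :: complex ring" "restrict_scalars \<eta> M"
    by (rule vectorspace_scalars[OF M])
  obtain B where B: "finite B" "B \<subseteq> X" "X \<subseteq> V.span B"
    using V.finite_subset_spanning[OF fd, of X] X by auto
  have "x \<in> M.lin_span (carrier R) B" if x: "x \<in> X" for x
  proof -
    have "x \<in> V.span B" "B \<subseteq> carrier (restrict_scalars \<eta> M)" using B X x by auto
    then obtain a where "x = V.lincomb a B"
      using V.finite_in_span[OF B(1), of x] by metis
    then have "x = (\<Oplus>\<^bsub>M\<^esub>b\<in>B. \<eta> (a b) \<odot>\<^bsub>M\<^esub> b)"
      unfolding V.lincomb_def finsum_restrict_scalars restrict_scalars_simps .
    then show ?thesis
      unfolding M.lin_span_def using scalar_closed
      by (intro CollectI exI[of _ "\<lambda>b. \<eta> (a b)"]) auto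
  qed
  with B show ?thesis by blast
qed

section \<open>Restricting to a full subquiver\<close>

locale path_algebra_restriction =
  fixes Qt :: "('v, 'a) pre_digraph" and V :: "'v set"
    and \<rho> :: "(('v, 'a) qpath \<Rightarrow> complex) \<Rightarrow> (('v, 'a) qpath \<Rightarrow> complex)"
    and Jt :: "(('v, 'a) qpath \<Rightarrow> complex) set"
  assumes fin: "fin_digraph Qt"
    and \<rho>: "is_restriction_hom Qt (arrow_restrict Qt V) \<rho>"
    and Jt: "ideal Jt (cpa Qt)"
    and Jt_radical: "Jt \<subseteq> cpa_radical Qt"
begin

abbreviation Q where "Q \<equiv> arrow_restrict Qt V"
abbreviation J where "J \<equiv> \<rho> ` Jt"

lemma wf: "wf_digraph Qt" "wf_digraph Q"
  using fin by (auto simp: fin_digraph_def wf_arrow_restrict)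

lemma \<rho>_hom: "\<rho> \<in> Ring.ring_hom (cpa Qt) (cpa Q)"
  using \<rho> by (simp add: is_restriction_hom_def)

lemma \<rho>_apply:
  "f \<in> carrier (cpa Qt) \<Longrightarrow> \<rho> f = (\<lambda>x. if x \<in> qpaths Q then f x else 0)"
  by (rule restriction_hom_apply[OF fin \<rho>])

lemma \<rho>_surj: "\<rho> ` carrier (cpa Qt) = carrier (cpa Q)"
proof
  show "carrier (cpa Q) \<subseteq> \<rho> ` carrier (cpa Qt)"
  proof
    fix f assume f: "f \<in> carrier (cpa Q)"
    then have "f \<in> carrier (cpa Qt)"
      using qpaths_arrow_restrict[of Qt V] by (auto simp: cpa_simps(1))
    moreover from this have "f = \<rho> f" using f \<rho>_apply by (auto simp: cpa_simps(1))
    ultimately show "f \<in> \<rho> ` carrier (cpa Qt)" by blast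
  qed
qed (use ring_hom_closed[OF \<rho>_hom] in blast)

lemma \<rho>_trivial:
  "f \<in> carrier (cpa Qt) \<Longrightarrow> \<rho> f (v, [], v) = f (v, [], v)"
  using \<rho>_apply by (auto simp: qpaths_Nil cpa_simps(1))

lemmas quotient = quotient_hom[OF ring_cpa[OF wf(1)] ring_cpa[OF wf(2)] \<rho>_hom \<rho>_surj Jt]

lemma J_radical: "J \<subseteq> cpa_radical Q"
proof
  fix g assume "g \<in> J"
  then obtain f where f: "f \<in> Jt" "g = \<rho> f" by blast
  then have "f \<in> cpa_radical Qt" using Jt_radical by blast
  then show "g \<in> cpa_radical Q"
    using f ring_hom_closed[OF \<rho>_hom] \<rho>_trivial by (auto simp: cpa_radical_def)
qed

lemma scalar_coset: "\<rho> ` (qalg_scalar Qt Jt c) = qalg_scalar Q J c"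
proof -
  interpret complex_algebra "cpa Qt" "\<lambda>c x. c * \<one>\<^bsub>cpa Qt\<^esub> x" by (rule complex_algebra_cpa[OF wf(1)])
  have "\<rho> (\<lambda>x. c * \<one>\<^bsub>cpa Qt\<^esub> x) = (\<lambda>x. c * \<rho> \<one>\<^bsub>cpa Qt\<^esub> x)"
    using \<rho> by (simp add: is_restriction_hom_def)
  then show ?thesis
    using quotient(2)[OF scalar_closed[of c]] ring_hom_one[OF \<rho>_hom] by (simp add: qalg_scalar_def)
qed

sublocale scalar_change "qalg Qt Jt" "qalg_scalar Qt Jt" "qalg Q J" "qalg_scalar Q J" "(`) \<rho>"
  by (intro scalar_change.intro scalar_change_axioms.intro complex_algebra_qalg wf Jt quotient
      scalar_coset)

context
  fixes M :: "((('v, 'a) qpath \<Rightarrow> complex) set, 'm) module" and i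
  assumes M: "left_module (qalg Q J) M"
    and fd: "vectorspace.fin_dim class_ring (restrict_scalars (qalg_scalar Q J) M)"
    and supp: "\<And>j. j \<in> verts Qt - V \<Longrightarrow> vertex_space Q J M j = {\<zero>\<^bsub>M\<^esub>}"
    and i: "i \<in> verts Qt" "i \<in> V"
begin

lemma simple: "left_module (qalg Q J) (simple_module i)"
  using left_module_simple[OF wf(2) quotient(1) J_radical] i by simp

lemma simple_smult:
  assumes "X \<in> carrier (qalg Qt Jt)"
  shows "X \<odot>\<^bsub>simple_module i\<^esub> z = (\<rho> ` X) \<odot>\<^bsub>simple_module i\<^esub> z"
proof -
  obtain f where f: "f \<in> carrier (cpa Qt)" "X = Jt +>\<^bsub>cpa Qt\<^esub> f"
    using assms unfolding carrier_Quot by blast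
  then show ?thesis
    using simple_module_smult[OF Jt Jt_radical f(1)] \<rho>_trivial[OF f(1)]
      simple_module_smult[OF quotient(1) J_radical ring_hom_closed[OF \<rho>_hom f(1)]] quotient(2)[OF f(1)]
    by simp
qed

text \<open>
  Such an \<open>s\<close> is represented by a series that vanishes on all paths inside \<open>V\<close>.  For these series \<open>f\<close>,
  the multiple of the basis element \<open>x\<close> by \<open>f\<close> lies in the syzygy, because \<open>f\<close> has no constant term at
  \<open>i\<close>, and \<open>\<phi>\<close> is zero there by \<open>outer_series_hom_zero\<close>.
\<close>

lemma hom_from_syzygy_kills_kernel:
  assumes \<phi>: "\<phi> \<in> module_hom (qalg Qt Jt)
      (syzygy (qalg Qt Jt) (restrict_scalars ((`) \<rho>) (simple_module i))) (restrict_scalars ((`) \<rho>) M)"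
    and s: "s \<in> carrier (qalg Qt Jt)" "\<rho> ` s = \<zero>\<^bsub>qalg Q J\<^esub>"
  shows "\<phi> (free_single (qalg Qt Jt) x s) = \<zero>\<^bsub>M\<^esub>"
proof -
  let ?S = "qalg Qt Jt" and ?SN = "restrict_scalars ((`) \<rho>) (simple_module i)"
  let ?K = "syzygy ?S ?SN" and ?D = "outer_series Qt V"
  let ?c = "\<lambda>f. Jt +>\<^bsub>cpa Qt\<^esub> f"
  interpret Jt: ideal Jt "cpa Qt" by (rule Jt)
  interpret J: ideal J "cpa Q" by (rule quotient(1))
  interpret M: left_module "qalg Q J" M by (rule M)
  interpret SN: plain_left_module ?S ?SN
    using plain_modules(2)[OF simple] .
  have c: "?c \<in> Ring.ring_hom (cpa Qt) ?S" by (rule Jt.rcos_ring_hom)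
  let ?M = "restrict_scalars ?c (restrict_scalars ((`) \<rho>) M)"
  have SM: "left_module ?S (restrict_scalars ((`) \<rho>) M)"
    by (rule left_module_restrict_scalars[OF M S.ring_axioms hom])
  have cM: "left_module (cpa Qt) ?M"
    by (rule left_module_restrict_scalars[OF SM ring_cpa[OF wf(1)] c])
  have cM_smult: "f \<odot>\<^bsub>?M\<^esub> m = (J +>\<^bsub>cpa Q\<^esub> \<rho> f) \<odot>\<^bsub>M\<^esub> m" if "f \<in> carrier (cpa Qt)" for f m
    using quotient(2)[OF that] by simp
  define \<Psi> where "\<Psi> f = \<phi> (free_single ?S x (?c f))" for f
  have mem: "free_single ?S x (?c f) \<in> carrier ?K" if f: "f \<in> ?D" for f
  proof -
    have fc: "f \<in> carrier (cpa Qt)" using f by (simp add: outer_series_def)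
    have "f (i, [], i) = 0" using f i by (auto simp: outer_series_def qpaths_Nil)
    then have "\<rho> ` ?c f \<odot>\<^bsub>simple_module i\<^esub> x = 0"
      using simple_smult[OF ring_hom_closed[OF c fc]] simple_module_smult[OF Jt Jt_radical fc] by simp
    then show ?thesis
      using SN.free_cover_single[of x "?c f"] ring_hom_closed[OF c fc]
      by (simp add: carrier_syzygy S.free_single_closed)
  qed
  have zero: "\<Psi> f = \<zero>\<^bsub>?M\<^esub>" if "f \<in> ?D" for f
  proof (rule outer_series_hom_zero[OF fin cM _ _ _ _ _ that])
    interpret P: complex_algebra "cpa Qt" "\<lambda>c x. c * \<one>\<^bsub>cpa Qt\<^esub> x"
      by (rule complex_algebra_cpa[OF wf(1)])
    have "restrict_scalars (\<lambda>c x. c * \<one>\<^bsub>cpa Qt\<^esub> x) ?M = restrict_scalars (qalg_scalar Q J) M"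
      unfolding restrict_scalars_comp scalar_coset[symmetric] qalg_scalar_def[symmetric] ..
    then show "\<exists>B. finite B \<and> B \<subseteq> X \<and> X \<subseteq> left_module.lin_span ?M (carrier (cpa Qt)) B"
      if "X \<subseteq> carrier ?M" for X
      using P.finitely_spanned[OF cM _ that] fd by simp
  next
    fix j m assume j: "j \<in> verts Qt - V" and m: "m \<in> carrier ?M"
    have "\<rho> (idem_elem j) = idem_elem j" using \<rho> j by (simp add: is_restriction_hom_def)
    then have "idem_elem j \<odot>\<^bsub>?M\<^esub> m \<in> vertex_space Q J M j"
      using cM_smult[OF idem_elem_carrier] j m by (auto simp: vertex_space_def)
    then show "idem_elem j \<odot>\<^bsub>?M\<^esub> m = \<zero>\<^bsub>?M\<^esub>" using supp[OF j] by simp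
  next
    fix f assume f: "f \<in> ?D"
    show "\<Psi> f \<in> carrier ?M"
      using module_hom_closed[OF \<phi>] mem[OF f] by (auto simp: \<Psi>_def)
    have fc: "f \<in> carrier (cpa Qt)" using f by (simp add: outer_series_def)
    fix g
    {
      assume g: "g \<in> ?D"
      then have gc: "g \<in> carrier (cpa Qt)" by (simp add: outer_series_def)
      have "free_single ?S x (?c (f \<oplus>\<^bsub>cpa Qt\<^esub> g)) =
          free_single ?S x (?c f) \<oplus>\<^bsub>?K\<^esub> free_single ?S x (?c g)"
        by (auto simp: fun_eq_iff free_single_def ring_hom_add[OF c fc gc])
      then show "\<Psi> (f \<oplus>\<^bsub>cpa Qt\<^esub> g) = \<Psi> f \<oplus>\<^bsub>?M\<^esub> \<Psi> g"
        using module_hom_add[OF \<phi> mem[OF f] mem[OF g]] by (simp add: \<Psi>_def)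
    next
      assume gc: "g \<in> carrier (cpa Qt)"
      have "free_single ?S x (?c (g \<otimes>\<^bsub>cpa Qt\<^esub> f)) = ?c g \<odot>\<^bsub>?K\<^esub> free_single ?S x (?c f)"
        using ring_hom_closed[OF c gc] by (auto simp: fun_eq_iff free_single_def ring_hom_mult[OF c gc fc])
      then show "\<Psi> (g \<otimes>\<^bsub>cpa Qt\<^esub> f) = g \<odot>\<^bsub>?M\<^esub> \<Psi> f"
        using module_hom_smult[OF \<phi> ring_hom_closed[OF c gc] mem[OF f]] by (simp add: \<Psi>_def)
    }
  qed
  obtain f where f: "f \<in> carrier (cpa Qt)" "s = ?c f"
    using s(1) unfolding carrier_Quot by blast
  have "J +>\<^bsub>cpa Q\<^esub> \<rho> f = J"
    unfolding quotient(2)[OF f(1), symmetric] f(2)[symmetric] s(2) by (simp add: FactRing_def)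
  then have "\<rho> f \<in> J"
    using J.a_rcos_self[OF ring_hom_closed[OF \<rho>_hom f(1)]] by (rule subst)
  then obtain j where j: "j \<in> Jt" "\<rho> f = \<rho> j" by blast
  have jc: "j \<in> carrier (cpa Qt)" using j(1) by (rule Jt.Icarr)
  \<comment> \<open>Changing the representative by an element of the ideal makes its image under \<open>\<rho>\<close> zero.\<close>
  let ?f = "\<ominus>\<^bsub>cpa Qt\<^esub> j \<oplus>\<^bsub>cpa Qt\<^esub> f"
  have fval: "?f = (\<lambda>x. f x - j x)" by (simp add: cpa_uminus[OF wf(1) jc]) (simp add: cpa_def)
  have "?f \<in> ?c f" using j(1) by (auto simp: a_r_coset_def')
  then have s_eq: "s = ?c ?f"
    unfolding f(2) by (rule Jt.a_repr_independence'[OF _ f(1)])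
  have "f y = j y" if "y \<in> qpaths Q" for y
    using fun_cong[OF j(2), of y] that \<rho>_apply[OF f(1)] \<rho>_apply[OF jc] by simp
  then have "?f \<in> ?D"
    using f(1) jc by (simp add: outer_series_def fval cpa_simps(1))
  then show ?thesis using zero[of ?f] s_eq by (simp add: \<Psi>_def)
qed

theorem simple_hom_space_eq:
  "hom_space (qalg_scalar Qt Jt) (qalg Qt Jt) (simple_module i) (restrict_scalars ((`) \<rho>) M) =
    hom_space (qalg_scalar Q J) (qalg Q J) (simple_module i) M"
  unfolding hom_space_restrict_scalars[symmetric]
  by (rule hom_space_cong) (simp_all add: simple_smult)

theorem dim_simple_ext1_eq:
  "cdim (ext1 (qalg_scalar Qt Jt) (qalg Qt Jt) (simple_module i) (restrict_scalars ((`) \<rho>) M)) =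
    cdim (ext1 (qalg_scalar Q J) (qalg Q J) (simple_module i) M)"
proof -
  have "ext1 (qalg_scalar Qt Jt) (qalg Qt Jt) (simple_module i) (restrict_scalars ((`) \<rho>) M) =
    ext1 (qalg_scalar Qt Jt) (qalg Qt Jt) (restrict_scalars ((`) \<rho>) (simple_module i))
      (restrict_scalars ((`) \<rho>) M)"
    by (rule ext1_cong[OF left_module_restrict_scalars[OF simple S.ring_axioms hom]])
      (simp_all add: simple_smult)
  then show ?thesis
    using dim_ext1_change_of_rings[OF simple M] hom_from_syzygy_kills_kernel by simp
qed

end

end

lemma arrow_ideal_radical:
  assumes wf: "wf_digraph Q" shows "arrow_ideal Q \<subseteq> cpa_radical Q"
  unfolding arrow_ideal_def
  by (rule ring.genideal_minimal[OF ring_cpa[OF wf] ideal_cpa_radical[OF wf]])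
    (use arrow_elem_radical[OF wf] in blast)

lemma ideal_power_radical:
  assumes wf: "wf_digraph Q" shows "ideal_power (cpa Q) (arrow_ideal Q) 2 \<subseteq> cpa_radical Q"
proof -
  interpret ring "cpa Q" by (rule ring_cpa[OF wf])
  note I = ideal_arrow_ideal[OF wf]
  have "ideal_power (cpa Q) (arrow_ideal Q) 2 \<subseteq> ideal_power (cpa Q) (arrow_ideal Q) 1"
    by (rule ideal_power_antimono[OF I]) simp
  also have "\<dots> \<subseteq> arrow_ideal Q"
    using ideal_prod_inter[OF I oneideal] by simp
  finally show ?thesis using arrow_ideal_radical[OF wf] by blast
qed

theorem proposition1p3:
  fixes n m :: nat
    and Qt Q :: "(nat, 'a) pre_digraph"
    and \<rho> :: "((nat, 'a) qpath \<Rightarrow> complex) \<Rightarrow> ((nat, 'a) qpath \<Rightarrow> complex)"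
    and Jt J :: "((nat, 'a) qpath \<Rightarrow> complex) set"
    and \<M> :: "(nat, 'a, 'm) decorated"
  assumes "n \<ge> 1"
    and "fin_digraph Qt"
    and "verts Qt = {1..n + m}"
    and "Q = arrow_restrict Qt {1..n}"
    and "is_restriction_hom Qt Q \<rho>"
    and "ideal Jt (cpa Qt)"
    and "closedin (cpa_topology Qt) Jt"
    and "Jt \<subseteq> ideal_power (cpa Qt) (arrow_ideal Qt) 2"
    and "J = \<rho> ` Jt"
    and "decorated_rep Q J \<M>"
    and "supported_in Q J {1..n} \<M>"
  shows "restrict (g_vector Qt Jt {1..n + m} (inflate \<rho> \<M>)) {1..n} = g_vector Q J {1..n} \<M>"
proof -
  have wf: "wf_digraph Qt" using assms(2) by (simp add: fin_digraph_def)
  interpret path_algebra_restriction Qt "{1..n}" \<rho> Jt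
    by (rule path_algebra_restriction.intro)
      (use assms(2,4-6,8) ideal_power_radical[OF wf] in auto)
  have M: "left_module (qalg Q J) (fst \<M>)"
    and fd: "vectorspace.fin_dim class_ring (restrict_scalars (qalg_scalar Q J) (fst \<M>))"
    using assms(10) by (simp_all add: decorated_rep_def)
  have supp: "vertex_space Q J (fst \<M>) j = {\<zero>\<^bsub>fst \<M>\<^esub>}" if "j \<in> verts Qt - {1..n}" for j
    using assms(4,11) that by (simp add: supported_in_def)
  note facts = M[unfolded assms(4,9)] fd[unfolded assms(4,9)] supp[unfolded assms(4,9)]
  have "g_vector Qt Jt {1..n + m} (inflate \<rho> \<M>) i = g_vector Q J {1..n} \<M> i"
    if i: "i \<in> {1..n}" for i
    using i assms(3) simple_hom_space_eq[OF facts, of i] dim_simple_ext1_eq[OF facts, of i]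
    by (simp add: g_vector_def inflate_def assms(4,9))
  then show ?thesis by (auto simp: g_vector_def fun_eq_iff)
qed

end
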